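(* Let $(M,g)$ be a connected smooth Riemannian manifold, let $k\ge 1$ be an integer, and let $\varphi\colon M\to\mathbb{S}^n$ be a smooth $k$-harmonic map into the Euclidean unit sphere. If a nonempty open subset of $M$ is mapped by $\varphi$ into the equator $\mathbb{S}^{n-1}\subset\mathbb{S}^n$, then $\varphi(M)\subset\mathbb{S}^{n-1}$.
   Context: $\mathbb{S}^n\subset\mathbb{R}^{n+1}$ carries the round metric, and the equator $\mathbb{S}^{n-1}$ is the set of points at distance $\pi/2$ from the north pole (the intersection of $\mathbb{S}^n$ with the hyperplane where the last coordinate vanishes). Let $\varphi\colon (M^m,g)\to (N,h)$ be a smooth map. $\bar\nabla$ is the connection induced on the pull-back bundle $\varphi^{-1}TN$; $\{e_j\}_{j=1}^m$ is a local orthonormal frame field on $M$; repeated indices are summed. The second fundamental form is $\nabla d\varphi(X,Y)=\bar\nabla_X d\varphi(Y)-d\varphi(\nabla_XY)$ and the tension field is $\tau(\varphi)=\mathrm{Tr}_g\nabla d\varphi$, a section of $\varphi^{-1}TN$. The rough Laplacian on sections of $\varphi^{-1}TN$ is $\bar\Delta=-\mathrm{Tr}_g(\bar\nabla\bar\nabla-\bar\nabla_\nabla)$, with $\bar\Delta^0=\mathrm{Id}$ and the convention $\bar\Delta^{-1}=0$. The curvature of $N$ is $R^N(X,Y)Z=[\nabla_X,\nabla_Y]Z-\nabla_{[X,Y]}Z$. A $k$-harmonic map is a critical point of the $k$-energy, where $E_1(\varphi)=\frac12\int_M|d\varphi|^2\,dV$, for $k=2s$, $s\ge1$, $E_{2s}(\varphi)=\frac12\int_M\langle\bar\Delta^{s-1}\tau(\varphi),\bar\Delta^{s-1}\tau(\varphi)\rangle\,dV$,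 and for $k=2s+1$, $s\geq 1$, $E_{2s+1}(\varphi)=\frac12\int_M\langle\bar\nabla\bar\Delta^{s-1}\tau(\varphi),\bar\nabla\bar\Delta^{s-1}\tau(\varphi)\rangle\,dV$. Equivalently, $\varphi$ is $k$-harmonic if $\tau_k(\varphi)=0$, where $\tau_1(\varphi)=\tau(\varphi)=:\tau$ and for $s\ge 1$ \[ \tau_{2s}(\varphi)=\bar\Delta^{2s-1}\tau-R^N(\bar\Delta^{2s-2}\tau,d\varphi(e_j))d\varphi(e_j)-\sum_{\ell=1}^{s-1}\Big(R^N(\bar\nabla_{e_j}\bar\Delta^{s+\ell-2}\tau,\bar\Delta^{s-\ell-1}\tau)d\varphi(e_j)-R^N(\bar\Delta^{s+\ell-2}\tau,\bar\nabla_{e_j}\bar\Delta^{s-\ell-1}\tau)d\varphi(e_j)\Big), \] \[ \tau_{2s+1}(\varphi)=\bar\Delta^{2s}\tau-R^N(\bar\Delta^{2s-1}\tau,d\varphi(e_j))d\varphi(e_j)-\sum_{\ell=1}^{s-1}\Big(R^N(\bar\nabla_{e_j}\bar\Delta^{s+\ell-1}\tau,\bar\Delta^{s-\ell-1}\tau)d\varphi(e_j)-R^N(\bar\Delta^{s+\ell-1}\tau,\bar\nabla_{e_j}\bar\Delta^{s-\ell-1}\tau)d\varphi(e_j)\Big)-R^N(\bar\nabla_{e_j}\bar\Delta^{s-1}\tau,\bar\Delta^{s-1}\tau)d\varphi(e_j). \] *)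

theory Defs
  imports "HOL-Analysis.Analysis"
begin

section \<open>Smooth functions and vector fields in Euclidean space\<close>

text \<open>\<open>C_on n f S\<close> is meant for open \<open>S\<close>: all iterated directional derivatives of \<open>f\<close>
  of order at most \<open>n\<close> exist and are continuous on \<open>S\<close>.\<close>

fun C_on :: "nat \<Rightarrow> ('a::euclidean_space \<Rightarrow> 'b::real_normed_vector) \<Rightarrow> 'a set \<Rightarrow> bool" where
  "C_on 0 f S \<longleftrightarrow> continuous_on S f"
| "C_on (Suc n) f S \<longleftrightarrow>
     (\<forall>x\<in>S. f differentiable (at x)) \<and> (\<forall>v. C_on n (\<lambda>x. frechet_derivative f (at x) v) S)"

definition smooth_on :: "('a::euclidean_space \<Rightarrow> 'b::real_normed_vector) \<Rightarrow> 'a set \<Rightarrow> bool" where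
  "smooth_on f S \<longleftrightarrow> (\<forall>n. C_on n f S)"

definition deriv_along ::
    "('a::euclidean_space \<Rightarrow> 'a) \<Rightarrow> ('a \<Rightarrow> 'b::real_normed_vector) \<Rightarrow> 'a \<Rightarrow> 'b" where
  "deriv_along X f = (\<lambda>x. frechet_derivative f (at x) (X x))"


section \<open>Smooth and Riemannian manifolds\<close>

type_synonym ('a, 'm) chart = "'a set \<times> ('a \<Rightarrow> real ^ 'm)"

definition chart_image :: "('a, 'm) chart \<Rightarrow> (real ^ 'm) set" where
  "chart_image c = snd c ` fst c"

definition chart_inv :: "('a, 'm) chart \<Rightarrow> real ^ 'm \<Rightarrow> 'a" where
  "chart_inv c = inv_into (fst c) (snd c)"

text \<open>The atlas \<open>A\<close> need not be maximal. The dimension is \<open>CARD('m)\<close>.\<close>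

locale smooth_manifold =
  fixes M :: "'a topology" and A :: "('a, 'm::finite) chart set"
  assumes Hausdorff: "Hausdorff_space M"
    and second_countable: "second_countable M"
    and chart_domain: "c \<in> A \<Longrightarrow> openin M (fst c)"
    and open_chart_image: "c \<in> A \<Longrightarrow> open (chart_image c)"
    and chart_homeomorphic: "c \<in> A \<Longrightarrow>
      homeomorphic_map (subtopology M (fst c)) (top_of_set (chart_image c)) (snd c)"
    and charts_cover: "(\<Union>c\<in>A. fst c) = topspace M"
    and smooth_transition: "c \<in> A \<Longrightarrow> d \<in> A \<Longrightarrow>
      smooth_on (snd d \<circ> chart_inv c) (snd c ` (fst c \<inter> fst d))"

text \<open>The metric is given by its coordinate matrices: \<open>g c x\<close> is the Gram matrix
  of the coordinate frame of the chart \<open>c\<close> at the point with coordinates \<open>x\<close>.\<close>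

locale riemannian_manifold = smooth_manifold M A
  for M :: "'a topology" and A :: "('a, 'm::finite) chart set" +
  fixes g :: "('a, 'm) chart \<Rightarrow> real ^ 'm \<Rightarrow> real ^ 'm ^ 'm"
  assumes metric_smooth: "c \<in> A \<Longrightarrow> smooth_on (g c) (chart_image c)"
    and metric_sym: "c \<in> A \<Longrightarrow> x \<in> chart_image c \<Longrightarrow> transpose (g c x) = g c x"
    and metric_pos: "c \<in> A \<Longrightarrow> x \<in> chart_image c \<Longrightarrow> v \<noteq> 0 \<Longrightarrow> 0 < v \<bullet> (g c x *v v)"
    and metric_transition: "c \<in> A \<Longrightarrow> d \<in> A \<Longrightarrow> x \<in> snd c ` (fst c \<inter> fst d) \<Longrightarrow>
      t = snd d \<circ> chart_inv c \<Longrightarrow> t' = frechet_derivative t (at x) \<Longrightarrow>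
      v \<bullet> (g c x *v w) = t' v \<bullet> (g d (t x) *v t' w)"


section \<open>Levi-Civita connection and trace in a chart of the domain\<close>

definition christoffel ::
    "(real ^ 'm \<Rightarrow> real ^ 'm ^ 'm) \<Rightarrow> real ^ 'm \<Rightarrow> 'm::finite \<Rightarrow> 'm \<Rightarrow> 'm \<Rightarrow> real" where
  "christoffel G x k i j = (1/2) * (\<Sum>l\<in>UNIV. matrix_inv (G x) $ k $ l *
     (frechet_derivative (\<lambda>y. G y $ j $ l) (at x) (axis i 1)
    + frechet_derivative (\<lambda>y. G y $ i $ l) (at x) (axis j 1)
    - frechet_derivative (\<lambda>y. G y $ i $ j) (at x) (axis l 1)))"

definition levi_civita ::
    "(real ^ 'm \<Rightarrow> real ^ 'm ^ 'm) \<Rightarrow> (real ^ 'm \<Rightarrow> real ^ 'm) \<Rightarrow> (real ^ 'm \<Rightarrow> real ^ 'm)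
     \<Rightarrow> real ^ 'm \<Rightarrow> real ^ 'm::finite" where
  "levi_civita G X Y = (\<lambda>x. deriv_along X Y x
     + (\<chi> k. \<Sum>i\<in>UNIV. \<Sum>j\<in>UNIV. christoffel G x k i j * X x $ i * Y x $ j))"

text \<open>\<open>metric_trace G B\<close> is the metric trace \<open>g\<^sup>i\<^sup>j B(\<partial>\<^sub>i, \<partial>\<^sub>j)\<close> of a tensor \<open>B\<close>, regarded as
  an operation on vector fields. Lemma \<open>metric_trace_orthonormal\<close> identifies it with the
  sum of \<open>B(e\<^sub>j, e\<^sub>j)\<close> over an orthonormal frame.\<close>

definition metric_trace ::
    "(real ^ 'm \<Rightarrow> real ^ 'm ^ 'm)
     \<Rightarrow> ((real ^ 'm \<Rightarrow> real ^ 'm) \<Rightarrow> (real ^ 'm \<Rightarrow> real ^ 'm) \<Rightarrow> real ^ 'm \<Rightarrow> 'v)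
     \<Rightarrow> real ^ 'm::finite \<Rightarrow> 'v::real_vector" where
  "metric_trace G B = (\<lambda>x. \<Sum>i\<in>UNIV. \<Sum>j\<in>UNIV.
     (matrix_inv (G x) $ i $ j) *\<^sub>R B (\<lambda>_. axis i 1) (\<lambda>_. axis j 1) x)"

lemma metric_trace_orthonormal:
  fixes e :: "'m::finite \<Rightarrow> real ^ 'm \<Rightarrow> real ^ 'm"
  assumes tensor: "\<And>X Y. B X Y x =
      (\<Sum>i\<in>UNIV. \<Sum>j\<in>UNIV. (X x $ i * Y x $ j) *\<^sub>R B (\<lambda>_. axis i 1) (\<lambda>_. axis j 1) x)"
    and orthonormal: "\<And>i j. e i x \<bullet> (G x *v e j x) = (if i = j then 1 else 0)"
  shows "metric_trace G B x = (\<Sum>j\<in>UNIV. B (e j) (e j) x)"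
proof -
  define E :: "real ^ 'm ^ 'm" where "E = (\<chi> i j. e i x $ j)"
  have 1: "E ** (G x ** transpose E) = mat 1"
    unfolding vec_eq_iff
  proof (intro allI)
    fix i j
    have "(E ** (G x ** transpose E)) $ i $ j = e i x \<bullet> (G x *v e j x)"
      by (simp add: E_def matrix_matrix_mult_def matrix_vector_mult_def inner_vec_def transpose_def)
    then show "(E ** (G x ** transpose E)) $ i $ j = (mat 1 :: real ^ 'm ^ 'm) $ i $ j"
      by (simp add: orthonormal mat_def)
  qed
  then have "(G x ** transpose E) ** E = mat 1"
    using matrix_left_right_inverse by blast
  then have 2: "G x ** (transpose E ** E) = mat 1"
    by (simp add: matrix_mul_assoc)
  then have 3: "(transpose E ** E) ** G x = mat 1"
    using matrix_left_right_inverse by blast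
  have inv: "matrix_inv (G x) = transpose E ** E"
    unfolding matrix_inv_def
  proof (rule some_equality)
    fix A' assume "G x ** A' = mat 1 \<and> A' ** G x = mat 1"
    then show "A' = transpose E ** E"
      by (metis 2 matrix_mul_assoc matrix_mul_lid matrix_mul_rid)
  qed (simp add: 2 3)
  have ij: "matrix_inv (G x) $ i $ j = (\<Sum>k\<in>UNIV. e k x $ i * e k x $ j)" for i j
    by (simp add: inv E_def matrix_matrix_mult_def transpose_def)
  have "(\<Sum>k\<in>UNIV. B (e k) (e k) x) = (\<Sum>k\<in>UNIV. \<Sum>i\<in>UNIV. \<Sum>j\<in>UNIV.
      (e k x $ i * e k x $ j) *\<^sub>R B (\<lambda>_. axis i 1) (\<lambda>_. axis j 1) x)"
    by (rule sum.cong[OF refl]) (rule tensor)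
  also have "\<dots> = (\<Sum>i\<in>UNIV. \<Sum>k\<in>UNIV. \<Sum>j\<in>UNIV.
      (e k x $ i * e k x $ j) *\<^sub>R B (\<lambda>_. axis i 1) (\<lambda>_. axis j 1) x)"
    by (rule sum.swap)
  also have "\<dots> = (\<Sum>i\<in>UNIV. \<Sum>j\<in>UNIV. \<Sum>k\<in>UNIV.
      (e k x $ i * e k x $ j) *\<^sub>R B (\<lambda>_. axis i 1) (\<lambda>_. axis j 1) x)"
    by (rule sum.cong[OF refl]) (rule sum.swap)
  also have "\<dots> = metric_trace G B x"
    by (simp add: metric_trace_def ij scaleR_sum_left)
  finally show ?thesis by simp
qed


section \<open>The unit sphere as target\<close>

text \<open>The tangent space of the unit sphere at \<open>p\<close> is the orthogonal complement of \<open>p\<close>.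
  The Levi-Civita connection of the round metric is the tangential part of the flat
  derivative; likewise for the connection induced on the pull-back bundle of the tangent
  bundle along \<open>\<phi>\<close>, whose sections are the vector-valued functions \<open>S\<close> with
  \<open>S x\<close> orthogonal to \<open>\<phi> x\<close>.\<close>

definition tangential :: "'v::euclidean_space \<Rightarrow> 'v \<Rightarrow> 'v" where
  "tangential p v = v - (v \<bullet> p) *\<^sub>R p"

definition pullback_conn ::
    "('a::euclidean_space \<Rightarrow> 'v::euclidean_space) \<Rightarrow> ('a \<Rightarrow> 'a) \<Rightarrow> ('a \<Rightarrow> 'v) \<Rightarrow> 'a \<Rightarrow> 'v" where
  "pullback_conn \<phi> X S = (\<lambda>x. tangential (\<phi> x) (deriv_along X S x))"

abbreviation sphere_conn ::
    "('v::euclidean_space \<Rightarrow> 'v) \<Rightarrow> ('v \<Rightarrow> 'v) \<Rightarrow> 'v \<Rightarrow> 'v" where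
  "sphere_conn \<equiv> pullback_conn (\<lambda>q. q)"

definition bracket :: "('v::euclidean_space \<Rightarrow> 'v) \<Rightarrow> ('v \<Rightarrow> 'v) \<Rightarrow> 'v \<Rightarrow> 'v" where
  "bracket X Y = (\<lambda>q. deriv_along X Y q - deriv_along Y X q)"

text \<open>Sanity check: the connection is metric and torsion-free.\<close>

lemma pullback_conn_metric:
  assumes "S differentiable (at x)" "T differentiable (at x)"
    and "S x \<bullet> \<phi> x = 0" "T x \<bullet> \<phi> x = 0"
  shows "deriv_along X (\<lambda>y. S y \<bullet> T y) x =
    pullback_conn \<phi> X S x \<bullet> T x + S x \<bullet> pullback_conn \<phi> X T x"
proof -
  have "((\<lambda>y. S y \<bullet> T y) has_derivative (\<lambda>h. S x \<bullet> frechet_derivative T (at x) h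
      + frechet_derivative S (at x) h \<bullet> T x)) (at x)"
    using assms(1,2) by (intro has_derivative_inner) (simp_all add: frechet_derivative_works)
  from frechet_derivative_at[OF this, symmetric] show ?thesis
    using assms(3,4)
    by (simp add: pullback_conn_def tangential_def deriv_along_def inner_diff inner_commute)
qed

lemma deriv_zero_on_sphere:
  fixes f :: "'v::euclidean_space \<Rightarrow> real"
  assumes "(f has_derivative f') (at p)" "norm p = 1" "v \<bullet> p = 0"
    and "\<And>q. norm q = 1 \<Longrightarrow> f q = 0"
  shows "f' v = 0"
proof -
  define \<gamma> where "\<gamma> t = (1 / sqrt (1 + t\<^sup>2 * (v \<bullet> v))) *\<^sub>R (p + t *\<^sub>R v)" for t :: real
  have pp: "p \<bullet> p = 1" using assms(2) by (simp add: norm_eq_1)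
  have pos: "0 < 1 + t\<^sup>2 * (v \<bullet> v)" for t :: real
    by (metis add_pos_nonneg inner_ge_zero zero_less_one zero_le_mult_iff zero_le_power2)
  have "norm (p + t *\<^sub>R v) = sqrt (1 + t\<^sup>2 * (v \<bullet> v))" for t
    using assms(3) pp
    by (simp add: norm_eq_sqrt_inner inner_add inner_commute power2_eq_square algebra_simps)
  then have "norm (\<gamma> t) = 1" for t
    using pos[of t] by (simp add: \<gamma>_def)
  then have zero: "f (\<gamma> t) = 0" for t using assms(4) by blast
  have "(\<gamma> has_derivative (\<lambda>h. h *\<^sub>R v)) (at 0)"
    unfolding \<gamma>_def by (auto intro!: derivative_eq_intros)
  moreover have "\<gamma> 0 = p" by (simp add: \<gamma>_def)
  ultimately have "((\<lambda>t. f (\<gamma> t)) has_derivative (\<lambda>h. f' (h *\<^sub>R v))) (at 0)"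
    using assms(1) has_derivative_compose[of \<gamma> _ 0 UNIV f f'] by simp
  then have "(\<lambda>h. f' (h *\<^sub>R v)) = (\<lambda>h. 0)"
    unfolding zero by (rule has_derivative_unique) simp
  from fun_cong[OF this, of 1] show ?thesis by simp
qed

lemma deriv_tangent_field:
  fixes X :: "'v::euclidean_space \<Rightarrow> 'v"
  assumes "X differentiable (at p)" "norm p = 1" "v \<bullet> p = 0"
    and tangent: "\<And>q. norm q = 1 \<Longrightarrow> X q \<bullet> q = 0"
  shows "frechet_derivative X (at p) v \<bullet> p = - (X p \<bullet> v)"
proof -
  have "((\<lambda>q. X q \<bullet> q) has_derivative
      (\<lambda>h. X p \<bullet> h + frechet_derivative X (at p) h \<bullet> p)) (at p)"
    using assms(1) by (intro has_derivative_inner) (simp_all add: frechet_derivative_works)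
  from deriv_zero_on_sphere[OF this assms(2,3)] show ?thesis using tangent by force
qed

lemma sphere_conn_torsion_free:
  assumes "X differentiable (at p)" "Y differentiable (at p)" "norm p = 1"
    and "\<And>q. norm q = 1 \<Longrightarrow> X q \<bullet> q = 0" "\<And>q. norm q = 1 \<Longrightarrow> Y q \<bullet> q = 0"
  shows "sphere_conn X Y p - sphere_conn Y X p = bracket X Y p"
  using assms deriv_tangent_field[of X p "Y p"] deriv_tangent_field[of Y p "X p"]
  by (simp add: pullback_conn_def tangential_def bracket_def deriv_along_def inner_commute)

text \<open>\<open>R(X,Y)Z = [\<nabla>\<^sub>X,\<nabla>\<^sub>Y]Z - \<nabla>\<^bsub>[X,Y]\<^esub>Z\<close>. By tensoriality, the curvature on tangent vectors
  \<open>u\<close>, \<open>v\<close>, \<open>w\<close> at \<open>p\<close> may be computed with the tangent fields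
  \<open>q \<mapsto> tangential q u\<close> etc. extending them.\<close>

definition sphere_curv_field ::
    "('v::euclidean_space \<Rightarrow> 'v) \<Rightarrow> ('v \<Rightarrow> 'v) \<Rightarrow> ('v \<Rightarrow> 'v) \<Rightarrow> 'v \<Rightarrow> 'v" where
  "sphere_curv_field X Y Z = (\<lambda>q. sphere_conn X (sphere_conn Y Z) q
     - sphere_conn Y (sphere_conn X Z) q - sphere_conn (bracket X Y) Z q)"

definition sphere_curv :: "'v::euclidean_space \<Rightarrow> 'v \<Rightarrow> 'v \<Rightarrow> 'v \<Rightarrow> 'v" where
  "sphere_curv p u v w =
     sphere_curv_field (\<lambda>q. tangential q u) (\<lambda>q. tangential q v) (\<lambda>q. tangential q w) p"

lemma deriv_along_tangential:
  "deriv_along X (\<lambda>q. tangential q w) q = - (w \<bullet> X q) *\<^sub>R q - (w \<bullet> q) *\<^sub>R X q"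
proof -
  have "((\<lambda>q. tangential q w) has_derivative (\<lambda>h. - (w \<bullet> h) *\<^sub>R q - (w \<bullet> q) *\<^sub>R h)) (at q)"
    unfolding tangential_def by (auto intro!: derivative_eq_intros simp: algebra_simps)
  from frechet_derivative_at[OF this] show ?thesis
    unfolding deriv_along_def by metis
qed

lemma sphere_curv_eq:
  assumes "norm p = 1" "u \<bullet> p = 0" "v \<bullet> p = 0" "w \<bullet> p = 0"
  shows "sphere_curv p u v w = (v \<bullet> w) *\<^sub>R u - (u \<bullet> w) *\<^sub>R v"
proof -
  have pp: "p \<bullet> p = 1" using assms(1) by (simp add: norm_eq_1)
  have conn: "sphere_conn (\<lambda>q. tangential q b) (\<lambda>q. tangential q c) =
      (\<lambda>q. tangential q (- (c \<bullet> tangential q b) *\<^sub>R q - (c \<bullet> q) *\<^sub>R tangential q b))" for b c :: 'a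
    by (simp add: pullback_conn_def deriv_along_tangential)
  have conn2: "sphere_conn (\<lambda>q. tangential q a)
      (\<lambda>q. tangential q (- (c \<bullet> tangential q b) *\<^sub>R q - (c \<bullet> q) *\<^sub>R tangential q b)) p
      = - (b \<bullet> c) *\<^sub>R a + (b \<bullet> c) *\<^sub>R a - (c \<bullet> a) *\<^sub>R b"
    if "a \<bullet> p = 0" "b \<bullet> p = 0" "c \<bullet> p = 0" for a b c :: 'a
  proof -
    note [simp] = that that[unfolded inner_commute[of _ p]] pp
    have "\<exists>D. ((\<lambda>q. tangential q (- (c \<bullet> tangential q b) *\<^sub>R q - (c \<bullet> q) *\<^sub>R tangential q b))
       has_derivative D) (at p) \<and> tangential p (D a) = - (c \<bullet> a) *\<^sub>R b"
      unfolding tangential_def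
      apply (rule exI, rule conjI)
       apply (rule derivative_eq_intros refl)+
      apply (simp add: algebra_simps inner_commute)
      done
    then obtain D where D: "((\<lambda>q. tangential q (- (c \<bullet> tangential q b) *\<^sub>R q
        - (c \<bullet> q) *\<^sub>R tangential q b)) has_derivative D) (at p)"
      and Da: "tangential p (D a) = - (c \<bullet> a) *\<^sub>R b" by blast
    have "tangential p a = a" by (simp add: tangential_def)
    then show ?thesis
      unfolding pullback_conn_def deriv_along_def frechet_derivative_at[OF D, symmetric]
      by (simp add: Da)
  qed
  have br: "bracket (\<lambda>q. tangential q u) (\<lambda>q. tangential q v) p = 0"
    using assms by (simp add: bracket_def deriv_along_tangential)
      (simp add: tangential_def inner_commute)
  show ?thesis
    unfolding sphere_curv_def sphere_curv_field_def conn
    using assms conn2[of u v w] conn2[of v u w] br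
    by (simp add: pullback_conn_def deriv_along_tangential)
      (simp add: tangential_def inner_commute)
qed


section \<open>Polyharmonic maps into the unit sphere\<close>

text \<open>Here \<open>G\<close> is the metric and \<open>\<phi>\<close> the map, both in a chart of the domain.\<close>

definition second_fund_form ::
    "(real ^ 'm \<Rightarrow> real ^ 'm ^ 'm) \<Rightarrow> (real ^ 'm \<Rightarrow> 'v)
     \<Rightarrow> (real ^ 'm \<Rightarrow> real ^ 'm) \<Rightarrow> (real ^ 'm \<Rightarrow> real ^ 'm)
     \<Rightarrow> real ^ 'm::finite \<Rightarrow> 'v::euclidean_space" where
  "second_fund_form G \<phi> X Y =
     (\<lambda>x. pullback_conn \<phi> X (deriv_along Y \<phi>) x - deriv_along (levi_civita G X Y) \<phi> x)"

definition tension ::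
    "(real ^ 'm \<Rightarrow> real ^ 'm ^ 'm) \<Rightarrow> (real ^ 'm \<Rightarrow> 'v)
     \<Rightarrow> real ^ 'm::finite \<Rightarrow> 'v::euclidean_space" where
  "tension G \<phi> = metric_trace G (second_fund_form G \<phi>)"

definition rough_laplacian ::
    "(real ^ 'm \<Rightarrow> real ^ 'm ^ 'm) \<Rightarrow> (real ^ 'm \<Rightarrow> 'v) \<Rightarrow> (real ^ 'm \<Rightarrow> 'v)
     \<Rightarrow> real ^ 'm::finite \<Rightarrow> 'v::euclidean_space" where
  "rough_laplacian G \<phi> S = (\<lambda>x. - metric_trace G (\<lambda>X Y y.
     pullback_conn \<phi> X (pullback_conn \<phi> Y S) y - pullback_conn \<phi> (levi_civita G X Y) S y) x)"

definition laplacian_tension ::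
    "(real ^ 'm \<Rightarrow> real ^ 'm ^ 'm) \<Rightarrow> (real ^ 'm \<Rightarrow> 'v) \<Rightarrow> nat
     \<Rightarrow> real ^ 'm::finite \<Rightarrow> 'v::euclidean_space" where
  "laplacian_tension G \<phi> r = (rough_laplacian G \<phi> ^^ r) (tension G \<phi>)"

text \<open>The trace of \<open>R(S, d\<phi>(e\<^sub>j)) d\<phi>(e\<^sub>j)\<close>.\<close>

definition curv_term ::
    "(real ^ 'm \<Rightarrow> real ^ 'm ^ 'm) \<Rightarrow> (real ^ 'm \<Rightarrow> 'v) \<Rightarrow> (real ^ 'm \<Rightarrow> 'v)
     \<Rightarrow> real ^ 'm::finite \<Rightarrow> 'v::euclidean_space" where
  "curv_term G \<phi> S = metric_trace G (\<lambda>X Y x.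
     sphere_curv (\<phi> x) (S x) (deriv_along X \<phi> x) (deriv_along Y \<phi> x))"

text \<open>The traces of \<open>R(\<nabla>\<^bsub>e\<^sub>j\<^esub>S, T) d\<phi>(e\<^sub>j)\<close> and \<open>R(S, \<nabla>\<^bsub>e\<^sub>j\<^esub>T) d\<phi>(e\<^sub>j)\<close>.\<close>

definition curv_term_left ::
    "(real ^ 'm \<Rightarrow> real ^ 'm ^ 'm) \<Rightarrow> (real ^ 'm \<Rightarrow> 'v) \<Rightarrow> (real ^ 'm \<Rightarrow> 'v)
     \<Rightarrow> (real ^ 'm \<Rightarrow> 'v) \<Rightarrow> real ^ 'm::finite \<Rightarrow> 'v::euclidean_space" where
  "curv_term_left G \<phi> S T = metric_trace G (\<lambda>X Y x.
     sphere_curv (\<phi> x) (pullback_conn \<phi> X S x) (T x) (deriv_along Y \<phi> x))"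

definition curv_term_right ::
    "(real ^ 'm \<Rightarrow> real ^ 'm ^ 'm) \<Rightarrow> (real ^ 'm \<Rightarrow> 'v) \<Rightarrow> (real ^ 'm \<Rightarrow> 'v)
     \<Rightarrow> (real ^ 'm \<Rightarrow> 'v) \<Rightarrow> real ^ 'm::finite \<Rightarrow> 'v::euclidean_space" where
  "curv_term_right G \<phi> S T = metric_trace G (\<lambda>X Y x.
     sphere_curv (\<phi> x) (S x) (pullback_conn \<phi> X T x) (deriv_along Y \<phi> x))"

text \<open>The fields \<open>\<tau>\<^bsub>2s\<^esub>\<close> and \<open>\<tau>\<^bsub>2s+1\<^esub>\<close> for \<open>s \<ge> 1\<close>. No subtraction below truncates.\<close>

definition tension_even ::
    "(real ^ 'm \<Rightarrow> real ^ 'm ^ 'm) \<Rightarrow> (real ^ 'm \<Rightarrow> 'v) \<Rightarrow> nat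
     \<Rightarrow> real ^ 'm::finite \<Rightarrow> 'v::euclidean_space" where
  "tension_even G \<phi> s = (let \<tau> = laplacian_tension G \<phi> in (\<lambda>x.
     \<tau> (2 * s - 1) x - curv_term G \<phi> (\<tau> (2 * s - 2)) x
     - (\<Sum>l = 1..s - 1. curv_term_left G \<phi> (\<tau> (s + l - 2)) (\<tau> (s - l - 1)) x
                      - curv_term_right G \<phi> (\<tau> (s + l - 2)) (\<tau> (s - l - 1)) x)))"

definition tension_odd ::
    "(real ^ 'm \<Rightarrow> real ^ 'm ^ 'm) \<Rightarrow> (real ^ 'm \<Rightarrow> 'v) \<Rightarrow> nat
     \<Rightarrow> real ^ 'm::finite \<Rightarrow> 'v::euclidean_space" where
  "tension_odd G \<phi> s = (let \<tau> = laplacian_tension G \<phi> in (\<lambda>x.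
     \<tau> (2 * s) x - curv_term G \<phi> (\<tau> (2 * s - 1)) x
     - (\<Sum>l = 1..s - 1. curv_term_left G \<phi> (\<tau> (s + l - 1)) (\<tau> (s - l - 1)) x
                      - curv_term_right G \<phi> (\<tau> (s + l - 1)) (\<tau> (s - l - 1)) x)
     - curv_term_left G \<phi> (\<tau> (s - 1)) (\<tau> (s - 1)) x))"

definition k_tension ::
    "nat \<Rightarrow> (real ^ 'm \<Rightarrow> real ^ 'm ^ 'm) \<Rightarrow> (real ^ 'm \<Rightarrow> 'v)
     \<Rightarrow> real ^ 'm::finite \<Rightarrow> 'v::euclidean_space" where
  "k_tension k G \<phi> =
     (if k = 1 then tension G \<phi>
      else if even k then tension_even G \<phi> (k div 2)
      else tension_odd G \<phi> (k div 2))"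

definition smooth_sphere_map ::
    "'a topology \<Rightarrow> ('a, 'm::finite) chart set \<Rightarrow> ('a \<Rightarrow> 'v::euclidean_space) \<Rightarrow> bool" where
  "smooth_sphere_map M A \<phi> \<longleftrightarrow> \<phi> ` topspace M \<subseteq> sphere 0 1 \<and>
     (\<forall>c\<in>A. smooth_on (\<phi> \<circ> chart_inv c) (chart_image c))"

definition k_harmonic ::
    "nat \<Rightarrow> ('a, 'm::finite) chart set \<Rightarrow> (('a, 'm) chart \<Rightarrow> real ^ 'm \<Rightarrow> real ^ 'm ^ 'm)
     \<Rightarrow> ('a \<Rightarrow> 'v::euclidean_space) \<Rightarrow> bool" where
  "k_harmonic k A g \<phi> \<longleftrightarrow>
     (\<forall>c\<in>A. \<forall>x\<in>chart_image c. k_tension k (g c) (\<phi> \<circ> chart_inv c) x = 0)"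

text \<open>The north pole of the unit sphere of the product of \<open>real ^ 'n\<close> and \<open>real\<close>
  is \<open>(0, 1)\<close>.\<close>

definition equator :: "((real ^ 'n::finite) \<times> real) set" where
  "equator = {p \<in> sphere 0 1. snd p = 0}"

end

theory Submission
  imports Defs
begin

text \<open>Let \<open>f\<close> be the last coordinate of the map; it vanishes exactly over the equator. The last
  coordinate of the tension field is \<open>\<Delta>f\<close> plus terms that are linear in \<open>f\<close> and \<open>df\<close> with smooth
  coefficients, because the normal part of any derivative is a multiple of the map itself and so
  contributes a multiple of \<open>f\<close>. In the same way, applying the rough Laplacian to a section
  turns its last coordinate \<open>s\<close> into \<open>- \<Delta>s\<close> plus terms in \<open>f\<close>, \<open>s\<close> and their gradients, and the
  curvature \<open>R(u, v) w = (v \<bullet> w) u - (u \<bullet> w) v\<close> of the sphere only combines last coordinates of \<open>u\<close>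
  and \<open>v\<close>. So \<open>f\<close> together with the last coordinates of the iterated rough Laplacians of the
  tension field, up to order \<open>k - 2\<close>, satisfies a system in which every Laplacian is bounded by
  the functions and their gradients: the last of these bounds is the \<open>k\<close>-harmonic equation
  (\<open>k_harmonic_dominated\<close>, \<open>laplacian_heights_dominated\<close>). Where \<open>f\<close> vanishes on an open set, all
  the other functions vanish too.

  Such systems have the unique continuation property (\<open>unique_continuation\<close>). Since the metric
  is only smooth, this rests on a Carleman estimate (\<open>carleman_estimate\<close>): for a suitable weight
  \<open>\<psi>\<close> and large \<open>t\<close>, the weighted norm of \<open>div (A\<nabla>V)\<close> with weight \<open>exp (t \<psi>)\<close> controls those of
  \<open>V\<close> and \<open>\<nabla>V\<close> with a gain that is a power of \<open>t\<close>. If a solution vanishes on some open set but not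
  everywhere, then a ball inside its zero set touches the boundary of that set at a point. A
  weight that decreases away from this point outside the ball makes the cut-off error
  exponentially small, and \<open>t \<rightarrow> \<infinity>\<close> shows that the solution vanishes beyond the point
  (\<open>unique_continuation_across_sphere\<close>). The theorem follows by connectedness: the interior of the
  zero set of \<open>f\<close> is open, and closed because it fills every coordinate ball that it meets.\<close>

section \<open>Calculus of continuously differentiable functions\<close>

abbreviation dd :: "('a::euclidean_space \<Rightarrow> 'b::real_normed_vector) \<Rightarrow> 'a \<Rightarrow> 'a \<Rightarrow> 'b" where
  "dd f v \<equiv> (\<lambda>x. frechet_derivative f (at x) v)"

lemma frechet_derivative_cong_open:
  assumes "open S" "x \<in> S" "\<And>y. y \<in> S \<Longrightarrow> f y = g y"
  shows "frechet_derivative f (at x) = frechet_derivative g (at x)"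
proof -
  have "(f has_derivative f') (at x) = (g has_derivative f') (at x)" for f'
    using assms has_derivative_transform_within_open[of f f' x UNIV S g]
      has_derivative_transform_within_open[of g f' x UNIV S f] by auto
  then show ?thesis unfolding frechet_derivative_def by simp
qed

lemma dd_eq: "(f has_derivative f') (at x) \<Longrightarrow> dd f v x = f' v"
  using frechet_derivative_at by metis

lemma C_on_has_derivative:
  "C_on n f S \<Longrightarrow> 0 < n \<Longrightarrow> x \<in> S \<Longrightarrow> (f has_derivative frechet_derivative f (at x)) (at x)"
  by (cases n) (auto simp: frechet_derivative_works[symmetric])

lemma C_on_cong:
  assumes "open S" "\<And>x. x \<in> S \<Longrightarrow> f x = g x" "C_on n f S"
  shows "C_on n g S"
  using assms(2,3)
proof (induction n arbitrary: f g)
  case 0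
  show ?case unfolding C_on.simps
    by (rule continuous_on_eq[of S f]) (use 0 in \<open>simp_all only: C_on.simps\<close>)
next
  case (Suc n)
  have "g differentiable (at x)" if xS: "x \<in> S" for x
  proof -
    obtain f' where "(f has_derivative f') (at x)"
      using C_on_has_derivative[OF Suc.prems(2) zero_less_Suc xS] by blast
    then have "(g has_derivative f') (at x)"
      using has_derivative_transform_within_open[OF _ \<open>open S\<close> xS] Suc.prems(1) by blast
    then show ?thesis by (auto simp: differentiable_def)
  qed
  moreover have "C_on n (dd g v) S" for v
  proof (rule Suc.IH)
    show "dd f v x = dd g v x" if "x \<in> S" for x
      using frechet_derivative_cong_open[OF \<open>open S\<close> that Suc.prems(1)] by (rule fun_cong)
    show "C_on n (dd f v) S" using Suc.prems(2) by simp
  qed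
  ultimately show ?case by simp
qed

lemma C_on_SucD: "C_on (Suc n) f S \<Longrightarrow> C_on n f S"
proof (induction n arbitrary: f)
  case 0
  then show ?case
    by (auto intro!: continuous_at_imp_continuous_on differentiable_imp_continuous_within)
next
  case (Suc n)
  then show ?case by (metis C_on.simps(2))
qed

lemma C_on_le: "C_on n f S \<Longrightarrow> m \<le> n \<Longrightarrow> C_on m f S"
  by (induction n) (auto simp: le_Suc_eq simp del: C_on.simps(2) dest: C_on_SucD)

lemma C_on_continuous: "C_on n f S \<Longrightarrow> continuous_on S f"
  using C_on_le[of n f S 0] by simp

lemma C_on_subset: "C_on n f S \<Longrightarrow> T \<subseteq> S \<Longrightarrow> C_on n f T"
  by (induction n arbitrary: f) (auto intro: continuous_on_subset)

lemma C_on_Un: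
  assumes "open S" "open T"
  shows "C_on n f S \<Longrightarrow> C_on n f T \<Longrightarrow> C_on n f (S \<union> T)"
  using assms by (induction n arbitrary: f) (auto intro: continuous_on_open_Un)

lemma C_on_dd: "C_on (Suc n) f S \<Longrightarrow> C_on n (dd f v) S"
  by simp

lemma C_on_Suc_derivI:
  assumes "open S" "\<And>x. x \<in> S \<Longrightarrow> (f has_derivative f' x) (at x)"
    and "\<And>v. C_on n (\<lambda>x. f' x v) S"
  shows "C_on (Suc n) f S"
proof -
  have "dd f v x = f' x v" if "x \<in> S" for x v using assms(2)[OF that] by (rule dd_eq)
  then have "C_on n (dd f v) S" for v
    by (intro C_on_cong[OF \<open>open S\<close> _ assms(3)[of v]]) auto
  then show ?thesis using assms(2) by (auto simp: differentiable_def)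
qed

lemma C_on_const: "C_on n (\<lambda>x. c) S"
  by (induction n arbitrary: c) auto

declare C_on.simps(2) [simp del]

lemma C_on_Suc_has_derivative:
  "C_on (Suc n) f S \<Longrightarrow> x \<in> S \<Longrightarrow> (f has_derivative frechet_derivative f (at x)) (at x)"
  by (rule C_on_has_derivative[of "Suc n"]) auto

lemma C_on_add:
  "open S \<Longrightarrow> C_on n f S \<Longrightarrow> C_on n g S \<Longrightarrow> C_on n (\<lambda>x. f x + g x) S"
proof (induction n arbitrary: f g)
  case (Suc n)
  show ?case
  proof (rule C_on_Suc_derivI)
    show "((\<lambda>x. f x + g x) has_derivative
        (\<lambda>v. frechet_derivative f (at x) v + frechet_derivative g (at x) v)) (at x)"
      if "x \<in> S" for x
      using Suc.prems that by (intro has_derivative_add) (auto intro: C_on_Suc_has_derivative)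
  qed (intro Suc.prems Suc.IH C_on_dd)+
qed (auto intro: continuous_on_add)

lemma C_on_sum:
  "open S \<Longrightarrow> (\<And>i. i \<in> I \<Longrightarrow> C_on n (f i) S) \<Longrightarrow> C_on n (\<lambda>x. \<Sum>i\<in>I. f i x) S"
  by (induction I rule: infinite_finite_induct) (auto intro: C_on_add C_on_const)

lemma C_on_linear_compose:
  assumes "bounded_linear L" "open S"
  shows "C_on n f S \<Longrightarrow> C_on n (\<lambda>x. L (f x)) S"
proof (induction n arbitrary: f)
  case 0
  then show ?case using bounded_linear.continuous_on[OF assms(1)] by simp
next
  case (Suc n)
  show ?case
  proof (rule C_on_Suc_derivI[OF \<open>open S\<close>])
    show "((\<lambda>x. L (f x)) has_derivative (\<lambda>v. L (frechet_derivative f (at x) v))) (at x)"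
      if "x \<in> S" for x
      using Suc.prems that
      by (intro bounded_linear.has_derivative[OF assms(1)]) (auto intro: C_on_Suc_has_derivative)
  qed (intro Suc.IH C_on_dd Suc.prems)
qed

lemma C_on_bilinear:
  assumes "bounded_bilinear B" "open S"
  shows "C_on n f S \<Longrightarrow> C_on n g S \<Longrightarrow> C_on n (\<lambda>x. B (f x) (g x)) S"
proof (induction n arbitrary: f g)
  case 0
  then show ?case using bounded_bilinear.continuous_on[OF assms(1)] by simp
next
  case (Suc n)
  show ?case
  proof (rule C_on_Suc_derivI[OF \<open>open S\<close>])
    show "((\<lambda>x. B (f x) (g x)) has_derivative (\<lambda>v. B (f x) (frechet_derivative g (at x) v)
        + B (frechet_derivative f (at x) v) (g x))) (at x)"
      if "x \<in> S" for x
      using Suc.prems that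
      by (intro bounded_bilinear.FDERIV[OF assms(1)]) (auto intro: C_on_Suc_has_derivative)
  qed (intro C_on_add \<open>open S\<close> Suc.IH C_on_dd Suc.prems Suc.prems[THEN C_on_SucD])
qed

lemmas C_on_scaleR = C_on_bilinear[OF bounded_bilinear_scaleR]
  and C_on_mult = C_on_bilinear[OF bounded_bilinear_mult]
  and C_on_inner = C_on_bilinear[OF bounded_bilinear_inner]
  and C_on_uminus = C_on_linear_compose[OF bounded_linear_minus[OF bounded_linear_ident]]
  and C_on_vec_nth = C_on_linear_compose[OF bounded_linear_vec_nth]
  and C_on_snd = C_on_linear_compose[OF bounded_linear_snd]

lemma C_on_diff:
  "open S \<Longrightarrow> C_on n f S \<Longrightarrow> C_on n g S \<Longrightarrow> C_on n (\<lambda>x. f x - g x) S"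
  using C_on_add[of S n f "\<lambda>x. - g x"] by (auto intro: C_on_uminus)

lemma C_on_ident: "open S \<Longrightarrow> C_on n (\<lambda>x. x) S"
proof (cases n)
  case (Suc m)
  assume "open S"
  show ?thesis unfolding Suc
    by (rule C_on_Suc_derivI[OF \<open>open S\<close>, where f' = "\<lambda>x v. v"]) (auto intro: C_on_const)
qed auto

lemma C_on_prod:
  fixes f :: "'i \<Rightarrow> 'a::euclidean_space \<Rightarrow> real"
  shows "open S \<Longrightarrow> (\<And>i. i \<in> I \<Longrightarrow> C_on n (f i) S) \<Longrightarrow> C_on n (\<lambda>x. \<Prod>i\<in>I. f i x) S"
  by (induction I rule: infinite_finite_induct) (auto intro: C_on_mult C_on_const)

lemma C_on_compose_real:
  fixes f :: "'a::euclidean_space \<Rightarrow> real" and h :: "real \<Rightarrow> real"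
  assumes "open S" "open T" "f ` S \<subseteq> T"
  shows "C_on n f S \<Longrightarrow> C_on n h T \<Longrightarrow> C_on n (\<lambda>x. h (f x)) S"
proof (induction n arbitrary: h)
  case 0
  then show ?case using assms(3) by (auto intro: continuous_on_compose2)
next
  case (Suc n)
  show ?case
  proof (rule C_on_Suc_derivI[OF \<open>open S\<close>])
    show "((\<lambda>x. h (f x)) has_derivative (\<lambda>v. frechet_derivative f (at x) v * dd h 1 (f x))) (at x)"
      if "x \<in> S" for x
    proof -
      have fx: "f x \<in> T" using assms(3) that by auto
      have h: "(h has_derivative frechet_derivative h (at (f x))) (at (f x))"
        using Suc.prems(2) fx by (auto intro: C_on_Suc_has_derivative)
      have lin: "frechet_derivative h (at (f x)) = (\<lambda>r. r * dd h 1 (f x))"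
      proof
        fix r
        show "frechet_derivative h (at (f x)) r = r * dd h 1 (f x)"
          using linear_scale[OF has_derivative_linear[OF h], of r 1] by simp
      qed
      have "(f has_derivative frechet_derivative f (at x)) (at x)"
        using Suc.prems(1) that by (rule C_on_Suc_has_derivative)
      from has_derivative_compose[OF this h] show ?thesis
        by (subst (asm) lin)
    qed
    show "C_on n (\<lambda>x. frechet_derivative f (at x) v * dd h 1 (f x)) S" for v
      by (rule C_on_mult[OF \<open>open S\<close> C_on_dd[OF Suc.prems(1)]
            Suc.IH[OF C_on_SucD[OF Suc.prems(1)] C_on_dd[OF Suc.prems(2)]]])
  qed
qed

lemma C_on_inverse_real: "C_on n (inverse :: real \<Rightarrow> real) (- {0})"
proof (induction n)
  case (Suc n)
  have o: "open (- {0::real})" by auto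
  show ?case
  proof (rule C_on_Suc_derivI[OF o])
    show "(inverse has_derivative (\<lambda>v. - (inverse x * v * inverse x))) (at x)" if "x \<in> - {0}"
      for x :: real using that by (auto intro!: derivative_eq_intros)
    show "C_on n (\<lambda>x::real. - (inverse x * v * inverse x)) (- {0})" for v
      by (intro C_on_uminus o C_on_mult C_on_const Suc.IH)
  qed
qed (auto intro!: continuous_on_inverse continuous_on_exp continuous_on_id)

lemma C_on_divide:
  fixes f g :: "'a::euclidean_space \<Rightarrow> real"
  assumes "open S" "C_on n f S" "C_on n g S" "\<And>x. x \<in> S \<Longrightarrow> g x \<noteq> 0"
  shows "C_on n (\<lambda>x. f x / g x) S"
  unfolding divide_inverse
  using assms by (intro C_on_mult C_on_compose_real[OF _ _ _ _ C_on_inverse_real]) auto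

lemma C_on_exp: "C_on n (exp :: real \<Rightarrow> real) UNIV"
proof (induction n)
  case (Suc n)
  show ?case
  proof (rule C_on_Suc_derivI)
    show "(exp has_derivative (\<lambda>v. v * exp x)) (at x)" for x :: real
      by (auto intro!: derivative_eq_intros)
    show "C_on n (\<lambda>x::real. v * exp x) UNIV" for v
      by (intro C_on_mult C_on_const Suc.IH open_UNIV)
  qed auto
qed (auto intro!: continuous_on_inverse continuous_on_exp continuous_on_id)

lemma C_on_vec_lambda:
  fixes f :: "'a::euclidean_space \<Rightarrow> ('b::euclidean_space) ^ 'm::finite"
  assumes "open S" "\<And>i. C_on n (\<lambda>x. f x $ i) S"
  shows "C_on n f S"
proof -
  have bl: "bounded_linear (\<lambda>y::'b. axis i y :: 'b ^ 'm)" for i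
    unfolding linear_conv_bounded_linear[symmetric]
    by (rule linearI) (auto simp: axis_def vec_eq_iff)
  have "f x = (\<Sum>i\<in>UNIV. axis i (f x $ i))" for x
    by (simp add: vec_eq_iff axis_def if_distrib cong: if_cong)
  then have "f = (\<lambda>x. \<Sum>i\<in>UNIV. axis i (f x $ i))" by blast
  moreover have "C_on n (\<lambda>x. \<Sum>i\<in>UNIV. axis i (f x $ i)) S"
    by (intro C_on_sum assms(1) C_on_linear_compose[OF bl] assms(2))
  ultimately show ?thesis by simp
qed

lemma bounded_bilinear_matrix_vector_mult:
  "bounded_bilinear ((*v) :: real ^ 'm ^ 'n \<Rightarrow> real ^ 'm \<Rightarrow> real ^ 'n::finite)"
  unfolding bilinear_conv_bounded_bilinear[symmetric] bilinear_def
  by (auto intro!: linearI simp: matrix_vector_mult_def vec_eq_iff algebra_simps sum.distrib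
      sum_distrib_left)

lemmas C_on_matrix_vector_mult = C_on_bilinear[OF bounded_bilinear_matrix_vector_mult]

lemma C_on_det:
  fixes f :: "'a::euclidean_space \<Rightarrow> real ^ 'm ^ 'm::finite"
  assumes "open S" "\<And>i j. C_on n (\<lambda>x. f x $ i $ j) S"
  shows "C_on n (\<lambda>x. det (f x)) S"
  unfolding det_def
  by (intro C_on_sum C_on_mult C_on_const C_on_prod assms)

text \<open>By Cramer's rule the inverse is a quotient of determinants, hence as regular as the matrix.\<close>

lemma matrix_inv_cofactor:
  fixes G :: "real ^ 'm ^ 'm::finite"
  assumes "det G \<noteq> 0"
  shows "matrix_inv G $ k $ l = det (\<chi> i j. if j = k then axis l 1 $ i else G $ i $ j) / det G"
proof -
  have "G ** matrix_inv G = mat 1"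
    using assms invertible_det_nz[of G] unfolding invertible_def matrix_inv_def
    by (metis (mono_tags, lifting) someI_ex)
  then have "G *v column l (matrix_inv G) = axis l 1"
    by (metis matrix_vector_mul_assoc matrix_vector_mul_lid matrix_vector_mult_basis)
  then show ?thesis
    using cramer[OF assms, of "column l (matrix_inv G)" "axis l 1"]
    by (auto simp: column_def dest: fun_cong[of _ _ k])
qed

lemma C_on_matrix_inv:
  fixes G :: "'a::euclidean_space \<Rightarrow> real ^ 'm ^ 'm::finite"
  assumes "open S" "C_on n G S" "\<And>x. x \<in> S \<Longrightarrow> det (G x) \<noteq> 0"
  shows "C_on n (\<lambda>x. matrix_inv (G x) $ k $ l) S"
proof -
  have G: "C_on n (\<lambda>x. G x $ i $ j) S" for i j
    by (intro C_on_vec_nth assms)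
  have "C_on n (\<lambda>x. det (\<chi> i j. if j = k then axis l 1 $ i else G x $ i $ j) / det (G x)) S"
  proof (intro C_on_divide C_on_det assms G)
    show "C_on n (\<lambda>x. (\<chi> i j. if j = k then axis l 1 $ i else G x $ i $ j) $ i $ j) S" for i j
      by (cases "j = k") (auto intro: C_on_const G)
  qed
  then show ?thesis
    by (rule C_on_cong[OF assms(1), rotated]) (rule matrix_inv_cofactor[OF assms(3), symmetric])
qed

lemma C_on_continuous_derivative:
  fixes f :: "'a::euclidean_space \<Rightarrow> 'b::real_normed_vector"
  assumes "C_on (Suc n) f S" "continuous_on T p" "p ` T \<subseteq> S" "continuous_on T v"
  shows "continuous_on T (\<lambda>y. frechet_derivative f (at (p y)) (v y))"
proof -
  have "frechet_derivative f (at (p y)) (v y) = (\<Sum>b\<in>Basis. (v y \<bullet> b) *\<^sub>R dd f b (p y))"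
    if "y \<in> T" for y
  proof -
    have lin: "linear (frechet_derivative f (at (p y)))"
      by (rule has_derivative_linear[OF C_on_Suc_has_derivative[OF assms(1)]]) (use assms(3) that in auto)
    have "frechet_derivative f (at (p y)) (v y)
        = frechet_derivative f (at (p y)) (\<Sum>b\<in>Basis. (v y \<bullet> b) *\<^sub>R b)"
      by (simp only: euclidean_representation)
    also have "\<dots> = (\<Sum>b\<in>Basis. (v y \<bullet> b) *\<^sub>R dd f b (p y))"
      by (simp only: linear_sum[OF lin] linear_scale[OF lin])
    finally show ?thesis .
  qed
  moreover have "continuous_on T (\<lambda>y. \<Sum>b\<in>Basis. (v y \<bullet> b) *\<^sub>R dd f b (p y))"
  proof (intro continuous_intros assms)
    fix b
    have "continuous_on S (dd f b)" using assms(1) C_on_dd C_on_continuous by blast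
    then show "continuous_on T (\<lambda>y. dd f b (p y))"
      using assms(2,3) by (auto intro: continuous_on_compose2)
  qed
  ultimately show ?thesis by (simp cong: continuous_on_cong)
qed

text \<open>Two applications of the mean value theorem express the second difference through either of
  the mixed second derivatives, which are therefore limits of the same quotient as \<open>s \<rightarrow> 0\<close>. This
  gives Schwarz's theorem.\<close>

lemma second_difference_mean_value:
  fixes f :: "'a::euclidean_space \<Rightarrow> real"
  assumes "C_on 2 f S" "0 < s" and S: "\<And>a b. 0 \<le> a \<Longrightarrow> a \<le> s \<Longrightarrow> 0 \<le> b \<Longrightarrow> b \<le> s \<Longrightarrow>
      x + a *\<^sub>R h + b *\<^sub>R k \<in> S"
  shows "\<exists>a b. 0 \<le> a \<and> a \<le> s \<and> 0 \<le> b \<and> b \<le> s \<and>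
    f (x + s *\<^sub>R h + s *\<^sub>R k) - f (x + s *\<^sub>R h) - f (x + s *\<^sub>R k) + f x
      = s\<^sup>2 * dd (dd f h) k (x + a *\<^sub>R h + b *\<^sub>R k)"
proof -
  have C2: "C_on (Suc (Suc 0)) f S" using assms(1) by (simp add: numeral_2_eq_2)
  have fd: "(f has_derivative frechet_derivative f (at y)) (at y)" if "y \<in> S" for y
    using C2 that by (intro C_on_has_derivative) auto
  have fd2: "(dd f h has_derivative frechet_derivative (dd f h) (at y)) (at y)"
    if "y \<in> S" for y
    using C2 that by (intro C_on_has_derivative[of "Suc 0"] C_on_dd) auto
  have path: "((\<lambda>r. F (q + r *\<^sub>R v)) has_real_derivative F' v) (at r)"
    if "(F has_derivative F') (at (q + r *\<^sub>R v))" for F :: "'a \<Rightarrow> real" and F' q v r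
  proof -
    have "((\<lambda>r. q + r *\<^sub>R v) has_derivative (\<lambda>d. d *\<^sub>R v)) (at r)"
      by (auto intro!: derivative_eq_intros)
    from has_derivative_compose[OF this that] linear_scale[OF has_derivative_linear[OF that]]
    have "((\<lambda>r. F (q + r *\<^sub>R v)) has_derivative (\<lambda>d. F' v * d)) (at r)"
      by (simp add: mult.commute)
    then show ?thesis by (simp add: has_field_derivative_def)
  qed
  define g where "g r = f (x + s *\<^sub>R k + r *\<^sub>R h) - f (x + r *\<^sub>R h)" for r
  have g': "(g has_real_derivative dd f h (x + s *\<^sub>R k + r *\<^sub>R h) - dd f h (x + r *\<^sub>R h)) (at r)"
    if "0 \<le> r" "r \<le> s" for r
    unfolding g_def
    using S[of r s] S[of r 0] that assms(2)
    by (intro DERIV_diff path fd) (auto simp: algebra_simps)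
  obtain a where a: "0 < a" "a < s"
    "g s - g 0 = (s - 0) * (dd f h (x + s *\<^sub>R k + a *\<^sub>R h) - dd f h (x + a *\<^sub>R h))"
    using MVT2[OF assms(2) g'] by blast
  define l where "l r = dd f h (x + a *\<^sub>R h + r *\<^sub>R k)" for r
  have l': "(l has_real_derivative dd (dd f h) k (x + a *\<^sub>R h + r *\<^sub>R k)) (at r)"
    if "0 \<le> r" "r \<le> s" for r
    unfolding l_def
    using S[of a r] that a by (intro path fd2) auto
  obtain b where b: "0 < b" "b < s" "l s - l 0 = (s - 0) * dd (dd f h) k (x + a *\<^sub>R h + b *\<^sub>R k)"
    using MVT2[OF assms(2) l'] by blast
  have "f (x + s *\<^sub>R h + s *\<^sub>R k) - f (x + s *\<^sub>R h) - f (x + s *\<^sub>R k) + f x = g s - g 0"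
    by (simp add: g_def algebra_simps)
  also have "\<dots> = s * (l s - l 0)" using a(3) by (simp add: l_def algebra_simps)
  also have "\<dots> = s\<^sup>2 * dd (dd f h) k (x + a *\<^sub>R h + b *\<^sub>R k)"
    using b(3) by (simp add: power2_eq_square)
  finally show ?thesis using a b by (intro exI[of _ a] exI[of _ b]) auto
qed

lemma mixed_second_derivatives_symmetric:
  fixes f :: "'a::euclidean_space \<Rightarrow> real"
  assumes "open S" "C_on 2 f S" "x \<in> S"
  shows "dd (dd f h) k x = dd (dd f k) h x"
proof (rule ccontr)
  assume ne: "dd (dd f h) k x \<noteq> dd (dd f k) h x"
  define e where "e = \<bar>dd (dd f h) k x - dd (dd f k) h x\<bar> / 2"
  have e: "e > 0" using ne by (simp add: e_def)
  have cont: "continuous_on S (dd (dd f u) v)" for u v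
    using assms(2) by (simp add: numeral_2_eq_2 C_on.simps)
  have "\<exists>d>0. \<forall>y\<in>S. dist y x < d \<longrightarrow> \<bar>dd (dd f u) v y - dd (dd f u) v x\<bar> < e" for u v
    using cont[of u v] assms(3) e unfolding continuous_on_iff dist_real_def by blast
  then obtain d1 d2 where d: "d1 > 0" "d2 > 0"
    "\<And>y. y \<in> S \<Longrightarrow> dist y x < d1 \<Longrightarrow> \<bar>dd (dd f h) k y - dd (dd f h) k x\<bar> < e"
    "\<And>y. y \<in> S \<Longrightarrow> dist y x < d2 \<Longrightarrow> \<bar>dd (dd f k) h y - dd (dd f k) h x\<bar> < e"
    by meson
  obtain d3 where d3: "d3 > 0" "ball x d3 \<subseteq> S" using assms(1,3) openE by blast
  define d where "d = min d1 (min d2 d3)"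
  define s where "s = d / (2 * (norm h + norm k + 1))"
  have dpos: "d > 0" using d d3 by (simp add: d_def)
  have N: "norm h + norm k + 1 > 0" by (simp add: add_nonneg_pos)
  have s: "s > 0" using dpos N by (simp add: s_def)
  have near: "dist (x + a *\<^sub>R h + b *\<^sub>R k) x < d" if "0 \<le> a" "a \<le> s" "0 \<le> b" "b \<le> s" for a b
  proof -
    have "dist (x + a *\<^sub>R h + b *\<^sub>R k) x \<le> a * norm h + b * norm k"
      using that norm_triangle_ineq[of "a *\<^sub>R h" "b *\<^sub>R k"] by (simp add: dist_norm add.assoc)
    also have "\<dots> \<le> s * norm h + s * norm k" using that by (intro add_mono mult_right_mono) auto
    also have "\<dots> \<le> s * (norm h + norm k + 1)" using s by (simp add: algebra_simps)
    also have "\<dots> = d / 2" using N by (simp add: s_def field_simps)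
    finally show ?thesis using dpos by simp
  qed
  have inS: "x + a *\<^sub>R h + b *\<^sub>R k \<in> S" if "0 \<le> a" "a \<le> s" "0 \<le> b" "b \<le> s" for a b
    using near[OF that] d3(2) by (auto simp: d_def dist_commute subset_iff)
  have inS': "x + a *\<^sub>R k + b *\<^sub>R h \<in> S" if "0 \<le> a" "a \<le> s" "0 \<le> b" "b \<le> s" for a b
    using inS[of b a] that by (simp add: algebra_simps)
  obtain a b where ab: "0 \<le> a" "a \<le> s" "0 \<le> b" "b \<le> s"
    "f (x + s *\<^sub>R h + s *\<^sub>R k) - f (x + s *\<^sub>R h) - f (x + s *\<^sub>R k) + f x
      = s\<^sup>2 * dd (dd f h) k (x + a *\<^sub>R h + b *\<^sub>R k)"
    using second_difference_mean_value[OF assms(2) s inS] by blast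
  obtain a' b' where ab': "0 \<le> a'" "a' \<le> s" "0 \<le> b'" "b' \<le> s"
    "f (x + s *\<^sub>R k + s *\<^sub>R h) - f (x + s *\<^sub>R k) - f (x + s *\<^sub>R h) + f x
      = s\<^sup>2 * dd (dd f k) h (x + a' *\<^sub>R k + b' *\<^sub>R h)"
    using second_difference_mean_value[OF assms(2) s inS'] by blast
  have "s\<^sup>2 * dd (dd f h) k (x + a *\<^sub>R h + b *\<^sub>R k) = s\<^sup>2 * dd (dd f k) h (x + a' *\<^sub>R k + b' *\<^sub>R h)"
    using ab(5) ab'(5) by (simp add: algebra_simps)
  then have eq: "dd (dd f h) k (x + a *\<^sub>R h + b *\<^sub>R k) = dd (dd f k) h (x + a' *\<^sub>R k + b' *\<^sub>R h)"
    using s by simp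
  have "\<bar>dd (dd f h) k (x + a *\<^sub>R h + b *\<^sub>R k) - dd (dd f h) k x\<bar> < e"
    using near[OF ab(1-4)] inS[OF ab(1-4)] by (intro d) (auto simp: d_def)
  moreover have "\<bar>dd (dd f k) h (x + a' *\<^sub>R k + b' *\<^sub>R h) - dd (dd f k) h x\<bar> < e"
    using near[of b' a'] inS'[OF ab'(1-4)] ab' by (intro d) (auto simp: d_def algebra_simps)
  ultimately have "\<bar>dd (dd f h) k x - dd (dd f k) h x\<bar> < 2 * e" using eq by linarith
  then show False by (simp add: e_def)
qed

section \<open>The divergence theorem for compactly supported fields\<close>

lemma integrable_compact_support:
  fixes f :: "'a::euclidean_space \<Rightarrow> real"
  assumes "continuous_on UNIV f" "\<And>x. x \<notin> cball p d \<Longrightarrow> f x = 0"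
  shows "integrable lborel f"
proof -
  have "integrable lborel (\<lambda>x. indicator (cball p d) x *\<^sub>R f x)"
    using assms(1) by (intro borel_integrable_compact) (auto intro: continuous_on_subset)
  moreover have "(\<lambda>x. indicator (cball p d) x *\<^sub>R f x) = f"
    using assms(2) by (auto simp: indicator_def fun_eq_iff)
  ultimately show ?thesis by simp
qed

lemma integral_translate:
  fixes f :: "'a::euclidean_space \<Rightarrow> real"
  assumes "f \<in> borel_measurable borel"
  shows "(\<integral>x. f (x + c) \<partial>lborel) = (\<integral>x. f x \<partial>lborel)"
proof -
  have "(\<integral>x. f x \<partial>lborel) = (\<integral>x. f x \<partial>distr lborel borel ((+) c))"
    by (simp add: lborel_distr_plus)
  also have "\<dots> = (\<integral>x. f (c + x) \<partial>lborel)"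
    using assms by (intro integral_distr) auto
  finally show ?thesis by (simp add: add.commute)
qed

lemma dd_zero_off_support:
  fixes f :: "'a::euclidean_space \<Rightarrow> 'b::real_normed_vector"
  assumes "\<And>x. x \<notin> cball p d \<Longrightarrow> f x = 0" "x \<notin> cball p d"
  shows "dd f v x = 0"
proof -
  have "frechet_derivative f (at x) = frechet_derivative (\<lambda>x. 0) (at x)"
    using assms by (intro frechet_derivative_cong_open[of "- cball p d"]) auto
  then show ?thesis by simp
qed

text \<open>The integral of a directional derivative is the limit of the integrals of the
  difference quotients, and these vanish by translation invariance.\<close>

lemma integral_dd_eq_0:
  fixes f :: "'a::euclidean_space \<Rightarrow> real"
  assumes C1: "C_on 1 f UNIV" and supp: "\<And>x. x \<notin> cball p d \<Longrightarrow> f x = 0"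
  shows "(\<integral>x. dd f v x \<partial>lborel) = 0"
proof -
  have fd: "(f has_derivative frechet_derivative f (at x)) (at x)" for x
    using C1 by (auto intro: C_on_has_derivative)
  have cf: "continuous_on UNIV f" using C1 by (rule C_on_continuous)
  have cd: "continuous_on UNIV (dd f v)" using C1 by (simp add: C_on.simps)
  have "compact (dd f v ` cball p d)"
    by (rule compact_continuous_image) (auto intro: continuous_on_subset[OF cd])
  then have "bounded (dd f v ` cball p d)" by (rule compact_imp_bounded)
  then obtain M0 where "\<forall>y\<in>dd f v ` cball p d. norm y \<le> M0"
    unfolding bounded_iff by (elim exE)
  then have M0: "\<bar>dd f v x\<bar> \<le> M0" if "x \<in> cball p d" for x
    using that by simp
  define M where "M = max M0 0"
  have M: "\<bar>dd f v x\<bar> \<le> M" for x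
    using M0 dd_zero_off_support[of p d f x v] supp by (cases "x \<in> cball p d") (auto simp: M_def intro: max.coboundedI1)
  define s where "s n = 1 / real (Suc n)" for n
  have s: "0 < s n" "s n \<le> 1" for n by (auto simp: s_def)
  have s0: "s \<longlonglongrightarrow> 0" unfolding s_def using LIMSEQ_inverse_real_of_nat
    by (simp add: inverse_eq_divide)
  define q where "q n x = (f (x + s n *\<^sub>R v) - f x) / s n" for n x
  have path: "((\<lambda>r. f (x + r *\<^sub>R v)) has_real_derivative dd f v (x + r *\<^sub>R v)) (at r)" for x r
  proof -
    have "((\<lambda>r. x + r *\<^sub>R v) has_derivative (\<lambda>d. d *\<^sub>R v)) (at r)"
      by (auto intro!: derivative_eq_intros)
    from has_derivative_compose[OF this fd] linear_scale[OF has_derivative_linear[OF fd]]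
    have "((\<lambda>r. f (x + r *\<^sub>R v)) has_derivative (\<lambda>d. dd f v (x + r *\<^sub>R v) * d)) (at r)"
      by (simp add: mult.commute)
    then show ?thesis by (simp add: has_field_derivative_def)
  qed
  have qM: "\<bar>q n x\<bar> \<le> M" for n x
  proof -
    obtain z where "f (x + s n *\<^sub>R v) - f (x + 0 *\<^sub>R v) = (s n - 0) * dd f v (x + z *\<^sub>R v)"
      using MVT2[OF s(1) path] by blast
    then show ?thesis using s(1)[of n] M by (simp add: q_def)
  qed
  have q0: "q n x = 0" if "x \<notin> cball p (d + norm v)" for n x
  proof -
    have "norm (s n *\<^sub>R v) \<le> norm v" using s[of n] by (simp add: mult_left_le_one_le)
    then have "d < dist p (x + s n *\<^sub>R v)" "d < dist p x"
      using that norm_triangle_ineq4[of "p - (x + s n *\<^sub>R v)" "- (s n *\<^sub>R v)"]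
      by (auto simp: dist_norm algebra_simps not_le intro: order_le_less_trans[rotated])
    then show ?thesis using supp by (simp add: q_def)
  qed
  have cq: "continuous_on UNIV (q n)" for n
    unfolding q_def using s(1)[of n]
    by (intro continuous_intros continuous_on_compose2[OF cf]) auto
  have "(\<integral>x. q n x \<partial>lborel) = 0" for n
  proof -
    have fi: "integrable lborel f" using cf supp by (rule integrable_compact_support)
    have fm: "f \<in> borel_measurable borel" using cf by (rule borel_measurable_continuous_onI)
    have "continuous_on UNIV (\<lambda>x. f (x + s n *\<^sub>R v))"
      by (intro continuous_intros continuous_on_compose2[OF cf]) auto
    moreover have "f (x + s n *\<^sub>R v) = 0" if "x \<notin> cball (p - s n *\<^sub>R v) d" for x
      using that by (intro supp) (auto simp: dist_norm algebra_simps)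
    ultimately have "integrable lborel (\<lambda>x. f (x + s n *\<^sub>R v))"
      by (rule integrable_compact_support)
    then show ?thesis
      using fi integral_translate[OF fm] by (simp add: q_def)
  qed
  moreover have "(\<lambda>n. \<integral>x. q n x \<partial>lborel) \<longlonglongrightarrow> (\<integral>x. dd f v x \<partial>lborel)"
  proof (rule integral_dominated_convergence[where w = "\<lambda>x. M * indicator (cball p (d + norm v)) x"])
    show "dd f v \<in> borel_measurable lborel"
      using borel_measurable_continuous_onI[OF cd] by simp
    show "q n \<in> borel_measurable lborel" for n
      using borel_measurable_continuous_onI[OF cq] by simp
    have "emeasure lborel (cball p (d + norm v)) < \<infinity>"
      using emeasure_bounded_finite[OF bounded_cball] by auto
    then show "integrable lborel (\<lambda>x. M * indicator (cball p (d + norm v)) x)"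
      by simp
    show "AE x in lborel. norm (q n x) \<le> M * indicator (cball p (d + norm v)) x" for n
      using qM q0 by (auto simp: indicator_def)
    have "(\<lambda>n. q n x) \<longlonglongrightarrow> dd f v x" for x
    proof -
      have "((\<lambda>h. (f (x + (0 + h) *\<^sub>R v) - f (x + 0 *\<^sub>R v)) / h) \<longlongrightarrow> dd f v (x + 0 *\<^sub>R v)) (at 0)"
        using path[of x 0] unfolding DERIV_def .
      moreover have "filterlim s (at 0) sequentially"
        using s s0 by (auto simp: filterlim_at less_imp_neq[symmetric])
      ultimately show ?thesis
        using filterlim_compose[of _ _ "at 0" s] by (fastforce simp: q_def)
    qed
    then show "AE x in lborel. (\<lambda>n. q n x) \<longlonglongrightarrow> dd f v x" by simp
  qed
  ultimately show ?thesis by (simp add: LIMSEQ_const_iff)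
qed

definition divergence :: "('a::euclidean_space \<Rightarrow> 'a) \<Rightarrow> 'a \<Rightarrow> real" where
  "divergence Y x = (\<Sum>b\<in>Basis. dd Y b x \<bullet> b)"

lemma continuous_on_divergence: "C_on 1 Y S \<Longrightarrow> continuous_on S (divergence Y)"
  unfolding divergence_def[abs_def] One_nat_def
  by (intro continuous_on_sum continuous_on_inner continuous_on_const C_on_continuous[of 0] C_on_dd)

lemma integral_divergence_eq_0:
  fixes Y :: "'a::euclidean_space \<Rightarrow> 'a"
  assumes C1: "C_on 1 Y UNIV" and supp: "\<And>x. x \<notin> cball p d \<Longrightarrow> Y x = 0"
  shows "(\<integral>x. divergence Y x \<partial>lborel) = 0"
proof -
  have Yb: "C_on 1 (\<lambda>x. Y x \<bullet> b) UNIV" for b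
    by (intro C_on_inner C1 C_on_const) auto
  have eq: "dd Y b x \<bullet> b = dd (\<lambda>x. Y x \<bullet> b) b x" for b x
  proof -
    have "(Y has_derivative frechet_derivative Y (at x)) (at x)"
      using C1 by (auto intro: C_on_has_derivative)
    then have "((\<lambda>x. Y x \<bullet> b) has_derivative (\<lambda>h. frechet_derivative Y (at x) h \<bullet> b)) (at x)"
      by (rule has_derivative_inner_left)
    from dd_eq[OF this] show ?thesis by simp
  qed
  have int: "integrable lborel (dd (\<lambda>x. Y x \<bullet> b) b)" for b
  proof (rule integrable_compact_support[of _ p d])
    show "continuous_on UNIV (dd (\<lambda>x. Y x \<bullet> b) b)"
      using Yb[of b] by (simp add: C_on.simps)
    show "dd (\<lambda>x. Y x \<bullet> b) b x = 0" if "x \<notin> cball p d" for x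
      using supp by (intro dd_zero_off_support[OF _ that]) simp
  qed
  have "(\<integral>x. divergence Y x \<partial>lborel) = (\<Sum>b\<in>Basis. \<integral>x. dd (\<lambda>x. Y x \<bullet> b) b x \<partial>lborel)"
    unfolding divergence_def eq using int by (intro Bochner_Integration.integral_sum) auto
  also have "\<dots> = 0"
    using supp by (intro sum.neutral ballI integral_dd_eq_0[OF Yb, of p d]) auto
  finally show ?thesis .
qed

section \<open>A Carleman estimate\<close>

definition grad :: "('a::euclidean_space \<Rightarrow> real) \<Rightarrow> 'a \<Rightarrow> 'a" where
  "grad f x = (\<Sum>b\<in>Basis. dd f b x *\<^sub>R b)"

lemma grad_inner:
  assumes "(f has_derivative f') (at x)"
  shows "grad f x \<bullet> v = f' v"
proof -
  have "grad f x \<bullet> v = (\<Sum>b\<in>Basis. (b \<bullet> v) * f' b)"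
    by (simp add: grad_def inner_sum_left dd_eq[OF assms] mult.commute)
  also have "\<dots> = f' (\<Sum>b\<in>Basis. (v \<bullet> b) *\<^sub>R b)"
    using has_derivative_linear[OF assms] by (simp only: linear_sum linear_scale) (simp add: inner_commute)
  finally show ?thesis by (simp only: euclidean_representation)
qed

lemma has_derivative_grad:
  "(f has_derivative f') (at x) \<Longrightarrow> (f has_derivative (\<lambda>h. grad f x \<bullet> h)) (at x)"
  using grad_inner by (metis (no_types, lifting) ext)

lemma grad_eqI: "(f has_derivative (\<lambda>h. u \<bullet> h)) (at x) \<Longrightarrow> grad f x = u"
  using grad_inner by (metis vector_eq_rdot)

lemma C_on_grad: "open S \<Longrightarrow> C_on (Suc n) f S \<Longrightarrow> C_on n (grad f) S"
  unfolding grad_def[abs_def] by (intro C_on_sum C_on_scaleR C_on_dd C_on_const)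

lemma dd_eq_grad_inner: "C_on (Suc n) f S \<Longrightarrow> x \<in> S \<Longrightarrow> dd f v x = grad f x \<bullet> v"
  using grad_inner[OF C_on_Suc_has_derivative] by metis

lemma hessian_symmetric:
  assumes "open S" "C_on 2 f S" "x \<in> S" "(grad f has_derivative W) (at x)"
  shows "W u \<bullet> v = u \<bullet> W v"
proof -
  have C2: "C_on (Suc (Suc 0)) f S" using assms(2) by (simp add: numeral_2_eq_2)
  have "dd (dd f k) h x = W h \<bullet> k" for h k
  proof -
    have "dd (dd f k) h x = dd (\<lambda>y. grad f y \<bullet> k) h x"
      using frechet_derivative_cong_open[OF assms(1,3), of "dd f k" "\<lambda>y. grad f y \<bullet> k"]
        dd_eq_grad_inner[OF C2] by simp
    also have "\<dots> = W h \<bullet> k"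
      by (rule dd_eq) (rule has_derivative_inner_left[OF assms(4)])
    finally show ?thesis .
  qed
  then show ?thesis
    using mixed_second_derivatives_symmetric[OF assms(1-3), of v u] by (simp add: inner_commute)
qed

lemma divergence_eq: "(Z has_derivative Z') (at x) \<Longrightarrow> divergence Z x = (\<Sum>b\<in>Basis. Z' b \<bullet> b)"
  by (simp add: divergence_def dd_eq)

lemma divergence_scaleR:
  assumes q: "(q has_derivative q') (at x)" and Z: "(Z has_derivative Z') (at x)"
  shows "divergence (\<lambda>y. q y *\<^sub>R Z y) x = q x * divergence Z x + q' (Z x)"
proof -
  have "((\<lambda>y. q y *\<^sub>R Z y) has_derivative (\<lambda>h. q x *\<^sub>R Z' h + q' h *\<^sub>R Z x)) (at x)"
    using q Z by (rule has_derivative_scaleR)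
  then have "divergence (\<lambda>y. q y *\<^sub>R Z y) x = (\<Sum>b\<in>Basis. q x * (Z' b \<bullet> b) + (Z x \<bullet> b) * q' b)"
    by (simp add: divergence_eq inner_add_left mult.commute)
  also have "\<dots> = q x * divergence Z x + (\<Sum>b\<in>Basis. (Z x \<bullet> b) * q' b)"
    by (simp add: sum.distrib divergence_eq[OF Z] sum_distrib_left)
  also have "(\<Sum>b\<in>Basis. (Z x \<bullet> b) * q' b) = q' (\<Sum>b\<in>Basis. (Z x \<bullet> b) *\<^sub>R b)"
    using has_derivative_linear[OF q] by (simp only: linear_sum linear_scale real_scaleR_def)
  finally show ?thesis by (simp only: euclidean_representation)
qed

lemma divergence_add:
  "(Y has_derivative Y') (at x) \<Longrightarrow> (Z has_derivative Z') (at x) \<Longrightarrow>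
    divergence (\<lambda>y. Y y + Z y) x = divergence Y x + divergence Z x"
  by (simp add: divergence_eq[OF has_derivative_add] divergence_eq inner_add_left sum.distrib)

lemmas has_derivative_matrix_vector_mult =
  bounded_bilinear.FDERIV[OF bounded_bilinear_matrix_vector_mult]

lemma symmetric_matrix_inner:
  fixes B :: "real ^ 'm ^ 'm::finite"
  assumes "transpose B = B"
  shows "(B *v u) \<bullet> z = u \<bullet> (B *v z)"
  using dot_lmul_matrix[of u B z] transpose_matrix_vector[of B u] assms by simp

text \<open>Multiplying the second order operator by a first order one, as in Rellich's identity, leaves
  a divergence and quadratic terms in which no second derivatives of \<open>v\<close> occur. The symmetry of \<open>A\<close> and of the Hessian \<open>W\<close> lets the second derivatives combine to the derivative
  of \<open>w \<bullet> Z\<close> along \<open>X\<close>, which is a divergence up to the term with \<open>div X\<close>. The parameter \<open>s\<close> will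
  be \<open>t\<^sup>2\<close>.\<close>

lemma rellich_identity:
  fixes A :: "real ^ 'm \<Rightarrow> real ^ 'm ^ 'm::finite" and X w :: "real ^ 'm \<Rightarrow> real ^ 'm"
    and v b :: "real ^ 'm \<Rightarrow> real"
  assumes A: "(A has_derivative A') (at x)" and X: "(X has_derivative X') (at x)"
    and w: "(w has_derivative W) (at x)" and v: "(v has_derivative (\<lambda>h. w x \<bullet> h)) (at x)"
    and b: "(b has_derivative b') (at x)"
    and symA: "\<And>u z. (A x *v u) \<bullet> z = u \<bullet> (A x *v z)"
    and symW: "\<And>u z. W u \<bullet> z = u \<bullet> W z"
    and Z_def: "Z = (\<lambda>y. A y *v w y)" and q_def: "q = (\<lambda>y. 2 * (X y \<bullet> w y) + \<mu> * v y)"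
    and Y_def: "Y = (\<lambda>y. - q y *\<^sub>R Z y + (w y \<bullet> Z y - s * (b y * (v y)\<^sup>2)) *\<^sub>R X y)"
  shows "- q x * (divergence Z x + s * b x * v x) = divergence Y x
    + (2 * (X' (Z x) \<bullet> w x) - w x \<bullet> (A' (X x) *v w x) + (\<mu> - divergence X x) * (w x \<bullet> Z x))
    + s * (v x)\<^sup>2 * (b' (X x) - (\<mu> - divergence X x) * b x)"
proof -
  have Z: "(Z has_derivative (\<lambda>h. A x *v W h + A' h *v w x)) (at x)"
    unfolding Z_def using A w by (rule has_derivative_matrix_vector_mult)
  have q: "(q has_derivative (\<lambda>h. 2 * (X x \<bullet> W h + X' h \<bullet> w x) + \<mu> * (w x \<bullet> h))) (at x)"
    unfolding q_def using X w v by (auto intro!: derivative_eq_intros)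
  have mq: "((\<lambda>y. - q y) has_derivative (\<lambda>h. - (2 * (X x \<bullet> W h + X' h \<bullet> w x) + \<mu> * (w x \<bullet> h)))) (at x)"
    using q by (rule has_derivative_minus)
  have r: "((\<lambda>y. w y \<bullet> Z y - s * (b y * (v y)\<^sup>2)) has_derivative
      (\<lambda>h. w x \<bullet> (A x *v W h + A' h *v w x) + W h \<bullet> Z x
        - s * (b' h * (v x)\<^sup>2 + b x * (2 * v x * (w x \<bullet> h))))) (at x)"
    using w Z b v by (auto intro!: derivative_eq_intros simp: algebra_simps)
  have "divergence Y x = divergence (\<lambda>y. - q y *\<^sub>R Z y) x
      + divergence (\<lambda>y. (w y \<bullet> Z y - s * (b y * (v y)\<^sup>2)) *\<^sub>R X y) x"
    unfolding Y_def
    by (rule divergence_add) (rule has_derivative_scaleR[OF mq Z], rule has_derivative_scaleR[OF r X])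
  also have "\<dots> = - q x * divergence Z x - (2 * (X x \<bullet> W (Z x) + X' (Z x) \<bullet> w x) + \<mu> * (w x \<bullet> Z x))
     + ((w x \<bullet> Z x - s * (b x * (v x)\<^sup>2)) * divergence X x
     + (w x \<bullet> (A x *v W (X x) + A' (X x) *v w x) + W (X x) \<bullet> Z x
        - s * (b' (X x) * (v x)\<^sup>2 + b x * (2 * v x * (w x \<bullet> X x)))))"
    unfolding divergence_scaleR[OF mq Z] divergence_scaleR[OF r X] by simp
  finally have div: "divergence Y x = \<dots>" .
  have 1: "w x \<bullet> (A x *v W (X x)) = Z x \<bullet> W (X x)"
    using symA[of "w x" "W (X x)"] by (simp add: Z_def)
  have 2: "X x \<bullet> W (Z x) = W (X x) \<bullet> Z x" using symW by simp
  have 3: "q x = 2 * (X x \<bullet> w x) + \<mu> * v x" by (simp add: q_def)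
  show ?thesis
    unfolding div inner_add_right 1 2 3
    by (simp add: algebra_simps power2_eq_square inner_commute)
qed

text \<open>For \<open>v = exp (t \<psi>) V\<close> the weighted operator splits into the formally symmetric part
  \<open>div (A\<nabla>v) + t\<^sup>2 b v\<close>, where \<open>b = \<nabla>\<psi> \<bullet> A\<nabla>\<psi>\<close>, and the formally antisymmetric part
  \<open>- 2 t X \<bullet> \<nabla>v - t v div X\<close>, where \<open>X = A\<nabla>\<psi>\<close>.\<close>

lemma conjugated_operator:
  fixes A :: "real ^ 'm \<Rightarrow> real ^ 'm ^ 'm::finite"
  assumes A: "C_on 1 A UNIV" and sym: "transpose (A x) = A x"
    and \<psi>: "C_on 2 \<psi> UNIV" and V: "C_on 2 V UNIV"
    and X_def: "X = (\<lambda>y. A y *v grad \<psi> y)"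
    and v_def: "v = (\<lambda>y. exp (t * \<psi> y) * V y)"
  shows "grad v x = exp (t * \<psi> x) *\<^sub>R (grad V x + (t * V x) *\<^sub>R grad \<psi> x)" (is ?grad)
    and "divergence (\<lambda>y. A y *v grad v y) x = exp (t * \<psi> x) * divergence (\<lambda>y. A y *v grad V y) x
      + 2 * t * (X x \<bullet> grad v x) - t\<^sup>2 * v x * (grad \<psi> x \<bullet> X x) + t * v x * divergence X x"
proof -
  have gV: "C_on 1 (grad V) UNIV" and g\<psi>: "C_on 1 (grad \<psi>) UNIV"
    using C_on_grad[OF open_UNIV, of "Suc 0"] V \<psi> by (simp_all add: numeral_2_eq_2)
  have dV: "(V has_derivative (\<lambda>h. grad V y \<bullet> h)) (at y)"
    and d\<psi>: "(\<psi> has_derivative (\<lambda>h. grad \<psi> y \<bullet> h)) (at y)" for y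
    using V \<psi> by (auto intro!: has_derivative_grad C_on_has_derivative)
  have de: "((\<lambda>y. exp (t * \<psi> y)) has_derivative (\<lambda>h. exp (t * \<psi> y) * (t * (grad \<psi> y \<bullet> h)))) (at y)" for y
    using d\<psi> by (auto intro!: derivative_eq_intros)
  have gv: "grad v y = exp (t * \<psi> y) *\<^sub>R (grad V y + (t * V y) *\<^sub>R grad \<psi> y)" for y
  proof (rule grad_eqI)
    show "(v has_derivative (\<lambda>h. (exp (t * \<psi> y) *\<^sub>R (grad V y + (t * V y) *\<^sub>R grad \<psi> y)) \<bullet> h)) (at y)"
      unfolding v_def using has_derivative_mult[OF de dV, of y]
      by (simp add: algebra_simps)
  qed
  then show ?grad .
  have dv: "(v has_derivative (\<lambda>h. grad v y \<bullet> h)) (at y)" for y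
    unfolding v_def by (rule has_derivative_grad) (rule has_derivative_mult[OF de dV])
  obtain P' where P': "((\<lambda>y. A y *v grad V y) has_derivative P') (at x)"
    using C_on_has_derivative[OF C_on_matrix_vector_mult[OF open_UNIV A gV]] by auto
  have XC: "C_on 1 X UNIV" unfolding X_def by (rule C_on_matrix_vector_mult[OF open_UNIV A g\<psi>])
  then obtain X' where X': "(X has_derivative X') (at x)"
    using C_on_has_derivative[OF XC] by auto
  have eq: "(\<lambda>y. A y *v grad v y) = (\<lambda>y. exp (t * \<psi> y) *\<^sub>R (A y *v grad V y) + (t * v y) *\<^sub>R X y)"
  proof
    fix y
    show "A y *v grad v y = exp (t * \<psi> y) *\<^sub>R (A y *v grad V y) + (t * v y) *\<^sub>R X y"
      unfolding gv[of y]
      by (simp add: X_def v_def matrix_vector_mult_scaleR matrix_vector_right_distrib algebra_simps)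
  qed
  have tv: "((\<lambda>y. t * v y) has_derivative (\<lambda>h. t * (grad v x \<bullet> h))) (at x)"
    using dv by (auto intro!: derivative_eq_intros)
  have div: "divergence (\<lambda>y. A y *v grad v y) x
     = exp (t * \<psi> x) * divergence (\<lambda>y. A y *v grad V y) x
       + exp (t * \<psi> x) * (t * (grad \<psi> x \<bullet> (A x *v grad V x)))
       + (t * v x * divergence X x + t * (grad v x \<bullet> X x))"
    unfolding eq
    by (simp add: divergence_add[OF has_derivative_scaleR[OF de P'] has_derivative_scaleR[OF tv X']]
        divergence_scaleR[OF de P'] divergence_scaleR[OF tv X'])
  have "exp (t * \<psi> x) * (grad \<psi> x \<bullet> (A x *v grad V x))
      = X x \<bullet> grad v x - t * v x * (grad \<psi> x \<bullet> X x)"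
  proof -
    have "grad \<psi> x \<bullet> (A x *v grad V x) = X x \<bullet> grad V x"
      using symmetric_matrix_inner[OF sym, of "grad \<psi> x" "grad V x"] by (simp add: X_def)
    moreover have "v x = exp (t * \<psi> x) * V x" by (simp add: v_def)
    ultimately show ?thesis
      unfolding gv[of x] by (simp add: algebra_simps inner_commute)
  qed
  then have "exp (t * \<psi> x) * (t * (grad \<psi> x \<bullet> (A x *v grad V x)))
      = t * (X x \<bullet> grad v x - t * v x * (grad \<psi> x \<bullet> X x))"
    by (simp only: mult.left_commute[of "exp (t * \<psi> x)" t])
  then show "divergence (\<lambda>y. A y *v grad v y) x = exp (t * \<psi> x) * divergence (\<lambda>y. A y *v grad V y) x
      + 2 * t * (X x \<bullet> grad v x) - t\<^sup>2 * v x * (grad \<psi> x \<bullet> X x) + t * v x * divergence X x"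
    unfolding div by (simp add: algebra_simps inner_commute power2_eq_square)
qed

lemma C_on_exp_weight:
  fixes \<psi> :: "'a::euclidean_space \<Rightarrow> real" and t :: real
  shows "open S \<Longrightarrow> C_on n \<psi> S \<Longrightarrow> C_on n (\<lambda>y. exp (t * \<psi> y)) S"
  using C_on_compose_real[OF _ open_UNIV _ _ C_on_exp, of S "\<lambda>y. t * \<psi> y" n]
  by (simp add: C_on_mult C_on_const)

text \<open>The Carleman estimate at a single point, before integration. The variables stand for the weight
  (\<open>e\<close>), the operator applied to \<open>V\<close> (\<open>P\<close>), the symmetric part (\<open>a\<close>), the multiplier (\<open>q\<close>), \<open>\<mu> - div X\<close>
  (\<open>m\<close>), the two forms of \<open>carleman_weight_on\<close> (\<open>Q1\<close>, \<open>Q2\<close>) and the divergence (\<open>dY\<close>). The gain is the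
  cross term in \<open>(a - t q)\<^sup>2\<close>, which Rellich's identity turns into \<open>t Q1\<close> and \<open>t\<^sup>3 v\<^sup>2 Q2\<close>; the error
  \<open>t\<^sup>2 m\<^sup>2 v\<^sup>2\<close> is of lower order in \<open>t\<close> and is absorbed once \<open>t \<ge> M\<^sup>2 / c\<close>.\<close>

lemma carleman_arithmetic:
  fixes P e t q a m vx w2 c M Q1 Q2 dY V2 g2 :: real
  assumes conj: "a - t * q = e * P - t * m * vx"
    and ident: "- q * a = dY + Q1 + t\<^sup>2 * vx\<^sup>2 * Q2"
    and Q1: "Q1 \<ge> c * w2" and Q2: "Q2 \<ge> c" and m: "\<bar>m\<bar> \<le> M"
    and c: "0 < c" and t: "1 \<le> t" "M\<^sup>2 / c \<le> t"
    and V: "e\<^sup>2 * V2 = vx\<^sup>2" and g: "e\<^sup>2 * g2 \<le> 2 * w2 + 2 * t\<^sup>2 * M\<^sup>2 * vx\<^sup>2" and w: "0 \<le> w2"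
  shows "e\<^sup>2 * (t ^ 3 * V2 + t * g2) \<le> (2 + 2 * M\<^sup>2) / c * (e\<^sup>2 * P\<^sup>2 - 2 * t * dY)"
proof -
  have M2: "m\<^sup>2 \<le> M\<^sup>2" using m by (metis abs_le_square_iff abs_of_nonneg abs_ge_zero order_trans)
  have "0 \<le> (a + t * q)\<^sup>2" by simp
  then have "- 4 * t * q * a \<le> (a - t * q)\<^sup>2" by (simp add: power2_eq_square algebra_simps)
  also have "\<dots> \<le> 2 * (e * P)\<^sup>2 + 2 * (t * m * vx)\<^sup>2"
    unfolding conj using zero_le_power2[of "e * P + t * m * vx"]
    by (simp add: power2_eq_square algebra_simps)
  also have "(t * m * vx)\<^sup>2 \<le> t\<^sup>2 * M\<^sup>2 * vx\<^sup>2"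
    using M2 by (simp add: power_mult_distrib mult_left_mono mult_right_mono)
  also have "t\<^sup>2 * M\<^sup>2 * vx\<^sup>2 \<le> t\<^sup>2 * (c * t) * vx\<^sup>2"
    using t c by (intro mult_right_mono mult_left_mono) (auto simp: field_simps)
  also have "- 4 * t * q * a = 4 * t * (dY + Q1 + t\<^sup>2 * vx\<^sup>2 * Q2)"
    unfolding ident[symmetric] by simp
  finally have 1: "4 * t * (dY + Q1 + t\<^sup>2 * vx\<^sup>2 * Q2) \<le> 2 * (e * P)\<^sup>2 + 2 * (t\<^sup>2 * (c * t) * vx\<^sup>2)"
    by simp
  have "t * (c * w2) \<le> t * Q1" using Q1 t by (intro mult_left_mono) auto
  moreover have "t * (t\<^sup>2 * vx\<^sup>2 * c) \<le> t * (t\<^sup>2 * vx\<^sup>2 * Q2)"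
    using Q2 t by (intro mult_left_mono) auto
  ultimately have 2: "2 * (c * (t * w2)) + c * (t ^ 3 * vx\<^sup>2) \<le> e\<^sup>2 * P\<^sup>2 - 2 * t * dY"
    using 1 by (simp add: algebra_simps power2_eq_square power3_eq_cube)
  have "e\<^sup>2 * (t ^ 3 * V2 + t * g2) = t ^ 3 * (e\<^sup>2 * V2) + t * (e\<^sup>2 * g2)"
    by (simp add: algebra_simps)
  also have "\<dots> \<le> t ^ 3 * vx\<^sup>2 + t * (2 * w2 + 2 * t\<^sup>2 * M\<^sup>2 * vx\<^sup>2)"
    using g t V by (intro add_mono mult_left_mono) auto
  also have "\<dots> = 2 * (t * w2) + (1 + 2 * M\<^sup>2) * (t ^ 3 * vx\<^sup>2)"
    by (simp add: algebra_simps power2_eq_square power3_eq_cube)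
  also have "\<dots> \<le> (2 + 2 * M\<^sup>2) * (2 * (t * w2)) + (2 + 2 * M\<^sup>2) * (t ^ 3 * vx\<^sup>2)"
    using t w mult_right_mono[of 1 "2 + 2 * M\<^sup>2" w2]
    by (intro add_mono mult_right_mono) auto
  also have "\<dots> = (2 + 2 * M\<^sup>2) / c * (2 * (c * (t * w2)) + c * (t ^ 3 * vx\<^sup>2))"
    using c by (simp add: field_simps)
  also have "\<dots> \<le> (2 + 2 * M\<^sup>2) / c * (e\<^sup>2 * P\<^sup>2 - 2 * t * dY)"
    using 2 c by (intro mult_left_mono) (auto simp: add_nonneg_nonneg)
  finally show ?thesis .
qed

text \<open>The two quadratic forms that remain after the integration by parts: the one in the
  gradient and the coefficient of the square of the function. Here \<open>X = A\<nabla>\<psi>\<close>. The number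
  \<open>\<mu>\<close> is the zero order coefficient of the multiplier \<open>2 X \<bullet> \<nabla>v + \<mu> v\<close> and can be chosen
  freely, because replacing \<open>div X\<close> by \<open>\<mu>\<close> changes the conjugated operator
  only by a term of lower order in \<open>t\<close>.\<close>

definition carleman_weight_on ::
    "(real ^ 'm) set \<Rightarrow> (real ^ 'm \<Rightarrow> real ^ 'm ^ 'm::finite) \<Rightarrow> (real ^ 'm \<Rightarrow> real)
     \<Rightarrow> real \<Rightarrow> real \<Rightarrow> real \<Rightarrow> bool" where
  "carleman_weight_on S A \<psi> \<mu> c M \<longleftrightarrow> (\<forall>X b. X = (\<lambda>y. A y *v grad \<psi> y) \<longrightarrow> b = (\<lambda>y. grad \<psi> y \<bullet> X y) \<longrightarrow>
    (\<forall>x\<in>S. (\<forall>u. c * (u \<bullet> u) \<le> 2 * (dd X (A x *v u) x \<bullet> u) - u \<bullet> (dd A (X x) x *v u)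
        + (\<mu> - divergence X x) * (u \<bullet> (A x *v u)))
      \<and> c \<le> dd b (X x) x - (\<mu> - divergence X x) * b x
      \<and> \<bar>\<mu> - divergence X x\<bar> \<le> M \<and> norm (grad \<psi> x) \<le> M))"

text \<open>Integrating the pointwise inequality removes the divergence. The powers of \<open>t\<close> on the left are
  what makes the estimate strong enough to absorb all lower order terms of an equation.\<close>

lemma carleman_estimate:
  fixes A :: "real ^ 'm \<Rightarrow> real ^ 'm ^ 'm::finite" and \<psi> V :: "real ^ 'm \<Rightarrow> real"
  assumes A: "C_on 1 A UNIV" and sym: "\<And>x. transpose (A x) = A x"
    and \<psi>: "C_on 2 \<psi> UNIV" and weight: "carleman_weight_on (cball p d) A \<psi> \<mu> c M"
    and c: "0 < c"
    and t: "1 \<le> t" "M\<^sup>2 / c \<le> t"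
    and V: "C_on 2 V UNIV" and supp: "\<And>x. x \<notin> cball p d \<Longrightarrow> V x = 0"
  shows "(\<integral>x. (exp (t * \<psi> x))\<^sup>2 * (t ^ 3 * (V x)\<^sup>2 + t * (norm (grad V x))\<^sup>2) \<partial>lborel)
    \<le> (2 + 2 * M\<^sup>2) / c * (\<integral>x. (exp (t * \<psi> x))\<^sup>2 * (divergence (\<lambda>y. A y *v grad V y) x)\<^sup>2 \<partial>lborel)"
proof -
  define X where "X = (\<lambda>y. A y *v grad \<psi> y)"
  define b where "b = (\<lambda>y. grad \<psi> y \<bullet> X y)"
  have Q1: "c * (u \<bullet> u) \<le> 2 * (dd X (A x *v u) x \<bullet> u) - u \<bullet> (dd A (X x) x *v u)
        + (\<mu> - divergence X x) * (u \<bullet> (A x *v u))"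
    and Q2: "c \<le> dd b (X x) x - (\<mu> - divergence X x) * b x"
    and M: "\<bar>\<mu> - divergence X x\<bar> \<le> M" "norm (grad \<psi> x) \<le> M"
    if "x \<in> cball p d" for x u
    using weight X_def b_def that unfolding carleman_weight_on_def by simp_all
  define K where "K = (2 + 2 * M\<^sup>2) / c"
  define e where "e x = exp (t * \<psi> x)" for x
  define P where "P = divergence (\<lambda>y. A y *v grad V y)"
  define v where "v = (\<lambda>y. exp (t * \<psi> y) * V y)"
  define w where "w = grad v"
  define Z where "Z = (\<lambda>y. A y *v w y)"
  define q where "q = (\<lambda>y. 2 * (X y \<bullet> w y) + \<mu> * v y)"
  define Y where "Y = (\<lambda>y. - q y *\<^sub>R Z y + (w y \<bullet> Z y - t\<^sup>2 * (b y * (v y)\<^sup>2)) *\<^sub>R X y)"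
  have le1: "C_on (Suc 0) f UNIV" if "C_on 2 f UNIV" for f :: "real ^ 'm \<Rightarrow> real"
    using C_on_le[OF that] by simp
  have grad1: "C_on (Suc 0) (grad f) UNIV" if "C_on 2 f UNIV" for f :: "real ^ 'm \<Rightarrow> real"
    using C_on_grad[OF open_UNIV, of "Suc 0"] that by (simp add: numeral_2_eq_2)
  have e2: "C_on 2 e UNIV" unfolding e_def[abs_def] by (rule C_on_exp_weight[OF open_UNIV \<psi>])
  have v2: "C_on 2 v UNIV" unfolding v_def using e2 V
    by (intro C_on_mult) (auto simp: e_def[abs_def])
  have A1: "C_on (Suc 0) A UNIV" using A by simp
  have w1: "C_on (Suc 0) w UNIV" unfolding w_def by (rule grad1[OF v2])
  have X1: "C_on (Suc 0) X UNIV" unfolding X_def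
    by (rule C_on_matrix_vector_mult[OF open_UNIV A1 grad1[OF \<psi>]])
  have b1: "C_on (Suc 0) b UNIV" unfolding b_def
    by (rule C_on_inner[OF open_UNIV grad1[OF \<psi>] X1])
  have Z1: "C_on (Suc 0) Z UNIV" unfolding Z_def
    by (rule C_on_matrix_vector_mult[OF open_UNIV A1 w1])
  have q1: "C_on (Suc 0) q UNIV" unfolding q_def
    by (intro C_on_add C_on_mult C_on_const C_on_inner X1 w1 le1 v2 open_UNIV)
  have Y1: "C_on (Suc 0) Y UNIV" unfolding Y_def power2_eq_square
    by (intro C_on_add C_on_scaleR C_on_uminus C_on_diff C_on_mult C_on_const C_on_inner q1 Z1 w1 b1 X1
        le1 v2 open_UNIV)
  have AgV1: "C_on (Suc 0) (\<lambda>y. A y *v grad V y) UNIV"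
    by (rule C_on_matrix_vector_mult[OF open_UNIV A1 grad1[OF V]])
  have v0: "v x = 0" if "x \<notin> cball p d" for x using supp[OF that] by (simp add: v_def)
  have w0: "w x = 0" if "x \<notin> cball p d" for x
    unfolding w_def grad_def using dd_zero_off_support[OF v0 that] by simp
  have gV0: "grad V x = 0" if "x \<notin> cball p d" for x
    unfolding grad_def using dd_zero_off_support[OF supp that] by simp
  have Y0: "Y x = 0" if "x \<notin> cball p d" for x
    using v0[OF that] w0[OF that] by (simp add: Y_def Z_def)
  have divY0: "divergence Y x = 0" if "x \<notin> cball p d" for x
    unfolding divergence_def using dd_zero_off_support[OF Y0 that] by simp
  have P0: "P x = 0" if "x \<notin> cball p d" for x
  proof -
    have "dd (\<lambda>y. A y *v grad V y) u x = 0" for u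
      by (rule dd_zero_off_support[OF _ that]) (simp add: gV0)
    then show ?thesis by (simp add: P_def divergence_def)
  qed
  have pointwise: "(e x)\<^sup>2 * (t ^ 3 * (V x)\<^sup>2 + t * (norm (grad V x))\<^sup>2)
      \<le> K * ((e x)\<^sup>2 * (P x)\<^sup>2 - 2 * t * divergence Y x)" for x
  proof (cases "x \<in> cball p d")
    case False
    then show ?thesis using supp gV0 divY0 P0 by simp
  next
    case True
    have gv: "w x = e x *\<^sub>R (grad V x + (t * V x) *\<^sub>R grad \<psi> x)"
      unfolding w_def e_def by (rule conjugated_operator(1)[OF A sym \<psi> V X_def v_def])
    have dv: "(v has_derivative (\<lambda>h. w x \<bullet> h)) (at x)"
      unfolding w_def by (rule has_derivative_grad[OF C_on_has_derivative[OF v2]]) auto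
    have dw: "(w has_derivative frechet_derivative w (at x)) (at x)"
      by (rule C_on_has_derivative[OF w1]) auto
    have symW: "dd w u x \<bullet> z = u \<bullet> dd w z x" for u z
      unfolding w_def by (rule hessian_symmetric[OF open_UNIV v2 _ dw[unfolded w_def]]) simp
    have ident: "- q x * (divergence Z x + t\<^sup>2 * b x * v x) = divergence Y x
      + (2 * (dd X (Z x) x \<bullet> w x) - w x \<bullet> (dd A (X x) x *v w x) + (\<mu> - divergence X x) * (w x \<bullet> Z x))
      + t\<^sup>2 * (v x)\<^sup>2 * (dd b (X x) x - (\<mu> - divergence X x) * b x)"
      by (rule rellich_identity[OF _ _ dw dv _ symmetric_matrix_inner[OF sym] symW Z_def q_def Y_def])
        (auto intro: C_on_has_derivative[OF A1] C_on_has_derivative[OF X1] C_on_has_derivative[OF b1])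
    have "divergence Z x = e x * P x + 2 * t * (X x \<bullet> w x) - t\<^sup>2 * v x * b x + t * v x * divergence X x"
      unfolding Z_def w_def e_def P_def b_def
      by (rule conjugated_operator(2)[OF A sym \<psi> V X_def v_def])
    then have conj: "(divergence Z x + t\<^sup>2 * b x * v x) - t * q x
        = e x * P x - t * (\<mu> - divergence X x) * v x"
      by (simp add: q_def algebra_simps)
    have "norm (e x *\<^sub>R grad V x) \<le> norm (w x) + norm ((t * v x) *\<^sub>R grad \<psi> x)"
    proof -
      have "e x *\<^sub>R grad V x = w x - (t * v x) *\<^sub>R grad \<psi> x"
        unfolding gv by (simp add: e_def v_def algebra_simps)
      then show ?thesis using norm_triangle_ineq4 by metis
    qed
    also have "\<dots> \<le> norm (w x) + t * \<bar>v x\<bar> * M"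
      using M(2)[OF True] t by (simp add: abs_mult mult_left_mono)
    finally have "(e x * norm (grad V x))\<^sup>2 \<le> (norm (w x) + t * \<bar>v x\<bar> * M)\<^sup>2"
      by (intro power_mono) (auto simp: e_def)
    also have "\<dots> \<le> 2 * (norm (w x))\<^sup>2 + 2 * (t * \<bar>v x\<bar> * M)\<^sup>2"
      using zero_le_power2[of "norm (w x) - t * \<bar>v x\<bar> * M"] by (simp add: power2_eq_square algebra_simps)
    finally have g: "(e x)\<^sup>2 * (norm (grad V x))\<^sup>2 \<le> 2 * (norm (w x))\<^sup>2 + 2 * t\<^sup>2 * M\<^sup>2 * (v x)\<^sup>2"
      by (simp add: power_mult_distrib mult_ac)
    have Vv: "(e x)\<^sup>2 * (V x)\<^sup>2 = (v x)\<^sup>2"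
      by (simp add: e_def v_def power_mult_distrib)
    show ?thesis unfolding K_def
    proof (rule carleman_arithmetic[OF conj ident _ Q2[OF True] M(1)[OF True] c t Vv g])
      show "c * (norm (w x))\<^sup>2 \<le> 2 * (dd X (Z x) x \<bullet> w x) - w x \<bullet> (dd A (X x) x *v w x)
          + (\<mu> - divergence X x) * (w x \<bullet> Z x)"
        using Q1[OF True, of "w x"] by (simp add: Z_def power2_norm_eq_inner)
    qed auto
  qed
  have ce: "continuous_on UNIV e" and cV: "continuous_on UNIV V" and cg: "continuous_on UNIV (grad V)"
    using C_on_continuous[OF e2] C_on_continuous[OF V] C_on_continuous[OF grad1[OF V]] by auto
  have cP: "continuous_on UNIV P"
    unfolding P_def using AgV1 by (intro continuous_on_divergence) simp
  have cY: "continuous_on UNIV (divergence Y)"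
    using Y1 by (intro continuous_on_divergence) simp
  have i1: "integrable lborel (\<lambda>x. (e x)\<^sup>2 * (t ^ 3 * (V x)\<^sup>2 + t * (norm (grad V x))\<^sup>2))"
    by (rule integrable_compact_support[of _ p d])
      (intro continuous_intros ce cV cg, simp add: supp gV0)
  have i2: "integrable lborel (\<lambda>x. (e x)\<^sup>2 * (P x)\<^sup>2)"
    by (rule integrable_compact_support[of _ p d]) (intro continuous_intros ce cP, simp add: P0)
  have i3: "integrable lborel (divergence Y)"
    by (rule integrable_compact_support[of _ p d]) (use cY divY0 in auto)
  have "(\<integral>x. (e x)\<^sup>2 * (t ^ 3 * (V x)\<^sup>2 + t * (norm (grad V x))\<^sup>2) \<partial>lborel)
      \<le> (\<integral>x. K * ((e x)\<^sup>2 * (P x)\<^sup>2 - 2 * t * divergence Y x) \<partial>lborel)"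
    using i1 i2 i3 pointwise by (intro integral_mono) auto
  also have "\<dots> = K * ((\<integral>x. (e x)\<^sup>2 * (P x)\<^sup>2 \<partial>lborel) - 2 * t * (\<integral>x. divergence Y x \<partial>lborel))"
    using i2 i3 by simp
  also have "(\<integral>x. divergence Y x \<partial>lborel) = 0"
    using Y1 Y0 by (intro integral_divergence_eq_0[of Y p d]) auto
  finally show ?thesis by (simp add: K_def P_def e_def)
qed

section \<open>Weights and cut-off functions\<close>

lemma quadratic_form_lower_bound:
  fixes f :: "'a::real_inner \<Rightarrow> real"
  assumes "\<And>u. norm u = 1 \<Longrightarrow> a \<le> f u" "\<And>s u. f (s *\<^sub>R u) = s\<^sup>2 * f u"
  shows "a * (u \<bullet> u) \<le> f u"
proof (cases "u = 0")
  case True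
  then show ?thesis using assms(2)[of 0 0] by simp
next
  case False
  then have "u = norm u *\<^sub>R (u /\<^sub>R norm u)" by simp
  then have "f u = (norm u)\<^sup>2 * f (u /\<^sub>R norm u)" using assms(2) by metis
  moreover have "a \<le> f (u /\<^sub>R norm u)" using assms(1) False by simp
  ultimately show ?thesis
    using mult_left_mono[of a "f (u /\<^sub>R norm u)" "(norm u)\<^sup>2"] by (simp add: power2_norm_eq_inner mult.commute)
qed

lemma quadratic_form_bounded:
  fixes f :: "'a::euclidean_space \<Rightarrow> real"
  assumes "continuous_on UNIV f" "\<And>s u. f (s *\<^sub>R u) = s\<^sup>2 * f u"
  obtains C where "\<And>u. \<bar>f u\<bar> \<le> C * (u \<bullet> u)"
proof -
  have "compact (f ` sphere 0 1)"
    using assms(1) by (intro compact_continuous_image) (auto intro: continuous_on_subset)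
  then have "bounded (f ` sphere 0 1)" by (rule compact_imp_bounded)
  then obtain C where C: "\<forall>y\<in>f ` sphere 0 1. norm y \<le> C" unfolding bounded_iff by (elim exE)
  have 1: "- C * (u \<bullet> u) \<le> f u" for u
    by (rule quadratic_form_lower_bound) (use C assms(2) in \<open>force+\<close>)
  have 2: "- C * (u \<bullet> u) \<le> - f u" for u
    by (rule quadratic_form_lower_bound) (use C assms(2) in \<open>force+\<close>)
  show ?thesis using 1 2 by (intro that[of C]) (smt (verit) minus_mult_left)
qed

lemma quadratic_form_coercive:
  fixes f :: "'a::euclidean_space \<Rightarrow> real"
  assumes "continuous_on UNIV f" "\<And>s u. f (s *\<^sub>R u) = s\<^sup>2 * f u" "\<And>u. u \<noteq> 0 \<Longrightarrow> 0 < f u"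
  obtains l where "0 < l" "\<And>u. l * (u \<bullet> u) \<le> f u"
proof -
  have ne: "sphere (0::'a) 1 \<noteq> {}" by simp
  obtain u0 where u0: "u0 \<in> sphere 0 1" "\<And>u. u \<in> sphere 0 1 \<Longrightarrow> f u0 \<le> f u"
    using continuous_attains_inf[OF compact_sphere ne continuous_on_subset[OF assms(1) subset_UNIV]]
    by blast
  have "u0 \<noteq> 0" using u0(1) by auto
  then have "0 < f u0" by (rule assms(3))
  moreover have "f u0 * (u \<bullet> u) \<le> f u" for u
    by (rule quadratic_form_lower_bound) (use u0 assms(2) in auto)
  ultimately show ?thesis by (rule that)
qed

text \<open>The weight is convexified by \<open>\<rho> \<mapsto> \<rho> + K \<rho>\<^sup>2 / 2\<close>. At \<open>p\<close> this adds \<open>2 K (A\<nabla>\<rho> \<bullet> u)\<^sup>2\<close> to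
  the gradient form and \<open>2 K \<beta>\<^sup>2\<close>, where \<open>\<beta> = \<nabla>\<rho> \<bullet> A\<nabla>\<rho>\<close> at \<open>p\<close>, to the zero order term. The
  free constant \<open>\<mu>\<close> moves positivity from the latter to the former: first \<open>\<mu> - div X\<close> is taken
  large enough for the gradient form, and then \<open>K\<close> large enough for the zero order term.
  Both inequalities persist near \<open>p\<close> by continuity.\<close>

lemma carleman_weight:
  fixes A :: "real ^ 'm \<Rightarrow> real ^ 'm ^ 'm::finite" and \<rho> :: "real ^ 'm \<Rightarrow> real"
  assumes A: "C_on 1 A UNIV" and sym: "\<And>x. transpose (A x) = A x"
    and pos: "\<And>u. u \<noteq> 0 \<Longrightarrow> 0 < u \<bullet> (A p *v u)"
    and \<rho>: "C_on 2 \<rho> UNIV" and \<rho>p: "\<rho> p = 0" and grad_ne: "grad \<rho> p \<noteq> 0"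
  obtains K \<mu> d M where "0 < K" "0 < d"
    "carleman_weight_on (cball p d) A (\<lambda>y. \<rho> y + K / 2 * (\<rho> y)\<^sup>2) \<mu> (1 / 2) M"
proof -
  have A1: "C_on (Suc 0) A UNIV" using A by simp
  have \<rho>1: "C_on (Suc 0) \<rho> UNIV" using C_on_le[OF \<rho>] by simp
  have grad1: "C_on (Suc 0) (grad f) UNIV" if "C_on 2 f UNIV" for f :: "real ^ 'm \<Rightarrow> real"
    using C_on_grad[OF open_UNIV, of "Suc 0"] that by (simp add: numeral_2_eq_2)
  define X0 where "X0 = (\<lambda>y. A y *v grad \<rho> y)"
  define b0 where "b0 = (\<lambda>y. grad \<rho> y \<bullet> X0 y)"
  have X01: "C_on (Suc 0) X0 UNIV" unfolding X0_def
    by (rule C_on_matrix_vector_mult[OF open_UNIV A1 grad1[OF \<rho>]])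
  have b01: "C_on (Suc 0) b0 UNIV" unfolding b0_def
    by (rule C_on_inner[OF open_UNIV grad1[OF \<rho>] X01])
  have hd: "(f has_derivative frechet_derivative f (at x)) (at x)" if "C_on (Suc 0) f UNIV"
    for f :: "real ^ 'm \<Rightarrow> 'c::real_normed_vector" and x
    using that by (rule C_on_has_derivative) auto
  have scale: "dd f (s *\<^sub>R h) x = s *\<^sub>R dd f h x" if "C_on (Suc 0) f UNIV"
    for f :: "real ^ 'm \<Rightarrow> 'c::real_normed_vector" and s h x
    using linear_scale[OF has_derivative_linear[OF hd[OF that]]] by simp
  have cdd: "continuous_on T (\<lambda>y. dd f (h y) (g y))"
    if "C_on (Suc 0) f UNIV" "continuous_on T g" "continuous_on T h"
    for f :: "real ^ 'm \<Rightarrow> 'c::real_normed_vector" and T :: "'t::topological_space set" and g h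
    by (rule C_on_continuous_derivative[OF that(1,2) _ that(3)]) simp
  have cmv: "continuous_on T (\<lambda>y. B y *v h y)" if "continuous_on T B" "continuous_on T h"
    for T :: "'t::topological_space set" and B :: "'t \<Rightarrow> real ^ 'm ^ 'm" and h
    using bounded_bilinear.continuous_on[OF bounded_bilinear_matrix_vector_mult that] .
  define \<beta> where "\<beta> = b0 p"
  have \<beta>: "\<beta> > 0" unfolding \<beta>_def b0_def X0_def using pos[OF grad_ne] .
  obtain C where C: "\<And>u. \<bar>2 * (dd X0 (A p *v u) p \<bullet> u) - u \<bullet> (dd A (X0 p) p *v u)\<bar> \<le> C * (u \<bullet> u)"
  proof (rule quadratic_form_bounded)
    show "continuous_on UNIV (\<lambda>u. 2 * (dd X0 (A p *v u) p \<bullet> u) - u \<bullet> (dd A (X0 p) p *v u))"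
      by (intro continuous_intros cdd[OF X01] cmv)
  qed (auto simp: matrix_vector_mult_scaleR scale[OF X01] power2_eq_square algebra_simps)
  obtain l where l: "0 < l" "\<And>u. l * (u \<bullet> u) \<le> u \<bullet> (A p *v u)"
  proof (rule quadratic_form_coercive)
    show "continuous_on UNIV (\<lambda>u. u \<bullet> (A p *v u))"
      by (intro continuous_intros cmv)
  qed (use pos in \<open>auto simp: matrix_vector_mult_scaleR power2_eq_square algebra_simps\<close>)
  \<comment> \<open>This \<open>\<kappa>\<close> is the value of \<open>\<mu> - div X\<close> at \<open>p\<close>.\<close>
  define \<kappa> where "\<kappa> = (\<bar>C\<bar> + 1) / l"
  define K where "K = \<bar>1 + \<kappa> * \<beta> - dd b0 (X0 p) p\<bar> / (2 * \<beta>\<^sup>2) + 1"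
  have K: "0 < K" unfolding K_def by (rule add_nonneg_pos) auto
  have K2: "2 * K * \<beta>\<^sup>2 \<ge> 1 + \<kappa> * \<beta> - dd b0 (X0 p) p"
  proof -
    have "2 * (a / (2 * \<beta>\<^sup>2) + 1) * \<beta>\<^sup>2 = a + 2 * \<beta>\<^sup>2" for a
      using \<beta> by (simp add: field_simps)
    then have "2 * K * \<beta>\<^sup>2 = \<bar>1 + \<kappa> * \<beta> - dd b0 (X0 p) p\<bar> + 2 * \<beta>\<^sup>2" unfolding K_def .
    then show ?thesis using zero_le_power2[of \<beta>] by linarith
  qed
  define \<psi> where "\<psi> = (\<lambda>y. \<rho> y + K / 2 * (\<rho> y)\<^sup>2)"
  have \<psi>2: "C_on 2 \<psi> UNIV" unfolding \<psi>_def power2_eq_square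
    by (intro C_on_add C_on_mult C_on_const \<rho> open_UNIV)
  have d\<rho>: "(\<rho> has_derivative (\<lambda>h. grad \<rho> y \<bullet> h)) (at y)" for y
    by (rule has_derivative_grad[OF hd[OF \<rho>1]])
  have g\<psi>: "grad \<psi> y = (1 + K * \<rho> y) *\<^sub>R grad \<rho> y" for y
    by (rule grad_eqI) (use d\<rho>[of y] in \<open>auto simp: \<psi>_def algebra_simps intro!: derivative_eq_intros\<close>)
  define X where "X = (\<lambda>y. A y *v grad \<psi> y)"
  define b where "b = (\<lambda>y. grad \<psi> y \<bullet> X y)"
  have Xeq: "X = (\<lambda>y. (1 + K * \<rho> y) *\<^sub>R X0 y)"
    by (simp add: X_def X0_def g\<psi> matrix_vector_mult_scaleR)
  have beq: "b = (\<lambda>y. (1 + K * \<rho> y)\<^sup>2 * b0 y)"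
    by (simp add: b_def b0_def Xeq g\<psi> power2_eq_square mult_ac)
  have X1: "C_on (Suc 0) X UNIV" unfolding X_def
    by (rule C_on_matrix_vector_mult[OF open_UNIV A1 grad1[OF \<psi>2]])
  have b1: "C_on (Suc 0) b UNIV" unfolding b_def
    by (rule C_on_inner[OF open_UNIV grad1[OF \<psi>2] X1])
  have s: "((\<lambda>y. 1 + K * \<rho> y) has_derivative (\<lambda>h. K * (grad \<rho> p \<bullet> h))) (at p)"
    using d\<rho>[of p] by (auto intro!: derivative_eq_intros)
  have Xp: "X p = X0 p" and bp: "b p = \<beta>" by (simp_all add: Xeq beq \<rho>p \<beta>_def)
  have ddX: "dd X h p = dd X0 h p + (K * (grad \<rho> p \<bullet> h)) *\<^sub>R X0 p" for h
  proof (rule dd_eq)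
    show "(X has_derivative (\<lambda>h. dd X0 h p + (K * (grad \<rho> p \<bullet> h)) *\<^sub>R X0 p)) (at p)"
      unfolding Xeq using has_derivative_scaleR[OF s hd[OF X01]] by (simp add: \<rho>p)
  qed
  have ddb: "dd b h p = dd b0 h p + 2 * (K * (grad \<rho> p \<bullet> h)) * \<beta>" for h
  proof (rule dd_eq)
    have "((\<lambda>y. (1 + K * \<rho> y)\<^sup>2) has_derivative (\<lambda>h. 2 * (K * (grad \<rho> p \<bullet> h)))) (at p)"
    proof -
      have "(\<lambda>h. (1 + K * \<rho> p) * (K * (grad \<rho> p \<bullet> h)) + K * (grad \<rho> p \<bullet> h) * (1 + K * \<rho> p))
          = (\<lambda>h. 2 * (K * (grad \<rho> p \<bullet> h)))"
        by (rule ext) (simp only: \<rho>p mult_zero_right add_0_right mult_1_left mult_1_right mult_2)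
      then show ?thesis using has_derivative_mult[OF s s] unfolding power2_eq_square by (simp only:)
    qed
    from has_derivative_mult[OF this hd[OF b01]]
    show "(b has_derivative (\<lambda>h. dd b0 h p + 2 * (K * (grad \<rho> p \<bullet> h)) * \<beta>)) (at p)"
      unfolding beq by (simp add: \<rho>p \<beta>_def)
  qed
  define \<mu> where "\<mu> = \<kappa> + divergence X p"
  define F where "F = (\<lambda>(x, u). 2 * (dd X (A x *v u) x \<bullet> u) - u \<bullet> (dd A (X x) x *v u)
        + (\<mu> - divergence X x) * (u \<bullet> (A x *v u)))"
  define H where "H x = dd b (X x) x - (\<mu> - divergence X x) * b x" for x
  have cA: "continuous_on T (\<lambda>y. A (g y))" and cX: "continuous_on T (\<lambda>y. X (g y))"
    and cdivX: "continuous_on T (\<lambda>y. divergence X (g y))" and cb: "continuous_on T (\<lambda>y. b (g y))"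
    if "continuous_on T g" for T :: "'t::topological_space set" and g :: "'t \<Rightarrow> real ^ 'm"
    using C_on_continuous[OF A1] C_on_continuous[OF X1] C_on_continuous[OF b1]
      continuous_on_divergence[of X UNIV] X1 that
    by (auto intro: continuous_on_compose2)
  have cF: "continuous_on UNIV F"
    unfolding F_def case_prod_beta
    by (intro continuous_intros cdd[OF X1] cmv cdd[OF A1] cA cX cdivX)
  have cH: "continuous_on UNIV H"
    unfolding H_def by (intro continuous_intros cdd[OF b1] cX cdivX cb)
  have Fp: "1 \<le> F (p, u)" if "norm u = 1" for u
  proof -
    have uu: "u \<bullet> u = 1" using that by (simp add: norm_eq_1)
    have "F (p, u) = 2 * (dd X0 (A p *v u) p \<bullet> u) - u \<bullet> (dd A (X0 p) p *v u)
        + 2 * K * (grad \<rho> p \<bullet> (A p *v u)) * (X0 p \<bullet> u) + \<kappa> * (u \<bullet> (A p *v u))"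
      by (simp add: F_def ddX Xp \<mu>_def algebra_simps)
    also have "grad \<rho> p \<bullet> (A p *v u) = X0 p \<bullet> u"
      using symmetric_matrix_inner[OF sym] by (simp add: X0_def)
    finally have eq: "F (p, u) = 2 * (dd X0 (A p *v u) p \<bullet> u) - u \<bullet> (dd A (X0 p) p *v u)
        + 2 * K * (X0 p \<bullet> u)\<^sup>2 + \<kappa> * (u \<bullet> (A p *v u))"
      by (simp add: power2_eq_square)
    have "\<kappa> * l \<le> \<kappa> * (u \<bullet> (A p *v u))"
      using l(2)[of u] l(1) uu by (intro mult_left_mono) (auto simp: \<kappa>_def)
    moreover have "\<kappa> * l = \<bar>C\<bar> + 1" using l(1) by (simp add: \<kappa>_def)
    moreover have "0 \<le> 2 * K * (X0 p \<bullet> u)\<^sup>2" using K by simp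
    moreover have "\<bar>2 * (dd X0 (A p *v u) p \<bullet> u) - u \<bullet> (dd A (X0 p) p *v u)\<bar> \<le> \<bar>C\<bar>"
      using C[of u] uu by simp
    ultimately show ?thesis unfolding eq by linarith
  qed
  have Hp: "1 \<le> H p"
  proof -
    have "H p = dd b0 (X0 p) p + 2 * K * \<beta>\<^sup>2 - \<kappa> * \<beta>"
      by (simp add: H_def Xp ddb bp \<mu>_def power2_eq_square) (simp add: \<beta>_def b0_def)
    then show ?thesis using K2 by linarith
  qed
  have "uniformly_continuous_on (cball p 1 \<times> sphere 0 1) F"
    by (intro compact_uniformly_continuous compact_Times continuous_on_subset[OF cF]) auto
  then obtain d1 where d1: "d1 > 0" "\<And>y y'. y \<in> cball p 1 \<times> sphere 0 1 \<Longrightarrow>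
      y' \<in> cball p 1 \<times> sphere 0 1 \<Longrightarrow> dist y' y < d1 \<Longrightarrow> dist (F y') (F y) < 1 / 2"
    by (rule uniformly_continuous_onE[where \<epsilon> = "1 / 2"]) auto
  obtain d2 where d2: "d2 > 0" "\<And>x. dist x p < d2 \<Longrightarrow> dist (H x) (H p) < 1 / 2"
    using cH unfolding continuous_on_iff by (metis UNIV_I half_gt_zero zero_less_one)
  define d where "d = min 1 (min d1 d2) / 2"
  have d: "0 < d" "d \<le> 1" "d < d1" "d < d2" using d1(1) d2(1) by (auto simp: d_def)
  have F1: "1 / 2 \<le> F (x, u)" if "x \<in> cball p d" "norm u = 1" for x u
  proof -
    have "dist (F (x, u)) (F (p, u)) < 1 / 2"
      using that d by (intro d1) (auto simp: dist_Pair_Pair dist_commute)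
    then show ?thesis using Fp[OF that(2)] by (simp add: dist_real_def abs_if split: if_splits)
  qed
  have F2: "F (x, s *\<^sub>R u) = s\<^sup>2 * F (x, u)" for x s u
    by (simp add: F_def matrix_vector_mult_scaleR scale[OF X1] power2_eq_square algebra_simps)
  have QF: "1 / 2 * (u \<bullet> u) \<le> F (x, u)" if "x \<in> cball p d" for x u
    by (rule quadratic_form_lower_bound[of "1/2" "\<lambda>u. F (x, u)"]) (use F1[OF that] F2 in auto)
  have QH: "1 / 2 \<le> H x" if "x \<in> cball p d" for x
    using d2(2)[of x] Hp that d by (simp add: dist_real_def dist_commute abs_if split: if_splits)
  have "compact ((\<lambda>x. (\<mu> - divergence X x, grad \<psi> x)) ` cball p d)"
    using C_on_continuous[OF grad1[OF \<psi>2]]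
    by (intro compact_continuous_image continuous_intros cdivX) (auto intro: continuous_on_subset)
  then have "bounded ((\<lambda>x. (\<mu> - divergence X x, grad \<psi> x)) ` cball p d)" by (rule compact_imp_bounded)
  then obtain M where M: "\<forall>y\<in>(\<lambda>x. (\<mu> - divergence X x, grad \<psi> x)) ` cball p d. norm y \<le> M"
    unfolding bounded_iff by (elim exE)
  have M1: "norm (\<mu> - divergence X x) \<le> M" "norm (grad \<psi> x) \<le> M" if "x \<in> cball p d" for x
  proof -
    have "norm (\<mu> - divergence X x, grad \<psi> x) \<le> M" using M that by blast
    then show "norm (\<mu> - divergence X x) \<le> M" "norm (grad \<psi> x) \<le> M"
      using norm_fst_le[of "\<mu> - divergence X x" "grad \<psi> x"] norm_snd_le[of "grad \<psi> x" "\<mu> - divergence X x"]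
      by auto
  qed
  have "carleman_weight_on (cball p d) A \<psi> \<mu> (1 / 2) M"
    unfolding carleman_weight_on_def
  proof (intro allI impI ballI)
    fix X' b' x assume "X' = (\<lambda>y. A y *v grad \<psi> y)" "b' = (\<lambda>y. grad \<psi> y \<bullet> X' y)" and x: "x \<in> cball p d"
    then have eq: "X' = X" "b' = b" by (simp_all add: X_def b_def)
    show "(\<forall>u. 1 / 2 * (u \<bullet> u) \<le> 2 * (dd X' (A x *v u) x \<bullet> u) - u \<bullet> (dd A (X' x) x *v u)
        + (\<mu> - divergence X' x) * (u \<bullet> (A x *v u)))
      \<and> 1 / 2 \<le> dd b' (X' x) x - (\<mu> - divergence X' x) * b' x
      \<and> \<bar>\<mu> - divergence X' x\<bar> \<le> M \<and> norm (grad \<psi> x) \<le> M"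
      unfolding eq using QF[OF x, unfolded F_def prod.case] QH[OF x, unfolded H_def]
        M1[OF x, unfolded real_norm_def] by blast
  qed
  then show ?thesis using K d(1) unfolding \<psi>_def by (intro that)
qed

lemma has_derivative_positive_part_power:
  "((\<lambda>s::real. (max 0 s) ^ (n + 2)) has_derivative (\<lambda>h. h * (real (n + 2) * (max 0 s) ^ (n + 1)))) (at s)"
proof -
  consider "s < 0" | "s = 0" | "s > 0" by linarith
  then show ?thesis
  proof cases
    case 1
    have "((\<lambda>s::real. 0) has_derivative (\<lambda>h. 0)) (at s)" by simp
    then have "((\<lambda>s::real. (max 0 s) ^ (n + 2)) has_derivative (\<lambda>h. 0)) (at s)"
      by (rule has_derivative_transform_within_open[of _ _ _ _ "{..<0}"]) (use 1 in auto)
    then show ?thesis using 1 by simp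
  next
    case 3
    have "((\<lambda>s::real. s ^ (n + 2)) has_derivative (\<lambda>h. h * (real (n + 2) * s ^ (n + 1)))) (at s)"
      by (rule derivative_eq_intros refl | simp add: fun_eq_iff)+
    then have "((\<lambda>s::real. (max 0 s) ^ (n + 2)) has_derivative (\<lambda>h. h * (real (n + 2) * s ^ (n + 1)))) (at s)"
      by (rule has_derivative_transform_within_open[of _ _ _ _ "{0<..}"]) (use 3 in auto)
    then show ?thesis using 3 by simp
  next
    case 2
    have "((\<lambda>s::real. (max 0 s) ^ (n + 2)) has_derivative (\<lambda>h. 0)) (at 0)"
    proof (rule has_derivativeI_sandwich[where e = 1 and H = "\<lambda>y. \<bar>y\<bar>"])
      show "((\<lambda>y::real. \<bar>y\<bar>) \<longlongrightarrow> 0) (at 0)" by (rule tendsto_eq_intros refl | simp)+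
      fix y :: real assume y: "y \<noteq> 0" "dist y 0 < 1"
      have "(max 0 y) ^ (n + 2) \<le> \<bar>y\<bar> ^ (n + 2)" by (intro power_mono) auto
      also have "\<dots> \<le> \<bar>y\<bar> ^ 2" using y by (intro power_decreasing) auto
      finally show "norm ((max 0 y) ^ (n + 2) - (max 0 0) ^ (n + 2) - 0) / norm (y - 0) \<le> \<bar>y\<bar>"
        using y by (simp add: field_simps power2_eq_square)
    qed auto
    then show ?thesis using 2 by simp
  qed
qed

lemma C_on_positive_part_power: "C_on (Suc n) (\<lambda>s::real. (max 0 s) ^ (n + 2)) UNIV"
proof (induction n)
  case 0
  show ?case
  proof (rule C_on_Suc_derivI[OF open_UNIV has_derivative_positive_part_power])
    show "C_on 0 (\<lambda>x::real. v * (real (0 + 2) * max 0 x ^ (0 + 1))) UNIV" for v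
      by (auto intro!: continuous_intros)
  qed
next
  case (Suc n)
  show ?case
  proof (rule C_on_Suc_derivI[OF open_UNIV has_derivative_positive_part_power])
    show "C_on (Suc n) (\<lambda>x::real. v * (real (Suc n + 2) * max 0 x ^ (Suc n + 1))) UNIV" for v
      using Suc by (intro C_on_mult C_on_const open_UNIV) simp
  qed
qed

text \<open>The cut-off is \<open>\<theta> (1 - \<theta> (f x))\<close>, where \<open>\<theta> s = (max 0 s)\<^sup>3\<close> is twice continuously differentiable
  and \<open>f\<close> is at most 0 on the inner ball and at least 1 off the outer one.\<close>

lemma cut_off_function:
  fixes p :: "'a::euclidean_space"
  assumes "0 < r"
  obtains \<eta> :: "'a \<Rightarrow> real" where "C_on 2 \<eta> UNIV" "\<And>x. x \<in> cball p r \<Longrightarrow> \<eta> x = 1"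
    "\<And>x. x \<notin> cball p (2 * r) \<Longrightarrow> \<eta> x = 0"
proof -
  define \<theta> where "\<theta> s = (max 0 s) ^ 3" for s :: real
  have \<theta>: "C_on 2 \<theta> UNIV"
    using C_on_positive_part_power[of 1] by (simp add: \<theta>_def[abs_def] numeral_3_eq_3 numeral_2_eq_2)
  define f where "f x = ((x - p) \<bullet> (x - p) - r\<^sup>2) / r\<^sup>2" for x
  have f: "C_on 2 f UNIV" unfolding f_def divide_inverse
    by (intro C_on_mult C_on_diff C_on_inner C_on_const C_on_ident open_UNIV)
  define \<eta> where "\<eta> x = \<theta> (1 - \<theta> (f x))" for x
  have "C_on 2 (\<lambda>x. 1 - \<theta> (f x)) UNIV"
    by (intro C_on_diff C_on_const open_UNIV C_on_compose_real[OF _ _ _ f \<theta>]) auto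
  then have "C_on 2 \<eta> UNIV" unfolding \<eta>_def
    by (rule C_on_compose_real[OF open_UNIV open_UNIV _ _ \<theta>, rotated]) auto
  moreover have "\<eta> x = 1" if "x \<in> cball p r" for x
  proof -
    have "(norm (x - p))\<^sup>2 \<le> r\<^sup>2" using that by (intro power_mono) (auto simp: dist_norm norm_minus_commute)
    then have "f x \<le> 0" using assms by (simp add: f_def power2_norm_eq_inner divide_le_0_iff)
    then show ?thesis by (simp add: \<eta>_def \<theta>_def)
  qed
  moreover have "\<eta> x = 0" if "x \<notin> cball p (2 * r)" for x
  proof -
    have "(2 * r)\<^sup>2 \<le> (norm (x - p))\<^sup>2"
      using that assms by (intro power_mono) (auto simp: dist_norm norm_minus_commute)
    then have "4 * r\<^sup>2 \<le> (x - p) \<bullet> (x - p)" by (simp add: power_mult_distrib power2_norm_eq_inner)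
    then have "2 * r\<^sup>2 \<le> (x - p) \<bullet> (x - p)" using zero_le_power2[of r] by linarith
    then have "1 \<le> f x" using assms by (simp add: f_def field_simps)
    then have "1 \<le> \<theta> (f x)" by (simp add: \<theta>_def)
    then show ?thesis by (simp add: \<eta>_def \<theta>_def)
  qed
  ultimately show ?thesis by (rule that)
qed

lemma C_on_extend_by_zero:
  fixes f :: "'a::euclidean_space \<Rightarrow> 'b::real_normed_vector"
  assumes "open S" "cball p r \<subseteq> S" "C_on n \<eta> UNIV" "\<And>x. x \<notin> cball p r \<Longrightarrow> \<eta> x = (0::real)"
    "C_on n f S"
  shows "C_on n (\<lambda>x. \<eta> x *\<^sub>R f x) UNIV"
proof -
  have "C_on n (\<lambda>x. \<eta> x *\<^sub>R f x) S"
    using assms by (intro C_on_scaleR C_on_subset[OF assms(3)]) auto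
  moreover have "C_on n (\<lambda>x. \<eta> x *\<^sub>R f x) (- cball p r)"
    by (rule C_on_cong[OF _ _ C_on_const[of n 0]]) (use assms in auto)
  ultimately have "C_on n (\<lambda>x. \<eta> x *\<^sub>R f x) (S \<union> - cball p r)"
    using assms(1) by (intro C_on_Un) auto
  moreover have "S \<union> - cball p r = UNIV" using assms(2) by auto
  ultimately show ?thesis by simp
qed

section \<open>Unique continuation\<close>

lemma grad_cong_open:
  assumes "open S" "x \<in> S" "\<And>y. y \<in> S \<Longrightarrow> f y = g y"
  shows "grad f x = grad g x"
  unfolding grad_def by (simp only: frechet_derivative_cong_open[OF assms])

lemma divergence_cong_open:
  assumes "open S" "x \<in> S" "\<And>y. y \<in> S \<Longrightarrow> f y = g y"
  shows "divergence f x = divergence g x"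
  unfolding divergence_def by (simp only: frechet_derivative_cong_open[OF assms])

lemma nonpos_if_le_exp_decay:
  fixes J H a :: real
  assumes "0 < a" "\<And>t. t0 \<le> t \<Longrightarrow> J \<le> H * exp (- t * a)"
  shows "J \<le> 0"
proof (rule ccontr)
  assume "\<not> J \<le> 0"
  then have J: "0 < J" by simp
  define t where "t = max (max t0 0) ((\<bar>H\<bar> + 1) / (J * a))"
  have t: "t0 \<le> t" "(\<bar>H\<bar> + 1) / (J * a) \<le> t" "0 \<le> t" by (auto simp: t_def)
  have "\<bar>H\<bar> + 1 \<le> J * (t * a)" using t(2) J assms(1) by (simp add: field_simps)
  also have "\<dots> \<le> J * exp (t * a)"
    using J exp_ge_add_one_self[of "t * a"] by (intro mult_left_mono) linarith+
  also have "\<dots> \<le> H * exp (- t * a) * exp (t * a)"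
    using assms(2)[OF t(1)] by (intro mult_right_mono) auto
  also have "\<dots> = H" by (simp add: exp_minus)
  finally show False by linarith
qed

lemma zero_on_ball_if_integral_nonpos:
  fixes f :: "'a::euclidean_space \<Rightarrow> real"
  assumes "integrable lborel f" "continuous_on UNIV f" "\<And>x. 0 \<le> f x"
    and "(\<integral>x. indicator (ball p d) x * f x \<partial>lborel) \<le> 0" and "x \<in> ball p d"
  shows "f x = 0"
proof (rule ccontr)
  assume fx: "f x \<noteq> 0"
  define U where "U = ball p d \<inter> {y. f y \<noteq> 0}"
  have int: "integrable lborel (\<lambda>x. indicator (ball p d) x * f x)"
    using integrable_mult_indicator[OF _ assms(1), of "ball p d"] by simp
  have "0 \<le> (\<integral>x. indicator (ball p d) x * f x \<partial>lborel)"
    using assms(3) by (intro integral_nonneg_AE) auto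
  then have "(\<integral>x. indicator (ball p d) x * f x \<partial>lborel) = 0" using assms(4) by simp
  then have "AE x in lborel. indicator (ball p d) x * f x = 0"
    using integral_nonneg_eq_0_iff_AE[OF int] assms(3) by simp
  then have "AE x in lborel. x \<notin> U" by (auto simp: U_def elim!: eventually_mono)
  have oU: "open U" unfolding U_def
    using assms(2) by (intro open_Int open_ball open_Collect_neq continuous_on_const) auto
  then have "U \<in> sets lborel" by simp
  then have "U \<in> null_sets lborel"
    using AE_iff_null_sets \<open>AE x in lborel. x \<notin> U\<close> by blast
  then have "negligible U"
    using negligible_iff_null_sets null_sets_completionI by blast
  moreover have "U \<noteq> {}" using fx assms(5) by (auto simp: U_def)
  ultimately show False using open_not_negligible[OF oU] by blast
qed

lemma sum_abs_norm_squared_le: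
  fixes a :: "'i \<Rightarrow> real" and b :: "'i \<Rightarrow> 'b::real_normed_vector"
  assumes "finite I"
  shows "(\<Sum>i\<in>I. \<bar>a i\<bar> + norm (b i))\<^sup>2 \<le> 2 * card I * (\<Sum>i\<in>I. (a i)\<^sup>2 + (norm (b i))\<^sup>2)"
proof -
  have "(\<bar>a i\<bar> + norm (b i))\<^sup>2 \<le> 2 * ((a i)\<^sup>2 + (norm (b i))\<^sup>2)" for i
    using zero_le_power2[of "\<bar>a i\<bar> - norm (b i)"] by (simp add: power2_sum power2_diff)
  then have "(\<Sum>i\<in>I. (\<bar>a i\<bar> + norm (b i))\<^sup>2) \<le> 2 * (\<Sum>i\<in>I. (a i)\<^sup>2 + (norm (b i))\<^sup>2)"
    by (simp add: sum_distrib_left sum_mono)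
  then have "(\<Sum>i\<in>I. (\<bar>a i\<bar> + norm (b i))\<^sup>2) * card I
      \<le> 2 * (\<Sum>i\<in>I. (a i)\<^sup>2 + (norm (b i))\<^sup>2) * card I"
    by (rule mult_right_mono) simp
  with sum_squared_le_sum_of_squares[of "\<lambda>i. \<bar>a i\<bar> + norm (b i)" I] show ?thesis
    by (simp add: mult_ac)
qed

text \<open>The Carleman estimate is applied to the cut-off functions \<open>V i = \<zeta> u i\<close>, with \<open>A\<close> also cut off so
  that it is defined everywhere. Near \<open>p\<close> the cut-off has no effect and the bound on the
  divergence is absorbed for large \<open>t\<close>. Where it has an effect and some \<open>u i\<close> can be nonzero,
  \<open>\<psi>\<close> is at most \<open>- s\<^sup>2 / 2\<close>, so that this error is \<open>O (exp (- t s\<^sup>2))\<close>; on a small ball around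
  \<open>p\<close> the square of \<open>exp (t \<psi>)\<close> is at least \<open>exp (- t s\<^sup>2 / 2)\<close>. As \<open>t\<close> grows, the functions must vanish there.\<close>

lemma unique_continuation_across_sphere:
  fixes A :: "real ^ 'm \<Rightarrow> real ^ 'm ^ 'm::finite" and u :: "'i \<Rightarrow> real ^ 'm \<Rightarrow> real"
  assumes B: "open B" "p \<in> B" and A: "C_on 1 A B" and sym: "\<And>x. x \<in> B \<Longrightarrow> transpose (A x) = A x"
    and pos: "\<And>v. v \<noteq> 0 \<Longrightarrow> 0 < v \<bullet> (A p *v v)"
    and I: "finite I" and u: "\<And>i. i \<in> I \<Longrightarrow> C_on 2 (u i) B"
    and r: "0 < r" "dist p z = r"
    and zero: "\<And>i x. i \<in> I \<Longrightarrow> x \<in> B \<Longrightarrow> x \<in> ball z r \<Longrightarrow> u i x = 0"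
    and C: "\<And>i x. i \<in> I \<Longrightarrow> x \<in> B \<Longrightarrow> \<bar>divergence (\<lambda>y. A y *v grad (u i) y) x\<bar>
      \<le> C * (\<Sum>j\<in>I. \<bar>u j x\<bar> + norm (grad (u j) x))"
  shows "\<exists>\<delta>>0. \<forall>x\<in>ball p \<delta>. \<forall>i\<in>I. u i x = 0"
proof -
  obtain R0 where R0: "0 < R0" "cball p R0 \<subseteq> B"
    using open_contains_cball_eq[OF B(1)] B(2) by auto
  define R where "R = R0 / 2"
  have R: "0 < R" "cball p (2 * R) \<subseteq> B" using R0 by (auto simp: R_def)
  obtain \<eta> :: "real ^ 'm \<Rightarrow> real" where \<eta>: "C_on 2 \<eta> UNIV" "\<And>x. x \<in> cball p R \<Longrightarrow> \<eta> x = 1"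
    "\<And>x. x \<notin> cball p (2 * R) \<Longrightarrow> \<eta> x = 0"
    using cut_off_function[OF R(1)] by blast
  have \<eta>B: "\<eta> x = 0" if "x \<notin> B" for x using \<eta>(3) R(2) that by blast
  define A' where "A' = (\<lambda>x. \<eta> x *\<^sub>R A x)"
  have A': "C_on 1 A' UNIV" unfolding A'_def
    using C_on_le[OF \<eta>(1), of 1] by (intro C_on_extend_by_zero[OF B(1) R(2) _ \<eta>(3) A]) auto
  have sym': "transpose (A' x) = A' x" for x
  proof -
    have "transpose (c *\<^sub>R D) = c *\<^sub>R transpose D" for c and D :: "real ^ 'm ^ 'm"
      by (simp add: transpose_def vec_eq_iff)
    moreover have "transpose (0 :: real ^ 'm ^ 'm) = 0" by (simp add: transpose_def vec_eq_iff)
    ultimately show ?thesis using sym[of x] \<eta>B[of x] by (cases "x \<in> B") (auto simp: A'_def)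
  qed
  have A'A: "A' x = A x" if "x \<in> cball p R" for x using \<eta>(2)[OF that] by (simp add: A'_def)
  have pos': "0 < v \<bullet> (A' p *v v)" if "v \<noteq> 0" for v
    using pos[OF that] A'A[of p] R(1) by simp
  \<comment> \<open>The first two terms define the sphere through \<open>p\<close>; the last one makes \<open>\<rho>\<close> negative at all
    points other than \<open>p\<close> that lie outside the ball.\<close>
  define \<rho> where "\<rho> = (\<lambda>x. r\<^sup>2 - (x - z) \<bullet> (x - z) - (x - p) \<bullet> (x - p))"
  have \<rho>2: "C_on 2 \<rho> UNIV" unfolding \<rho>_def
    by (intro C_on_diff C_on_inner C_on_const C_on_ident open_UNIV)
  have \<rho>p: "\<rho> p = 0" using r by (simp add: \<rho>_def dist_norm power2_norm_eq_inner[symmetric])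
  have "grad \<rho> p = (- 2) *\<^sub>R (p - z)"
    by (rule grad_eqI)
      (auto simp: \<rho>_def algebra_simps inner_commute intro!: derivative_eq_intros)
  then have grad_ne: "grad \<rho> p \<noteq> 0" using r by auto
  obtain K \<mu> d M where K: "0 < K" and d: "0 < d"
    and weight: "carleman_weight_on (cball p d) A' (\<lambda>y. \<rho> y + K / 2 * (\<rho> y)\<^sup>2) \<mu> (1 / 2) M"
    using carleman_weight[OF A' sym' pos' \<rho>2 \<rho>p grad_ne] by blast
  define \<psi> where \<psi>: "\<psi> = (\<lambda>y. \<rho> y + K / 2 * (\<rho> y)\<^sup>2)"
  have \<psi>2: "C_on 2 \<psi> UNIV" unfolding \<psi> power2_eq_square
    by (intro C_on_add C_on_mult C_on_const \<rho>2 open_UNIV)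
  have c\<rho>: "continuous_on UNIV \<rho>" and c\<psi>: "continuous_on UNIV \<psi>"
    using C_on_continuous[OF \<rho>2] C_on_continuous[OF \<psi>2] by auto
  have near: "\<exists>s>0. \<forall>x. dist x p < s \<longrightarrow> dist (f x) (f p) < \<epsilon>"
    if "continuous_on UNIV f" "0 < \<epsilon>" for f :: "real ^ 'm \<Rightarrow> real" and \<epsilon>
    using that unfolding continuous_on_iff by blast
  obtain s0 where s0: "s0 > 0" "\<And>x. dist x p < s0 \<Longrightarrow> \<bar>\<rho> x\<bar> < 1 / K"
    using near[OF c\<rho>, of "1 / K"] K \<rho>p by (auto simp: dist_real_def)
  define s where "s = min R (min d s0) / 4"
  have s: "0 < s" "2 * s < R" "2 * s < d" "2 * s < s0"
    using R(1) d s0(1) by (auto simp: s_def)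
  have sub: "cball p (2 * s) \<subseteq> cball p d" "cball p (2 * s) \<subseteq> cball p R" "cball p (2 * s) \<subseteq> B"
    using s R by (auto simp: subset_iff)
  have \<psi>_away: "\<psi> x \<le> - s\<^sup>2 / 2" if "x \<in> cball p (2 * s)" "s \<le> dist p x" "r \<le> dist z x" for x
  proof -
    have "r\<^sup>2 \<le> (norm (x - z))\<^sup>2" "s\<^sup>2 \<le> (norm (x - p))\<^sup>2"
      using that r(1) s(1) by (auto intro!: power_mono simp: dist_norm norm_minus_commute)
    then have 1: "\<rho> x \<le> - s\<^sup>2" by (simp add: \<rho>_def power2_norm_eq_inner)
    have "dist x p < s0" using that(1) s(4) by (simp add: dist_commute)
    then have "\<bar>\<rho> x\<bar> < 1 / K" by (rule s0)
    \<comment> \<open>On this scale the quadratic term of the weight is at most half of the linear one.\<close>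
    then have "K * \<bar>\<rho> x\<bar> \<le> 1" using K by (simp add: field_simps)
    moreover have \<rho>0: "\<rho> x \<le> 0" using 1 zero_le_power2[of s] by linarith
    ultimately have "1 / 2 \<le> 1 + K / 2 * \<rho> x" by simp
    then have "\<rho> x * (1 + K / 2 * \<rho> x) \<le> \<rho> x * (1 / 2)"
      using \<rho>0 by (rule mult_left_mono_neg)
    then have "\<psi> x \<le> \<rho> x / 2" by (simp add: \<psi> power2_eq_square algebra_simps)
    then show ?thesis using 1 by simp
  qed
  have weight': "carleman_weight_on (cball p (2 * s)) A' \<psi> \<mu> (1 / 2) M"
    using weight sub(1) unfolding carleman_weight_on_def \<psi> by blast
  obtain \<zeta> :: "real ^ 'm \<Rightarrow> real" where \<zeta>: "C_on 2 \<zeta> UNIV" "\<And>x. x \<in> cball p s \<Longrightarrow> \<zeta> x = 1"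
    "\<And>x. x \<notin> cball p (2 * s) \<Longrightarrow> \<zeta> x = 0"
    using cut_off_function[OF s(1)] by blast
  define V where "V i x = \<zeta> x * u i x" for i x
  have V2: "C_on 2 (V i) UNIV" if "i \<in> I" for i
    using C_on_extend_by_zero[OF B(1) sub(3) \<zeta>(1) \<zeta>(3) u[OF that]] by (simp add: V_def[abs_def])
  have V0: "V i x = 0" if "x \<notin> cball p (2 * s)" for i x using \<zeta>(3)[OF that] by (simp add: V_def)
  have Vu: "V i x = u i x" if "x \<in> cball p s" for i x using \<zeta>(2)[OF that] by (simp add: V_def)
  have Vz: "V i x = 0" if "i \<in> I" "x \<in> ball z r" for i x
  proof (cases "x \<in> B")
    case True
    then show ?thesis using zero[OF that(1) True that(2)] by (simp add: V_def)
  next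
    case False
    then show ?thesis using sub(3) by (intro V0) blast
  qed
  define P where "P i = divergence (\<lambda>y. A' y *v grad (V i) y)" for i
  have gV1: "C_on (Suc 0) (grad (V i)) UNIV" if "i \<in> I" for i
    using C_on_grad[OF open_UNIV, of "Suc 0"] V2[OF that] by (simp add: numeral_2_eq_2)
  have cV: "continuous_on UNIV (V i)" and cg: "continuous_on UNIV (grad (V i))"
    and cP: "continuous_on UNIV (P i)" if "i \<in> I" for i
  proof -
    have "C_on 1 (\<lambda>y. A' y *v grad (V i) y) UNIV"
      using A' gV1[OF that] by (intro C_on_matrix_vector_mult) auto
    then show "continuous_on UNIV (P i)" unfolding P_def by (rule continuous_on_divergence)
  qed (use C_on_continuous[OF V2[OF that]] C_on_continuous[OF gV1[OF that]] in auto)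
  have gV0: "grad (V i) x = 0" if "x \<notin> cball p (2 * s)" for i x
    unfolding grad_def using dd_zero_off_support[OF V0 that] by simp
  have P_eq_0: "P i x = 0" if "open S" "x \<in> S" "\<And>y. y \<in> S \<Longrightarrow> V i y = 0" for S i x
  proof -
    have "grad (V i) y = grad (\<lambda>y. 0) y" if "y \<in> S" for y
      using that \<open>open S\<close> \<open>\<And>y. y \<in> S \<Longrightarrow> V i y = 0\<close> by (intro grad_cong_open) auto
    then have "P i x = divergence (\<lambda>y. 0) x"
      unfolding P_def using that(1,2) by (intro divergence_cong_open) (auto simp: grad_def)
    then show ?thesis by (simp add: divergence_def)
  qed
  have P0: "P i x = 0" if "x \<notin> cball p (2 * s)" for i x
    using V0 that by (intro P_eq_0[of "- cball p (2 * s)"]) auto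
  define Ps where "Ps x = (\<Sum>i\<in>I. (P i x)\<^sup>2)" for x
  define Vs where "Vs x = (\<Sum>i\<in>I. (V i x)\<^sup>2)" for x
  define Gs where "Gs x = (\<Sum>i\<in>I. (norm (grad (V i) x))\<^sup>2)" for x
  have nonneg: "0 \<le> Ps x" "0 \<le> Vs x" "0 \<le> Gs x" for x
    by (auto simp: Ps_def Vs_def Gs_def intro!: sum_nonneg)
  have off: "Ps x = 0" "Vs x = 0" "Gs x = 0" if "x \<notin> cball p (2 * s)" for x
    using P0[OF that] V0[OF that] gV0[OF that] by (auto simp: Ps_def Vs_def Gs_def)
  have cont: "continuous_on UNIV Ps" "continuous_on UNIV Vs" "continuous_on UNIV Gs"
    unfolding Ps_def Vs_def Gs_def by (intro continuous_intros cP cV cg; assumption)+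
  have "compact (Ps ` cball p (2 * s))"
    by (intro compact_continuous_image compact_cball continuous_on_subset[OF cont(1)]) auto
  then have "bounded (Ps ` cball p (2 * s))" by (rule compact_imp_bounded)
  then obtain N where N: "\<forall>y\<in>Ps ` cball p (2 * s). norm y \<le> N" unfolding bounded_iff by (elim exE)
  have PsN: "Ps x \<le> N" if "x \<in> cball p (2 * s)" for x
    using bspec[OF N imageI[OF that]] by simp
  have N0: "0 \<le> N" using PsN[of p] nonneg(1)[of p] s(1) by simp
  define C1 where "C1 = card I * (C\<^sup>2 * (2 * card I))"
  have C1: "0 \<le> C1" by (simp add: C1_def)
  have Ps_near: "Ps x \<le> C1 * (Vs x + Gs x)" if x: "x \<in> ball p s" for x
  proof -
    have gVu: "grad (V i) y = grad (u i) y" if "y \<in> ball p s" for i y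
    proof (rule grad_cong_open[OF open_ball that])
      show "V i y = u i y" if "y \<in> ball p s" for y using that by (intro Vu) auto
    qed
    have "(P i x)\<^sup>2 \<le> C\<^sup>2 * (2 * card I) * (Vs x + Gs x)" if i: "i \<in> I" for i
    proof -
      have "P i x = divergence (\<lambda>y. A y *v grad (u i) y) x"
        unfolding P_def
      proof (rule divergence_cong_open[OF open_ball x])
        fix y assume y: "y \<in> ball p s"
        then have "y \<in> cball p R" using s by auto
        then show "A' y *v grad (V i) y = A y *v grad (u i) y" using A'A gVu[OF y] by simp
      qed
      moreover have "x \<in> B" using x s(1) sub(3) by auto
      ultimately have "\<bar>P i x\<bar> \<le> C * (\<Sum>j\<in>I. \<bar>u j x\<bar> + norm (grad (u j) x))"
        using C[OF i] by simp
      also have "\<dots> = C * (\<Sum>j\<in>I. \<bar>V j x\<bar> + norm (grad (V j) x))"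
        using gVu[OF x] Vu[of x] x by simp
      finally have "\<bar>P i x\<bar>\<^sup>2 \<le> (C * (\<Sum>j\<in>I. \<bar>V j x\<bar> + norm (grad (V j) x)))\<^sup>2"
        by (rule power_mono) simp
      also have "\<dots> \<le> C\<^sup>2 * (2 * card I * (\<Sum>j\<in>I. (V j x)\<^sup>2 + (norm (grad (V j) x))\<^sup>2))"
        unfolding power_mult_distrib by (intro mult_left_mono sum_abs_norm_squared_le I) auto
      finally show ?thesis by (simp add: Vs_def Gs_def sum.distrib algebra_simps)
    qed
    then have "Ps x \<le> (\<Sum>i\<in>I. C\<^sup>2 * (2 * card I) * (Vs x + Gs x))"
      unfolding Ps_def by (rule sum_mono)
    then show ?thesis by (simp add: C1_def mult_ac)
  qed
  have pointwise: "(exp (t * \<psi> x))\<^sup>2 * Ps x \<le> C1 * ((exp (t * \<psi> x))\<^sup>2 * (Vs x + Gs x))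
      + N * exp (- t * s\<^sup>2) * indicator (cball p (2 * s)) x" if "0 \<le> t" for t x
  proof -
    have rhs: "0 \<le> C1 * ((exp (t * \<psi> x))\<^sup>2 * (Vs x + Gs x))" "0 \<le> N * exp (- t * s\<^sup>2) * indicator (cball p (2 * s)) x"
      using C1 nonneg[of x] N0 by (auto simp: indicator_def)
    consider "x \<notin> cball p (2 * s)" | "x \<in> ball p s" | "x \<in> ball z r"
      | "x \<in> cball p (2 * s)" "s \<le> dist p x" "r \<le> dist z x" by fastforce
    then show ?thesis
    proof cases
      case 1
      then show ?thesis using off(1) rhs by simp
    next
      case 2
      then have "(exp (t * \<psi> x))\<^sup>2 * Ps x \<le> (exp (t * \<psi> x))\<^sup>2 * (C1 * (Vs x + Gs x))"
        by (intro mult_left_mono Ps_near) auto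
      also have "\<dots> = C1 * ((exp (t * \<psi> x))\<^sup>2 * (Vs x + Gs x))" by (rule mult.left_commute)
      finally show ?thesis using rhs(2) by linarith
    next
      case 3
      have "P i x = 0" if "i \<in> I" for i
        using Vz[OF that] 3 by (intro P_eq_0[of "ball z r"]) auto
      then have "Ps x = 0" by (simp add: Ps_def)
      then show ?thesis using rhs by simp
    next
      case 4
      have "(exp (t * \<psi> x))\<^sup>2 = exp (2 * (t * \<psi> x))" by (simp add: exp_double)
      also have "\<dots> \<le> exp (- t * s\<^sup>2)"
        using mult_left_mono[OF \<psi>_away[OF 4] that] by simp
      finally have "(exp (t * \<psi> x))\<^sup>2 * Ps x \<le> exp (- t * s\<^sup>2) * N"
        using PsN[OF 4(1)] nonneg(1)[of x] by (intro mult_mono) auto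
      then show ?thesis using rhs(1) 4(1) by (simp add: mult_ac)
    qed
  qed
  define L where "L = (2 + 2 * M\<^sup>2) / (1 / 2)"
  have L0: "0 \<le> L" by (simp add: L_def)
  define vol where "vol = measure lborel (cball p (2 * s))"
  \<comment> \<open>The first two bounds are those of the Carleman estimate, the third one absorbs the lower
    order terms of the system.\<close>
  define t0 where "t0 = Max {1, M\<^sup>2 / (1 / 2), L * C1 + 1}"
  have t0: "1 \<le> t" "M\<^sup>2 / (1 / 2) \<le> t" "L * C1 + 1 \<le> t" if "t0 \<le> t" for t
    using that by (auto simp: t0_def)
  have decay: "(\<integral>x. (exp (t * \<psi> x))\<^sup>2 * Vs x \<partial>lborel) \<le> L * (N * exp (- t * s\<^sup>2) * vol)" if "t0 \<le> t" for t
  proof -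
    define e where "e x = (exp (t * \<psi> x))\<^sup>2" for x
    have e0: "0 \<le> e x" for x by (simp add: e_def)
    have ce: "continuous_on UNIV e" unfolding e_def by (intro continuous_intros c\<psi>)
    have int: "integrable lborel (\<lambda>x. e x * f x)"
      if "continuous_on UNIV f" "\<And>x. x \<notin> cball p (2 * s) \<Longrightarrow> f x = 0" for f
      using that by (intro integrable_compact_support[of _ p "2 * s"] continuous_intros ce) auto
    have iV: "integrable lborel (\<lambda>x. e x * Vs x)" and iG: "integrable lborel (\<lambda>x. e x * Gs x)"
      and iP: "integrable lborel (\<lambda>x. e x * Ps x)"
      using cont off by (auto intro: int)
    have iVi: "integrable lborel (\<lambda>x. e x * (t ^ 3 * (V i x)\<^sup>2 + t * (norm (grad (V i) x))\<^sup>2))"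
      and iPi: "integrable lborel (\<lambda>x. e x * (P i x)\<^sup>2)" if "i \<in> I" for i
      by (rule int; (intro continuous_intros cV cg cP that)?; simp add: V0 gV0 P0)+
    have "t ^ 3 * (\<integral>x. e x * Vs x \<partial>lborel) + t * (\<integral>x. e x * Gs x \<partial>lborel)
        = (\<integral>x. t ^ 3 * (e x * Vs x) + t * (e x * Gs x) \<partial>lborel)"
      using iV iG by simp
    also have "\<dots> = (\<integral>x. (\<Sum>i\<in>I. e x * (t ^ 3 * (V i x)\<^sup>2 + t * (norm (grad (V i) x))\<^sup>2)) \<partial>lborel)"
      by (rule Bochner_Integration.integral_cong)
        (simp_all add: Vs_def Gs_def sum_distrib_left sum.distrib algebra_simps)
    also have "\<dots> = (\<Sum>i\<in>I. \<integral>x. e x * (t ^ 3 * (V i x)\<^sup>2 + t * (norm (grad (V i) x))\<^sup>2) \<partial>lborel)"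
      using iVi by (rule Bochner_Integration.integral_sum)
    also have "\<dots> \<le> (\<Sum>i\<in>I. L * (\<integral>x. e x * (P i x)\<^sup>2 \<partial>lborel))"
    proof (rule sum_mono)
      fix i assume i: "i \<in> I"
      show "(\<integral>x. e x * (t ^ 3 * (V i x)\<^sup>2 + t * (norm (grad (V i) x))\<^sup>2) \<partial>lborel)
          \<le> L * (\<integral>x. e x * (P i x)\<^sup>2 \<partial>lborel)"
        unfolding L_def e_def P_def
        using t0[OF \<open>t0 \<le> t\<close>]
        by (intro carleman_estimate[OF A' sym' \<psi>2 weight' _ _ _ V2[OF i] V0]) auto
    qed
    also have "\<dots> = L * (\<integral>x. e x * Ps x \<partial>lborel)"
      using iPi by (simp add: Ps_def sum_distrib_left Bochner_Integration.integral_sum)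
    also have "(\<integral>x. e x * Ps x \<partial>lborel)
        \<le> (\<integral>x. C1 * (e x * Vs x + e x * Gs x) + N * exp (- t * s\<^sup>2) * indicator (cball p (2 * s)) x \<partial>lborel)"
    proof (rule integral_mono)
      show "integrable lborel (\<lambda>x. C1 * (e x * Vs x + e x * Gs x) + N * exp (- t * s\<^sup>2) * indicator (cball p (2 * s)) x)"
        by (intro Bochner_Integration.integrable_add integrable_mult_right iV iG integrable_real_indicator)
          (use emeasure_bounded_finite[OF bounded_cball] in auto)
      show "e x * Ps x \<le> C1 * (e x * Vs x + e x * Gs x) + N * exp (- t * s\<^sup>2) * indicator (cball p (2 * s)) x" for x
        using pointwise[of t x] t0(1)[OF \<open>t0 \<le> t\<close>] by (simp add: e_def distrib_left)
    qed (rule iP)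
    also have "\<dots> = C1 * ((\<integral>x. e x * Vs x \<partial>lborel) + (\<integral>x. e x * Gs x \<partial>lborel)) + N * exp (- t * s\<^sup>2) * vol"
      using iV iG emeasure_bounded_finite[OF bounded_cball, of p "2 * s"]
      by (simp add: vol_def)
    finally have main: "t ^ 3 * (\<integral>x. e x * Vs x \<partial>lborel) + t * (\<integral>x. e x * Gs x \<partial>lborel)
      \<le> L * (C1 * ((\<integral>x. e x * Vs x \<partial>lborel) + (\<integral>x. e x * Gs x \<partial>lborel)) + N * exp (- t * s\<^sup>2) * vol)"
      using L0 by (simp add: mult_left_mono)
    have EV: "0 \<le> (\<integral>x. e x * Vs x \<partial>lborel)" and EG: "0 \<le> (\<integral>x. e x * Gs x \<partial>lborel)"
      using e0 nonneg by (auto intro!: integral_nonneg_AE)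
    have t: "1 \<le> t" "L * C1 + 1 \<le> t" using t0 that by auto
    have "t \<le> t ^ 3" using t(1) by (simp add: power_increasing[of 1 3 t, simplified])
    then have "(L * C1 + 1) * (\<integral>x. e x * Vs x \<partial>lborel) \<le> t ^ 3 * (\<integral>x. e x * Vs x \<partial>lborel)"
      using t EV by (intro mult_right_mono) auto
    moreover have "(L * C1) * (\<integral>x. e x * Gs x \<partial>lborel) \<le> t * (\<integral>x. e x * Gs x \<partial>lborel)"
      using t EG by (intro mult_right_mono) auto
    ultimately show ?thesis using main by (simp add: e_def algebra_simps)
  qed
  have "\<psi> p = 0" by (simp add: \<psi> \<rho>p)
  then obtain \<delta>0 where \<delta>0: "\<delta>0 > 0" "\<And>x. dist x p < \<delta>0 \<Longrightarrow> \<bar>\<psi> x\<bar> < s\<^sup>2 / 4"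
    using near[OF c\<psi>, of "s\<^sup>2 / 4"] s(1) by (auto simp: dist_real_def)
  define \<delta> where "\<delta> = min \<delta>0 s"
  have iVs: "integrable lborel Vs"
    using cont(2) off(2) by (rule integrable_compact_support)
  define J where "J = (\<integral>x. indicator (ball p \<delta>) x * Vs x \<partial>lborel)"
  have "J \<le> L * N * vol * exp (- t * (s\<^sup>2 / 2))" if t: "t0 \<le> t" for t
  proof -
    have "exp (- t * (s\<^sup>2 / 2)) * J = (\<integral>x. exp (- t * (s\<^sup>2 / 2)) * (indicator (ball p \<delta>) x * Vs x) \<partial>lborel)"
      by (simp add: J_def)
    also have "\<dots> \<le> (\<integral>x. (exp (t * \<psi> x))\<^sup>2 * Vs x \<partial>lborel)"
    proof (rule integral_mono)
      show "integrable lborel (\<lambda>x. exp (- t * (s\<^sup>2 / 2)) * (indicator (ball p \<delta>) x * Vs x))"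
        using integrable_mult_indicator[OF _ iVs, of "ball p \<delta>"] by simp
      show "integrable lborel (\<lambda>x. (exp (t * \<psi> x))\<^sup>2 * Vs x)"
        using off(2) by (intro integrable_compact_support[of _ p "2 * s"] continuous_intros c\<psi> cont) auto
      fix x
      show "exp (- t * (s\<^sup>2 / 2)) * (indicator (ball p \<delta>) x * Vs x) \<le> (exp (t * \<psi> x))\<^sup>2 * Vs x"
      proof (cases "x \<in> ball p \<delta>")
        case True
        then have "- (s\<^sup>2 / 4) \<le> \<psi> x" using \<delta>0(2)[of x] by (simp add: \<delta>_def dist_commute)
        then have "t * - (s\<^sup>2 / 4) \<le> t * \<psi> x" using t0(1)[OF t] by (intro mult_left_mono) auto
        then have "exp (- t * (s\<^sup>2 / 2)) \<le> exp (2 * (t * \<psi> x))" by simp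
        then show ?thesis using True nonneg(2)[of x] by (simp add: exp_double mult_right_mono)
      qed (simp add: nonneg)
    qed
    also have "\<dots> \<le> L * (N * exp (- t * s\<^sup>2) * vol)" by (rule decay[OF t])
    also have "exp (- t * s\<^sup>2) = exp (- t * (s\<^sup>2 / 2)) * exp (- t * (s\<^sup>2 / 2))"
      by (simp flip: exp_add)
    finally have "exp (- t * (s\<^sup>2 / 2)) * J \<le> exp (- t * (s\<^sup>2 / 2)) * (L * N * vol * exp (- t * (s\<^sup>2 / 2)))"
      by (simp add: mult_ac)
    then show ?thesis by (rule mult_left_le_imp_le) simp
  qed
  then have "J \<le> 0" using s(1) by (intro nonpos_if_le_exp_decay[of "s\<^sup>2 / 2"]) auto
  then have Vs0: "Vs x = 0" if "x \<in> ball p \<delta>" for x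
    using zero_on_ball_if_integral_nonpos[OF iVs cont(2) nonneg(2), of p \<delta> x] that by (simp add: J_def)
  have "u i x = 0" if "x \<in> ball p \<delta>" "i \<in> I" for x i
  proof -
    have "V i x = 0"
      using Vs0[OF that(1)] sum_nonneg_eq_0_iff[OF I, of "\<lambda>i. (V i x)\<^sup>2"] that(2) by (simp add: Vs_def)
    then show ?thesis using Vu[of x i] that(1) by (simp add: \<delta>_def)
  qed
  moreover have "0 < \<delta>" using \<delta>0(1) s(1) by (simp add: \<delta>_def)
  ultimately show ?thesis by blast
qed

text \<open>If the interior \<open>Z\<close> of the common zero set were not closed in \<open>B\<close>, then the largest ball in \<open>Z\<close>
  around a point close to the boundary of \<open>Z\<close> would touch this boundary inside \<open>B\<close>, and the
  functions would continue by zero across the sphere at the point of contact.\<close>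

theorem unique_continuation:
  fixes A :: "real ^ 'm \<Rightarrow> real ^ 'm ^ 'm::finite" and u :: "'i \<Rightarrow> real ^ 'm \<Rightarrow> real"
  assumes B: "open B" "connected B" and A: "C_on 1 A B"
    and sym: "\<And>x. x \<in> B \<Longrightarrow> transpose (A x) = A x"
    and pos: "\<And>x v. x \<in> B \<Longrightarrow> v \<noteq> 0 \<Longrightarrow> 0 < v \<bullet> (A x *v v)"
    and I: "finite I" and u: "\<And>i. i \<in> I \<Longrightarrow> C_on 2 (u i) B"
    and ineq: "\<And>x. x \<in> B \<Longrightarrow> \<exists>C e. 0 < e \<and> (\<forall>y\<in>B \<inter> ball x e. \<forall>i\<in>I.
      \<bar>divergence (\<lambda>y. A y *v grad (u i) y) y\<bar> \<le> C * (\<Sum>j\<in>I. \<bar>u j y\<bar> + norm (grad (u j) y)))"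
    and W: "open W" "W \<noteq> {}" "W \<subseteq> B" "\<And>i x. i \<in> I \<Longrightarrow> x \<in> W \<Longrightarrow> u i x = 0"
    and "x \<in> B" "i \<in> I"
  shows "u i x = 0"
proof -
  define Z where "Z = interior {x \<in> B. \<forall>i\<in>I. u i x = 0}"
  have Z: "open Z" "Z \<subseteq> B" "\<And>i x. i \<in> I \<Longrightarrow> x \<in> Z \<Longrightarrow> u i x = 0"
    using interior_subset[of "{x \<in> B. \<forall>i\<in>I. u i x = 0}"] by (auto simp: Z_def)
  have "W \<subseteq> Z" unfolding Z_def using W by (intro interior_maximal) auto
  then have Zne: "Z \<noteq> {}" using W(2) by blast
  have "b \<in> Z" if b: "b \<in> B" "b \<in> closure Z" for b
  proof (rule ccontr)
    assume bZ: "b \<notin> Z"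
    obtain R where R: "0 < R" "ball b R \<subseteq> B" using B(1) b(1) openE by blast
    obtain z where z: "z \<in> Z" "dist z b < R / 2"
      using b(2) R(1) closure_approachable[of b Z] half_gt_zero by blast
    have "closed (- Z)" "- Z \<noteq> {}" using Z(1) bZ by auto
    then obtain p where p: "p \<in> - Z" "infdist z (- Z) = dist z p"
      using infdist_attains_inf[of "- Z" z] by blast
    define r where "r = dist z p"
    have "dist z p \<le> dist z b" using infdist_le[of b "- Z" z] bZ p(2) by simp
    then have "dist b p < R" using z(2) dist_triangle[of b p z] by (simp add: dist_commute)
    then have pB: "p \<in> B" using R(2) by auto
    have r: "0 < r" "dist p z = r" using p(1) z(1) by (auto simp: r_def dist_commute)
    have ballZ: "y \<in> Z" if "y \<in> ball z r" for y
    proof (rule ccontr)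
      assume "y \<notin> Z"
      then have "dist z p \<le> dist z y" using infdist_le[of y "- Z" z] p(2) by simp
      then show False using that by (simp add: r_def)
    qed
    obtain C e where C: "0 < e" "\<forall>y\<in>B \<inter> ball p e. \<forall>i\<in>I.
        \<bar>divergence (\<lambda>y. A y *v grad (u i) y) y\<bar> \<le> C * (\<Sum>j\<in>I. \<bar>u j y\<bar> + norm (grad (u j) y))"
      using ineq[OF pB] by auto
    have "\<exists>\<delta>>0. \<forall>x\<in>ball p \<delta>. \<forall>i\<in>I. u i x = 0"
    proof (rule unique_continuation_across_sphere[OF _ _ _ _ _ I _ r])
      show "open (B \<inter> ball p e)" "p \<in> B \<inter> ball p e" using B(1) pB C(1) by auto
      show "C_on 1 A (B \<inter> ball p e)" "\<And>i. i \<in> I \<Longrightarrow> C_on 2 (u i) (B \<inter> ball p e)"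
        using A u by (auto intro: C_on_subset)
    qed (use sym pos[OF pB] Z(3) ballZ C(2) in auto)
    then obtain \<delta> where \<delta>: "\<delta> > 0" "\<forall>x\<in>ball p \<delta>. \<forall>i\<in>I. u i x = 0" by blast
    have "B \<inter> ball p \<delta> \<subseteq> Z" unfolding Z_def
      using \<delta>(2) B(1) by (intro interior_maximal) auto
    then show False using p(1) pB \<delta>(1) by auto
  qed
  then have "Z = B \<inter> closure Z" using Z(2) closure_subset by blast
  then have "closedin (top_of_set B) Z" by (metis closed_closure closedin_closed)
  moreover have "openin (top_of_set B) Z" using Z(1,2) by (simp add: open_openin_trans openin_open_eq B(1))
  ultimately have "Z = B" using B(2) Zne unfolding connected_clopen by blast
  then show ?thesis using Z(3) assms(13,14) by blast
qed

section \<open>Functions controlled by a family and its gradients\<close>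

definition jet_size :: "('a::euclidean_space \<Rightarrow> real) set \<Rightarrow> 'a \<Rightarrow> real" where
  "jet_size us x = (\<Sum>u\<in>us. \<bar>u x\<bar> + norm (grad u x))"

lemma jet_size_nonneg: "0 \<le> jet_size us x"
  unfolding jet_size_def by (intro sum_nonneg) auto

text \<open>Lower order terms enter unique continuation only through bounds of this kind, which are stable
  under sums and under products with continuous functions; so their coefficients never have to be
  written out.\<close>

definition dominated ::
    "'a::euclidean_space set \<Rightarrow> ('a \<Rightarrow> real) set \<Rightarrow> ('a \<Rightarrow> real) \<Rightarrow> bool" where
  "dominated S us F \<longleftrightarrow> (\<forall>x\<in>S. \<exists>C e. 0 < e \<and>
     (\<forall>y\<in>S \<inter> ball x e. \<bar>F y\<bar> \<le> C * jet_size us y))"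

lemma dominatedE:
  assumes "dominated S us F" "x \<in> S"
  obtains C e where "0 < e" "0 \<le> C"
    "\<And>y. y \<in> S \<Longrightarrow> y \<in> ball x e \<Longrightarrow> \<bar>F y\<bar> \<le> C * jet_size us y"
proof -
  obtain C e where C: "0 < e"
    "\<forall>y\<in>S \<inter> ball x e. \<bar>F y\<bar> \<le> C * jet_size us y"
    using assms unfolding dominated_def by auto
  have "\<bar>F y\<bar> \<le> \<bar>C\<bar> * jet_size us y" if "y \<in> S" "y \<in> ball x e" for y
  proof -
    have "C * jet_size us y \<le> \<bar>C\<bar> * jet_size us y"
      by (intro mult_right_mono jet_size_nonneg) auto
    moreover have "\<bar>F y\<bar> \<le> C * jet_size us y" using C(2) that by blast
    ultimately show ?thesis by linarith
  qed
  then show ?thesis using C(1) by (intro that[of e "\<bar>C\<bar>"]) auto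
qed

lemma dominated_cong:
  assumes "dominated S us F" "\<And>x. x \<in> S \<Longrightarrow> F x = H x"
  shows "dominated S us H"
  unfolding dominated_def
proof
  fix x assume "x \<in> S"
  then obtain C e where C: "0 < e" "\<And>y. y \<in> S \<Longrightarrow> y \<in> ball x e \<Longrightarrow>
      \<bar>F y\<bar> \<le> C * jet_size us y"
    using dominatedE[OF assms(1)] by metis
  show "\<exists>C e. 0 < e \<and> (\<forall>y\<in>S \<inter> ball x e. \<bar>H y\<bar> \<le> C * jet_size us y)"
  proof (intro exI conjI ballI)
    show "\<bar>H y\<bar> \<le> C * jet_size us y" if "y \<in> S \<inter> ball x e" for y
      using C(2)[of y] assms(2)[of y] that by simp
  qed (rule C(1))
qed

lemma dominated_mono:
  assumes "dominated S us F" "us \<subseteq> vs" "finite vs"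
  shows "dominated S vs F"
  unfolding dominated_def
proof
  fix x assume "x \<in> S"
  then obtain C e where C: "0 < e" "0 \<le> C" "\<And>y. y \<in> S \<Longrightarrow> y \<in> ball x e \<Longrightarrow>
      \<bar>F y\<bar> \<le> C * jet_size us y"
    using dominatedE[OF assms(1)] by metis
  show "\<exists>C e. 0 < e \<and> (\<forall>y\<in>S \<inter> ball x e. \<bar>F y\<bar> \<le> C * jet_size vs y)"
  proof (intro exI conjI ballI)
    fix y assume y: "y \<in> S \<inter> ball x e"
    have "jet_size us y \<le> jet_size vs y"
      unfolding jet_size_def using assms by (intro sum_mono2) auto
    then show "\<bar>F y\<bar> \<le> C * jet_size vs y"
      using C(3)[of y] y mult_left_mono[OF _ C(2), of "jet_size us y" "jet_size vs y"] by auto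
  qed (rule C(1))
qed

lemma dominated_zero: "dominated S us (\<lambda>x. 0)"
  unfolding dominated_def by (rule ballI, rule exI[of _ 0], rule exI[of _ 1]) simp

lemma dominated_add:
  assumes "dominated S us F" "dominated S us H"
  shows "dominated S us (\<lambda>x. F x + H x)"
  unfolding dominated_def
proof
  fix x assume x: "x \<in> S"
  obtain C e where C: "0 < e" "\<And>y. y \<in> S \<Longrightarrow> y \<in> ball x e \<Longrightarrow>
      \<bar>F y\<bar> \<le> C * jet_size us y"
    using dominatedE[OF assms(1) x] by metis
  obtain D d where D: "0 < d" "\<And>y. y \<in> S \<Longrightarrow> y \<in> ball x d \<Longrightarrow>
      \<bar>H y\<bar> \<le> D * jet_size us y"
    using dominatedE[OF assms(2) x] by metis
  show "\<exists>C e. 0 < e \<and> (\<forall>y\<in>S \<inter> ball x e. \<bar>F y + H y\<bar> \<le> C * jet_size us y)"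
  proof (intro exI conjI ballI)
    show "0 < min e d" using C(1) D(1) by simp
    fix y assume "y \<in> S \<inter> ball x (min e d)"
    then show "\<bar>F y + H y\<bar> \<le> (C + D) * jet_size us y"
      using C(2)[of y] D(2)[of y] by (simp add: distrib_right)
  qed
qed

lemma dominated_sum:
  "(\<And>i. i \<in> I \<Longrightarrow> dominated S us (F i)) \<Longrightarrow> dominated S us (\<lambda>x. \<Sum>i\<in>I. F i x)"
  by (induction I rule: infinite_finite_induct) (auto intro: dominated_add dominated_zero)

lemma dominated_mult:
  assumes "open S" "continuous_on S c" "dominated S us F"
  shows "dominated S us (\<lambda>x. c x * F x)"
  unfolding dominated_def
proof
  fix x assume x: "x \<in> S"
  obtain C e where C: "0 < e" "0 \<le> C" "\<And>y. y \<in> S \<Longrightarrow> y \<in> ball x e \<Longrightarrow>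
      \<bar>F y\<bar> \<le> C * jet_size us y"
    using dominatedE[OF assms(3) x] by metis
  obtain d where d: "0 < d" "\<And>y. y \<in> S \<Longrightarrow> dist y x < d \<Longrightarrow> dist (c y) (c x) < 1"
    using assms(2) x unfolding continuous_on_iff by (metis zero_less_one)
  show "\<exists>C e. 0 < e \<and> (\<forall>y\<in>S \<inter> ball x e. \<bar>c y * F y\<bar> \<le> C * jet_size us y)"
  proof (intro exI conjI ballI)
    show "0 < min e d" using C(1) d(1) by simp
    fix y assume y: "y \<in> S \<inter> ball x (min e d)"
    then have "dist (c y) (c x) < 1" using d(2)[of y] by (simp add: dist_commute)
    then have "\<bar>c y\<bar> \<le> \<bar>c x\<bar> + 1" unfolding dist_real_def by linarith
    moreover have "\<bar>F y\<bar> \<le> C * jet_size us y" using C(3)[of y] y by simp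
    ultimately have "\<bar>c y\<bar> * \<bar>F y\<bar> \<le> (\<bar>c x\<bar> + 1) * (C * jet_size us y)"
      by (intro mult_mono) auto
    then show "\<bar>c y * F y\<bar> \<le> ((\<bar>c x\<bar> + 1) * C) * jet_size us y"
      by (simp add: abs_mult mult.assoc)
  qed
qed

lemma dominated_uminus: "dominated S us F \<Longrightarrow> dominated S us (\<lambda>x. - F x)"
  unfolding dominated_def by simp

lemma dominated_diff:
  "dominated S us F \<Longrightarrow> dominated S us H \<Longrightarrow> dominated S us (\<lambda>x. F x - H x)"
  using dominated_add[of S us F "\<lambda>x. - H x"] dominated_uminus[of S us H] by simp

lemma dominated_member:
  assumes "finite us" "u \<in> us"
  shows "dominated S us u"
  unfolding dominated_def
proof (intro ballI exI[of _ 1] conjI)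
  fix y
  have "\<bar>u y\<bar> \<le> \<bar>u y\<bar> + norm (grad u y)" by simp
  also have "\<dots> \<le> jet_size us y"
    unfolding jet_size_def using assms by (intro member_le_sum) auto
  finally show "\<bar>u y\<bar> \<le> 1 * jet_size us y" by simp
qed simp

lemma dominated_dd:
  assumes "finite us" "u \<in> us" "C_on (Suc n) u S"
  shows "dominated S us (dd u v)"
  unfolding dominated_def
proof (rule ballI, rule exI[of _ "norm v"], rule exI[of _ 1], intro conjI ballI)
  fix x y assume "y \<in> S \<inter> ball x 1"
  then have "\<bar>dd u v y\<bar> \<le> norm v * norm (grad u y)"
    using dd_eq_grad_inner[OF assms(3)] Cauchy_Schwarz_ineq2[of "grad u y" v] by (simp add: mult.commute)
  also have "\<dots> \<le> norm v * jet_size us y"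
  proof (rule mult_left_mono)
    have "norm (grad u y) \<le> \<bar>u y\<bar> + norm (grad u y)" by simp
    also have "\<dots> \<le> jet_size us y"
      unfolding jet_size_def using assms by (intro member_le_sum) auto
    finally show "norm (grad u y) \<le> jet_size us y" .
  qed simp
  finally show "\<bar>dd u v y\<bar> \<le> norm v * jet_size us y" .
qed simp

lemma dominated_vanishes:
  assumes "dominated S us F" "open W" "W \<subseteq> S" "\<And>u y. u \<in> us \<Longrightarrow> y \<in> W \<Longrightarrow> u y = 0" "x \<in> W"
  shows "F x = 0"
proof -
  obtain C e where C: "0 < e" "\<And>y. y \<in> S \<Longrightarrow> y \<in> ball x e \<Longrightarrow>
      \<bar>F y\<bar> \<le> C * jet_size us y"
    using dominatedE[OF assms(1), of x] assms(3,5) by (metis subsetD)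
  have "grad u x = 0" if "u \<in> us" for u
    using grad_cong_open[OF assms(2,5), of u "\<lambda>_. 0"] assms(4) that by (simp add: grad_def)
  then have "jet_size us x = 0"
    unfolding jet_size_def using assms(4,5) by (intro sum.neutral) simp
  then show ?thesis using C(2)[of x] C(1) assms(3,5) by auto
qed

section \<open>Smooth functions and their derivatives in coordinates\<close>

lemma smooth_onD: "smooth_on f S \<Longrightarrow> C_on n f S"
  by (simp add: smooth_on_def)

lemma smooth_on_continuous: "smooth_on f S \<Longrightarrow> continuous_on S f"
  by (rule C_on_continuous[OF smooth_onD])

lemma smooth_on_dd: "smooth_on f S \<Longrightarrow> smooth_on (dd f v) S"
  unfolding smooth_on_def by (intro allI C_on_dd) simp

lemma smooth_on_cong: "open S \<Longrightarrow> (\<And>x. x \<in> S \<Longrightarrow> f x = g x) \<Longrightarrow> smooth_on f S \<Longrightarrow> smooth_on g S"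
  unfolding smooth_on_def using C_on_cong[of S f g] by blast

lemma smooth_on_const: "smooth_on (\<lambda>x. c) S"
  by (simp add: smooth_on_def C_on_const)

lemma smooth_on_add: "open S \<Longrightarrow> smooth_on f S \<Longrightarrow> smooth_on g S \<Longrightarrow> smooth_on (\<lambda>x. f x + g x) S"
  by (simp add: smooth_on_def C_on_add)

lemma smooth_on_diff: "open S \<Longrightarrow> smooth_on f S \<Longrightarrow> smooth_on g S \<Longrightarrow> smooth_on (\<lambda>x. f x - g x) S"
  by (simp add: smooth_on_def C_on_diff)

lemma smooth_on_uminus: "open S \<Longrightarrow> smooth_on f S \<Longrightarrow> smooth_on (\<lambda>x. - f x) S"
  by (simp add: smooth_on_def C_on_uminus)

lemma smooth_on_scaleR: "open S \<Longrightarrow> smooth_on f S \<Longrightarrow> smooth_on g S \<Longrightarrow> smooth_on (\<lambda>x. f x *\<^sub>R g x) S"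
  by (simp add: smooth_on_def C_on_scaleR)

lemma smooth_on_mult:
  fixes f g :: "'a::euclidean_space \<Rightarrow> real"
  shows "open S \<Longrightarrow> smooth_on f S \<Longrightarrow> smooth_on g S \<Longrightarrow> smooth_on (\<lambda>x. f x * g x) S"
  by (simp add: smooth_on_def C_on_mult)

lemma smooth_on_inner: "open S \<Longrightarrow> smooth_on f S \<Longrightarrow> smooth_on g S \<Longrightarrow> smooth_on (\<lambda>x. f x \<bullet> g x) S"
  by (simp add: smooth_on_def C_on_inner)

lemma smooth_on_sum: "open S \<Longrightarrow> (\<And>i. i \<in> I \<Longrightarrow> smooth_on (f i) S) \<Longrightarrow> smooth_on (\<lambda>x. \<Sum>i\<in>I. f i x) S"
  by (simp add: smooth_on_def C_on_sum)

lemma smooth_on_vec_nth: "open S \<Longrightarrow> smooth_on f S \<Longrightarrow> smooth_on (\<lambda>x. f x $ i) S"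
  by (simp add: smooth_on_def C_on_vec_nth)

lemma smooth_on_vec_lambda:
  fixes f :: "'a::euclidean_space \<Rightarrow> ('b::euclidean_space) ^ 'm::finite"
  shows "open S \<Longrightarrow> (\<And>i. smooth_on (\<lambda>x. f x $ i) S) \<Longrightarrow> smooth_on f S"
  by (simp add: smooth_on_def C_on_vec_lambda)

lemma smooth_on_snd: "open S \<Longrightarrow> smooth_on f S \<Longrightarrow> smooth_on (\<lambda>x. snd (f x)) S"
  by (simp add: smooth_on_def C_on_snd)

lemma smooth_on_has_derivative:
  "smooth_on f S \<Longrightarrow> x \<in> S \<Longrightarrow> (f has_derivative frechet_derivative f (at x)) (at x)"
  by (rule C_on_Suc_has_derivative[OF smooth_onD])

lemma frechet_derivative_coordinates:
  fixes f :: "real ^ 'm::finite \<Rightarrow> 'b::real_normed_vector"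
  assumes "smooth_on f S" "x \<in> S"
  shows "frechet_derivative f (at x) v = (\<Sum>k\<in>UNIV. v $ k *\<^sub>R dd f (axis k 1) x)"
proof -
  have lin: "linear (frechet_derivative f (at x))"
    by (rule has_derivative_linear[OF smooth_on_has_derivative[OF assms]])
  have "v = (\<Sum>k\<in>UNIV. v $ k *\<^sub>R axis k 1)"
    by (simp add: vec_eq_iff axis_def if_distrib cong: if_cong)
  then have "frechet_derivative f (at x) v = frechet_derivative f (at x) (\<Sum>k\<in>UNIV. v $ k *\<^sub>R axis k 1)"
    by simp
  then show ?thesis by (simp only: linear_sum[OF lin] linear_scale[OF lin])
qed

lemma dd_snd:
  assumes "smooth_on f S" "x \<in> S"
  shows "dd (\<lambda>x. snd (f x)) v x = snd (dd f v x)"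
  by (rule dd_eq[OF has_derivative_snd[OF smooth_on_has_derivative[OF assms]]])

section \<open>The equation for the height in a chart\<close>

locale sphere_map_chart =
  fixes \<Omega> :: "(real ^ 'm::finite) set" and G :: "real ^ 'm \<Rightarrow> real ^ 'm ^ 'm"
    and \<Phi> :: "real ^ 'm \<Rightarrow> (real ^ 'n::finite) \<times> real"
  assumes open_domain: "open \<Omega>" and smooth_metric: "smooth_on G \<Omega>"
    and metric_symmetric: "x \<in> \<Omega> \<Longrightarrow> transpose (G x) = G x"
    and metric_positive: "x \<in> \<Omega> \<Longrightarrow> v \<noteq> 0 \<Longrightarrow> 0 < v \<bullet> (G x *v v)"
    and smooth_map: "smooth_on \<Phi> \<Omega>" and unit_length: "x \<in> \<Omega> \<Longrightarrow> norm (\<Phi> x) = 1"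
begin

definition "cometric x = matrix_inv (G x)"

definition "height x = snd (\<Phi> x)"

text \<open>This operator has the second order part of the Laplacian of \<open>G\<close> and differs from it at first order,
  because the density \<open>sqrt (det G)\<close> is left out. Being in divergence form, it is the operator of the
  Carleman estimate.\<close>

definition laplacian :: "(real ^ 'm \<Rightarrow> real) \<Rightarrow> real ^ 'm \<Rightarrow> real" where
  "laplacian h = divergence (\<lambda>y. cometric y *v grad h y)"

lemma metric_inverse:
  assumes "x \<in> \<Omega>"
  shows "G x ** cometric x = mat 1" "cometric x ** G x = mat 1" "det (G x) \<noteq> 0"
proof -
  have "v = 0" if "G x *v v = 0" for v
    using metric_positive[OF assms, of v] that by force
  then have "invertible (G x)"
    using matrix_left_invertible_ker[of "G x"] invertible_left_inverse[of "G x"] by blast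
  then show "det (G x) \<noteq> 0" using invertible_det_nz by blast
  have "\<exists>B. G x ** B = mat 1 \<and> B ** G x = mat 1"
    using \<open>invertible (G x)\<close> unfolding invertible_def .
  from someI_ex[OF this] show "G x ** cometric x = mat 1" "cometric x ** G x = mat 1"
    unfolding cometric_def matrix_inv_def by auto
qed

lemma cometric_symmetric:
  assumes "x \<in> \<Omega>"
  shows "transpose (cometric x) = cometric x"
proof -
  have "transpose (cometric x) ** G x = mat 1"
    using metric_inverse(1)[OF assms] metric_symmetric[OF assms]
    by (metis matrix_transpose_mul transpose_mat)
  then show ?thesis
    using metric_inverse(1)[OF assms] by (metis matrix_mul_assoc matrix_mul_lid matrix_mul_rid)
qed

lemma cometric_positive:
  assumes "x \<in> \<Omega>" "v \<noteq> 0"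
  shows "0 < v \<bullet> (cometric x *v v)"
proof -
  define w where "w = cometric x *v v"
  have v: "v = G x *v w"
    using metric_inverse(1)[OF assms(1)] by (simp add: w_def matrix_vector_mul_assoc)
  then have "w \<noteq> 0" using assms(2) by auto
  then have "0 < w \<bullet> (G x *v w)" by (rule metric_positive[OF assms(1)])
  then have "0 < w \<bullet> v" by (simp add: v[symmetric])
  then show ?thesis by (simp add: w_def inner_commute)
qed

lemma smooth_cometric_nth: "smooth_on (\<lambda>x. cometric x $ i $ j) \<Omega>"
  unfolding smooth_on_def cometric_def
  using C_on_matrix_inv[OF open_domain smooth_onD[OF smooth_metric]] metric_inverse(3) by blast

lemma smooth_cometric: "smooth_on cometric \<Omega>"
  by (intro smooth_on_vec_lambda open_domain smooth_cometric_nth)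

lemma smooth_height: "smooth_on height \<Omega>"
  unfolding height_def[abs_def] by (rule smooth_on_snd[OF open_domain smooth_map])

lemma smooth_christoffel: "smooth_on (\<lambda>x. christoffel G x k i j) \<Omega>"
  unfolding christoffel_def cometric_def[symmetric]
  by (intro smooth_on_mult smooth_on_sum smooth_on_add smooth_on_diff smooth_on_const smooth_on_dd
      smooth_on_vec_nth open_domain smooth_metric smooth_cometric_nth)

lemma levi_civita_coordinate_fields:
  "levi_civita G (\<lambda>_. axis i 1) (\<lambda>_. axis j 1) = (\<lambda>x. \<chi> k. christoffel G x k i j)"
proof -
  have "(\<Sum>a\<in>UNIV. \<Sum>b\<in>UNIV. christoffel G x k a b * axis i 1 $ a * axis j 1 $ b) = christoffel G x k i j"
    for x k
  proof -
    have "(\<Sum>a\<in>UNIV. \<Sum>b\<in>UNIV. christoffel G x k a b * axis i 1 $ a * axis j 1 $ b)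
        = (\<Sum>a\<in>UNIV. \<Sum>b\<in>UNIV. if b = j then (if a = i then christoffel G x k a b else 0) else 0)"
      by (intro sum.cong refl) (auto simp: axis_def)
    also have "\<dots> = (\<Sum>a\<in>UNIV. if a = i then christoffel G x k a j else 0)"
      by (intro sum.cong refl) (simp add: sum.delta)
    also have "\<dots> = christoffel G x k i j" by (simp add: sum.delta)
    finally show ?thesis .
  qed
  then show ?thesis by (simp add: levi_civita_def deriv_along_def fun_eq_iff)
qed

lemma smooth_levi_civita: "smooth_on (levi_civita G (\<lambda>_. axis i 1) (\<lambda>_. axis j 1)) \<Omega>"
  unfolding levi_civita_coordinate_fields
  by (rule smooth_on_vec_lambda[OF open_domain]) (simp add: smooth_christoffel)

lemma smooth_deriv_along:
  fixes S :: "real ^ 'm \<Rightarrow> 'b::real_normed_vector"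
  assumes "smooth_on X \<Omega>" "smooth_on S \<Omega>"
  shows "smooth_on (deriv_along X S) \<Omega>"
proof (rule smooth_on_cong[OF open_domain])
  show "(\<Sum>k\<in>UNIV. X x $ k *\<^sub>R dd S (axis k 1) x) = deriv_along X S x" if "x \<in> \<Omega>" for x
    unfolding deriv_along_def by (rule frechet_derivative_coordinates[OF assms(2) that, symmetric])
  show "smooth_on (\<lambda>x. \<Sum>k\<in>UNIV. X x $ k *\<^sub>R dd S (axis k 1) x) \<Omega>"
    by (intro smooth_on_sum smooth_on_scaleR smooth_on_vec_nth smooth_on_dd assms open_domain)
qed

lemma smooth_pullback_conn:
  "smooth_on X \<Omega> \<Longrightarrow> smooth_on S \<Omega> \<Longrightarrow> smooth_on (pullback_conn \<Phi> X S) \<Omega>"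
  unfolding pullback_conn_def tangential_def
  by (intro smooth_on_diff smooth_on_scaleR smooth_on_inner smooth_deriv_along open_domain smooth_map)

lemma smooth_metric_trace:
  fixes B :: "(real ^ 'm \<Rightarrow> real ^ 'm) \<Rightarrow> (real ^ 'm \<Rightarrow> real ^ 'm) \<Rightarrow> real ^ 'm \<Rightarrow> 'b::real_normed_vector"
  shows "(\<And>i j. smooth_on (B (\<lambda>_. axis i 1) (\<lambda>_. axis j 1)) \<Omega>) \<Longrightarrow> smooth_on (metric_trace G B) \<Omega>"
  unfolding metric_trace_def cometric_def[symmetric]
  by (intro smooth_on_sum smooth_on_scaleR open_domain smooth_cometric_nth)

lemma smooth_tension: "smooth_on (tension G \<Phi>) \<Omega>"
  unfolding tension_def second_fund_form_def
  by (intro smooth_metric_trace smooth_on_diff smooth_pullback_conn smooth_deriv_along smooth_levi_civita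
      smooth_on_const smooth_map open_domain)

lemma smooth_rough_laplacian: "smooth_on S \<Omega> \<Longrightarrow> smooth_on (rough_laplacian G \<Phi> S) \<Omega>"
  unfolding rough_laplacian_def
  by (intro smooth_on_uminus smooth_metric_trace smooth_on_diff smooth_pullback_conn smooth_levi_civita
      smooth_on_const open_domain)

lemma smooth_laplacian_tension: "smooth_on (laplacian_tension G \<Phi> r) \<Omega>"
  by (induction r) (simp_all add: laplacian_tension_def smooth_tension smooth_rough_laplacian)

text \<open>The formula for the curvature of the sphere holds for tangent vectors; the tangency of all the
  sections involved follows from that of covariant derivatives and of the differential.\<close>

lemma tangential_inner_unit: "x \<in> \<Omega> \<Longrightarrow> tangential (\<Phi> x) v \<bullet> \<Phi> x = 0"
  using unit_length[of x] by (simp add: tangential_def inner_diff_left norm_eq_1)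

lemma pullback_conn_tangent: "x \<in> \<Omega> \<Longrightarrow> pullback_conn \<Phi> X S x \<bullet> \<Phi> x = 0"
  by (simp add: pullback_conn_def tangential_inner_unit)

lemma derivative_tangent:
  assumes "x \<in> \<Omega>"
  shows "deriv_along X \<Phi> x \<bullet> \<Phi> x = 0"
proof -
  note D = smooth_on_has_derivative[OF smooth_map assms]
  have "dd (\<lambda>y. \<Phi> y \<bullet> \<Phi> y) v x = dd (\<lambda>y. 1) v x" for v
    using frechet_derivative_cong_open[OF open_domain assms, of "\<lambda>y. \<Phi> y \<bullet> \<Phi> y" "\<lambda>y. 1"] unit_length
    by (simp add: norm_eq_1)
  moreover have "dd (\<lambda>y. \<Phi> y \<bullet> \<Phi> y) v x = \<Phi> x \<bullet> dd \<Phi> v x + dd \<Phi> v x \<bullet> \<Phi> x" for v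
    by (rule dd_eq[OF has_derivative_inner[OF D D]])
  ultimately show ?thesis by (simp add: deriv_along_def inner_commute)
qed

lemma metric_trace_tangent:
  "(\<And>i j. B (\<lambda>_. axis i 1) (\<lambda>_. axis j 1) x \<bullet> \<Phi> x = 0) \<Longrightarrow> metric_trace G B x \<bullet> \<Phi> x = 0"
  by (simp add: metric_trace_def inner_sum_left)

lemma laplacian_tension_tangent:
  assumes "x \<in> \<Omega>"
  shows "laplacian_tension G \<Phi> r x \<bullet> \<Phi> x = 0"
proof (cases r)
  case 0
  have "tension G \<Phi> x \<bullet> \<Phi> x = 0"
    unfolding tension_def
    by (intro metric_trace_tangent)
      (simp add: second_fund_form_def inner_diff_left pullback_conn_tangent derivative_tangent assms)
  then show ?thesis using 0 by (simp add: laplacian_tension_def)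
next
  case (Suc q)
  have "rough_laplacian G \<Phi> S x \<bullet> \<Phi> x = 0" for S
    unfolding rough_laplacian_def inner_minus_left neg_equal_0_iff_equal
    by (intro metric_trace_tangent) (simp add: inner_diff_left pullback_conn_tangent assms)
  then show ?thesis using Suc by (simp add: laplacian_tension_def)
qed

text \<open>The difference consists of the terms in which the coefficients are differentiated.\<close>

lemma dominated_laplacian_minus_second_order:
  assumes h: "smooth_on h \<Omega>"
  shows "dominated \<Omega> {h} (\<lambda>x. laplacian h x
    - (\<Sum>i\<in>UNIV. \<Sum>j\<in>UNIV. cometric x $ i $ j * dd (dd h (axis j 1)) (axis i 1) x))"
proof (rule dominated_cong)
  show "dominated \<Omega> {h} (\<lambda>x. \<Sum>i\<in>UNIV. \<Sum>j\<in>UNIV. dd cometric (axis i 1) x $ i $ j * dd h (axis j 1) x)"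
    by (intro dominated_sum dominated_mult open_domain smooth_on_continuous smooth_on_vec_nth smooth_on_dd
        smooth_cometric dominated_dd[OF _ _ smooth_onD[OF h]]) auto
  fix x assume x: "x \<in> \<Omega>"
  have gh: "smooth_on (grad h) \<Omega>"
    unfolding smooth_on_def using C_on_grad[OF open_domain smooth_onD[OF h]] by blast
  have gnth: "grad h y $ j = dd h (axis j 1) y" if "y \<in> \<Omega>" for y j
    using dd_eq_grad_inner[OF smooth_onD[OF h] that, of "axis j 1"] by (simp add: inner_axis)
  have gnth2: "dd (grad h) v x $ j = dd (dd h (axis j 1)) v x" for v j
  proof -
    have "dd (\<lambda>y. grad h y $ j) v x = dd (grad h) v x $ j"
      by (rule dd_eq) (rule bounded_linear.has_derivative[OF bounded_linear_vec_nth smooth_on_has_derivative[OF gh x]])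
    moreover have "dd (\<lambda>y. grad h y $ j) v x = dd (dd h (axis j 1)) v x"
      by (rule fun_cong[OF frechet_derivative_cong_open[OF open_domain x gnth]])
    ultimately show ?thesis by simp
  qed
  have "((\<lambda>y. cometric y *v grad h y) has_derivative
      (\<lambda>v. cometric x *v dd (grad h) v x + dd cometric v x *v grad h x)) (at x)"
    by (rule has_derivative_matrix_vector_mult[OF smooth_on_has_derivative[OF smooth_cometric x]
          smooth_on_has_derivative[OF gh x]])
  then have "laplacian h x = (\<Sum>b\<in>Basis. (cometric x *v dd (grad h) b x + dd cometric b x *v grad h x) \<bullet> b)"
    unfolding laplacian_def by (rule divergence_eq)
  also have "(Basis :: (real ^ 'm) set) = range (\<lambda>i. axis i 1)" by (auto simp: Basis_vec_def)
  also have "(\<Sum>b\<in>range (\<lambda>i::'m. axis i 1). (cometric x *v dd (grad h) b x + dd cometric b x *v grad h x) \<bullet> b)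
      = (\<Sum>i\<in>UNIV. (cometric x *v dd (grad h) (axis i 1) x + dd cometric (axis i 1) x *v grad h x) $ i)"
    by (subst sum.reindex) (auto simp: inj_on_def axis_eq_axis inner_axis)
  also have "\<dots> = (\<Sum>i\<in>UNIV. \<Sum>j\<in>UNIV. cometric x $ i $ j * dd (dd h (axis j 1)) (axis i 1) x)
      + (\<Sum>i\<in>UNIV. \<Sum>j\<in>UNIV. dd cometric (axis i 1) x $ i $ j * dd h (axis j 1) x)"
    by (simp add: matrix_vector_mult_def gnth2 gnth[OF x] sum.distrib)
  finally show "(\<Sum>i\<in>UNIV. \<Sum>j\<in>UNIV. dd cometric (axis i 1) x $ i $ j * dd h (axis j 1) x)
      = laplacian h x - (\<Sum>i\<in>UNIV. \<Sum>j\<in>UNIV. cometric x $ i $ j * dd (dd h (axis j 1)) (axis i 1) x)"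
    by simp
qed

lemma dominated_metric_trace:
  fixes B :: "(real ^ 'm \<Rightarrow> real ^ 'm) \<Rightarrow> (real ^ 'm \<Rightarrow> real ^ 'm) \<Rightarrow> real ^ 'm \<Rightarrow> (real ^ 'n) \<times> real"
  assumes "\<And>i j. dominated \<Omega> us (\<lambda>x. snd (B (\<lambda>_. axis i 1) (\<lambda>_. axis j 1) x))"
  shows "dominated \<Omega> us (\<lambda>x. snd (metric_trace G B x))"
proof (rule dominated_cong)
  show "dominated \<Omega> us (\<lambda>x. \<Sum>i\<in>UNIV. \<Sum>j\<in>UNIV. cometric x $ i $ j * snd (B (\<lambda>_. axis i 1) (\<lambda>_. axis j 1) x))"
    by (intro dominated_sum dominated_mult open_domain smooth_on_continuous[OF smooth_cometric_nth] assms)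
qed (simp add: metric_trace_def snd_sum cometric_def)

lemma dominated_derivative:
  assumes "smooth_on S \<Omega>" "smooth_on X \<Omega>" "finite us" "(\<lambda>x. snd (S x)) \<in> us"
  shows "dominated \<Omega> us (\<lambda>x. snd (deriv_along X S x))"
proof (rule dominated_cong)
  show "dominated \<Omega> us (\<lambda>x. \<Sum>k\<in>UNIV. X x $ k * dd (\<lambda>x. snd (S x)) (axis k 1) x)"
    by (intro dominated_sum dominated_mult open_domain smooth_on_continuous smooth_on_vec_nth assms
        dominated_dd[OF assms(3,4) smooth_onD[OF smooth_on_snd[OF open_domain assms(1)]]])
  show "(\<Sum>k\<in>UNIV. X x $ k * dd (\<lambda>x. snd (S x)) (axis k 1) x) = snd (deriv_along X S x)" if "x \<in> \<Omega>" for x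
    unfolding deriv_along_def frechet_derivative_coordinates[OF assms(1) that, of "X x"]
    by (simp add: snd_sum dd_snd[OF assms(1) that])
qed

text \<open>Projecting to the tangent space subtracts a multiple of \<open>\<Phi>\<close>, and the last coordinate of \<open>\<Phi>\<close> is
  the height itself.\<close>

lemma dominated_pullback_conn:
  assumes "smooth_on S \<Omega>" "smooth_on X \<Omega>" "finite us" "(\<lambda>x. snd (S x)) \<in> us" "height \<in> us"
  shows "dominated \<Omega> us (\<lambda>x. snd (pullback_conn \<Phi> X S x))"
proof (rule dominated_cong)
  show "dominated \<Omega> us (\<lambda>x. snd (deriv_along X S x) - (deriv_along X S x \<bullet> \<Phi> x) * height x)"
    by (intro dominated_diff dominated_derivative dominated_mult dominated_member assms open_domain
        smooth_on_continuous smooth_on_inner smooth_deriv_along smooth_map)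
qed (simp add: pullback_conn_def tangential_def height_def)

text \<open>The inner projection contributes a multiple of the height, whose derivative is again of first
  order in the height; so second derivatives occur only in the flat one of \<open>snd \<circ> S\<close>.\<close>

lemma dominated_second_pullback_conn:
  assumes "smooth_on S \<Omega>" "finite us" "(\<lambda>x. snd (S x)) \<in> us" "height \<in> us"
  shows "dominated \<Omega> us (\<lambda>x. snd (pullback_conn \<Phi> (\<lambda>_. a) (pullback_conn \<Phi> (\<lambda>_. b) S) x)
    - dd (dd (\<lambda>x. snd (S x)) b) a x)"
proof (rule dominated_cong)
  define s where "s = (\<lambda>x. snd (S x))"
  define c where "c = (\<lambda>x. dd S b x \<bullet> \<Phi> x)"
  define T where "T = pullback_conn \<Phi> (\<lambda>_. b) S"
  have s: "smooth_on s \<Omega>" unfolding s_def by (rule smooth_on_snd[OF open_domain assms(1)])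
  have c: "smooth_on c \<Omega>" unfolding c_def
    by (intro smooth_on_inner smooth_on_dd assms smooth_map open_domain)
  have T: "smooth_on T \<Omega>" unfolding T_def by (intro smooth_pullback_conn smooth_on_const assms)
  have sndT: "snd (T y) = dd s b y - c y * height y" if "y \<in> \<Omega>" for y
    by (simp add: T_def pullback_conn_def tangential_def deriv_along_def c_def height_def s_def
        dd_snd[OF assms(1) that])
  show "dominated \<Omega> us (\<lambda>x. - (dd T a x \<bullet> \<Phi> x + dd c a x) * height x - c x * dd height a x)"
    by (intro dominated_diff dominated_mult dominated_member dominated_dd[OF _ _ smooth_onD[OF smooth_height]]
        assms open_domain smooth_on_continuous smooth_on_uminus smooth_on_add smooth_on_inner smooth_on_dd
        T c smooth_map)
  fix x assume x: "x \<in> \<Omega>"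
  have "dd (\<lambda>y. snd (T y)) a x = dd (\<lambda>y. dd s b y - c y * height y) a x"
    by (rule fun_cong[OF frechet_derivative_cong_open[OF open_domain x sndT]])
  also have "\<dots> = dd (dd s b) a x - (c x * dd height a x + dd c a x * height x)"
    by (rule dd_eq) (intro has_derivative_diff has_derivative_mult smooth_on_has_derivative[OF _ x]
        smooth_on_dd s c smooth_height)
  finally have "snd (dd T a x) = dd (dd s b) a x - (c x * dd height a x + dd c a x * height x)"
    by (simp add: dd_snd[OF T x])
  then show "- (dd T a x \<bullet> \<Phi> x + dd c a x) * height x - c x * dd height a x
      = snd (pullback_conn \<Phi> (\<lambda>_. a) (pullback_conn \<Phi> (\<lambda>_. b) S) x) - dd (dd (\<lambda>x. snd (S x)) b) a x"
    unfolding T_def[symmetric] s_def[symmetric]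
    by (simp add: pullback_conn_def tangential_def deriv_along_def height_def algebra_simps)
qed

text \<open>In the next two lemmas the Christoffel symbols of the domain multiply first derivatives only, which
  leaves the trace of the flat second derivatives as the only term of second order.\<close>

lemma dominated_tension:
  "dominated \<Omega> {height} (\<lambda>x. snd (tension G \<Phi> x) - laplacian height x)"
proof (rule dominated_cong)
  define E where "E i j x = snd (second_fund_form G \<Phi> (\<lambda>_. axis i 1) (\<lambda>_. axis j 1) x)
    - dd (dd height (axis j 1)) (axis i 1) x" for i j x
  have E: "dominated \<Omega> {height} (E i j)" for i j
  proof (rule dominated_cong)
    define P where "P = dd \<Phi> (axis j 1)"
    have P: "smooth_on P \<Omega>" unfolding P_def by (rule smooth_on_dd[OF smooth_map])
    show "dominated \<Omega> {height} (\<lambda>x. - (dd P (axis i 1) x \<bullet> \<Phi> x) * height x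
        - snd (deriv_along (levi_civita G (\<lambda>_. axis i 1) (\<lambda>_. axis j 1)) \<Phi> x))"
      by (intro dominated_diff dominated_mult dominated_member dominated_derivative smooth_on_continuous
          smooth_on_uminus smooth_on_inner smooth_on_dd P smooth_map smooth_levi_civita open_domain)
        (auto simp: height_def[abs_def])
    fix x assume x: "x \<in> \<Omega>"
    have "dd (dd height (axis j 1)) (axis i 1) x = dd (\<lambda>y. snd (P y)) (axis i 1) x"
      using frechet_derivative_cong_open[OF open_domain x, of "dd height (axis j 1)" "\<lambda>y. snd (P y)"]
        dd_snd[OF smooth_map] by (simp add: P_def height_def[abs_def])
    then have "dd (dd height (axis j 1)) (axis i 1) x = snd (dd P (axis i 1) x)"
      by (simp add: dd_snd[OF P x])
    then show "- (dd P (axis i 1) x \<bullet> \<Phi> x) * height x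
        - snd (deriv_along (levi_civita G (\<lambda>_. axis i 1) (\<lambda>_. axis j 1)) \<Phi> x) = E i j x"
      unfolding E_def second_fund_form_def
      by (simp add: pullback_conn_def tangential_def P_def deriv_along_def height_def)
  qed
  show "dominated \<Omega> {height} (\<lambda>x. (\<Sum>i\<in>UNIV. \<Sum>j\<in>UNIV. cometric x $ i $ j * E i j x)
      - (laplacian height x
        - (\<Sum>i\<in>UNIV. \<Sum>j\<in>UNIV. cometric x $ i $ j * dd (dd height (axis j 1)) (axis i 1) x)))"
    by (intro dominated_diff dominated_sum dominated_mult E open_domain
        smooth_on_continuous[OF smooth_cometric_nth]
        dominated_laplacian_minus_second_order[OF smooth_height])
  show "(\<Sum>i\<in>UNIV. \<Sum>j\<in>UNIV. cometric x $ i $ j * E i j x)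
      - (laplacian height x
        - (\<Sum>i\<in>UNIV. \<Sum>j\<in>UNIV. cometric x $ i $ j * dd (dd height (axis j 1)) (axis i 1) x))
      = snd (tension G \<Phi> x) - laplacian height x" for x
    by (simp add: E_def tension_def metric_trace_def snd_sum cometric_def right_diff_distrib sum_subtractf)
qed

lemma dominated_rough_laplacian:
  assumes S: "smooth_on S \<Omega>" and s_def: "s = (\<lambda>x. snd (S x))"
  shows "dominated \<Omega> {height, s} (\<lambda>x. snd (rough_laplacian G \<Phi> S x) + laplacian s x)"
proof (rule dominated_cong)
  have s: "smooth_on s \<Omega>" unfolding s_def by (rule smooth_on_snd[OF open_domain S])
  define E where "E i j x = (snd (pullback_conn \<Phi> (\<lambda>_. axis i 1) (pullback_conn \<Phi> (\<lambda>_. axis j 1) S) x)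
     - dd (dd s (axis j 1)) (axis i 1) x)
     - snd (pullback_conn \<Phi> (levi_civita G (\<lambda>_. axis i 1) (\<lambda>_. axis j 1)) S x)" for i j x
  have E: "dominated \<Omega> {height, s} (E i j)" for i j
    unfolding E_def s_def
    by (intro dominated_diff dominated_second_pullback_conn dominated_pullback_conn S smooth_levi_civita) auto
  show "dominated \<Omega> {height, s} (\<lambda>x. (laplacian s x
        - (\<Sum>i\<in>UNIV. \<Sum>j\<in>UNIV. cometric x $ i $ j * dd (dd s (axis j 1)) (axis i 1) x))
      - (\<Sum>i\<in>UNIV. \<Sum>j\<in>UNIV. cometric x $ i $ j * E i j x))"
    by (intro dominated_diff dominated_sum dominated_mult E open_domain
        smooth_on_continuous[OF smooth_cometric_nth]
        dominated_mono[OF dominated_laplacian_minus_second_order[OF s]]) auto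
  show "(laplacian s x
        - (\<Sum>i\<in>UNIV. \<Sum>j\<in>UNIV. cometric x $ i $ j * dd (dd s (axis j 1)) (axis i 1) x))
      - (\<Sum>i\<in>UNIV. \<Sum>j\<in>UNIV. cometric x $ i $ j * E i j x)
      = snd (rough_laplacian G \<Phi> S x) + laplacian s x" for x
    by (simp add: E_def rough_laplacian_def metric_trace_def snd_sum cometric_def right_diff_distrib
        sum_subtractf)
qed

lemma dominated_sphere_curv:
  assumes "smooth_on u \<Omega>" "smooth_on v \<Omega>" "smooth_on w \<Omega>"
    and "\<And>x. x \<in> \<Omega> \<Longrightarrow> u x \<bullet> \<Phi> x = 0" "\<And>x. x \<in> \<Omega> \<Longrightarrow> v x \<bullet> \<Phi> x = 0" "\<And>x. x \<in> \<Omega> \<Longrightarrow> w x \<bullet> \<Phi> x = 0"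
    and "dominated \<Omega> us (\<lambda>x. snd (u x))" "dominated \<Omega> us (\<lambda>x. snd (v x))"
  shows "dominated \<Omega> us (\<lambda>x. snd (sphere_curv (\<Phi> x) (u x) (v x) (w x)))"
proof (rule dominated_cong)
  show "dominated \<Omega> us (\<lambda>x. (v x \<bullet> w x) * snd (u x) - (u x \<bullet> w x) * snd (v x))"
    by (intro dominated_diff dominated_mult smooth_on_continuous smooth_on_inner assms open_domain)
qed (simp add: sphere_curv_eq unit_length assms)

definition tension_height :: "nat \<Rightarrow> real ^ 'm \<Rightarrow> real" where
  "tension_height r = (\<lambda>x. snd (laplacian_tension G \<Phi> r x))"

lemma smooth_tension_height: "smooth_on (tension_height r) \<Omega>"
  unfolding tension_height_def by (rule smooth_on_snd[OF open_domain smooth_laplacian_tension])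

lemma dominated_laplacian_height:
  "dominated \<Omega> {height} (\<lambda>x. tension_height 0 x - laplacian height x)"
  using dominated_tension by (simp add: tension_height_def laplacian_tension_def)

lemma dominated_laplacian_tension_height:
  "dominated \<Omega> {height, tension_height r} (\<lambda>x. tension_height (Suc r) x + laplacian (tension_height r) x)"
proof -
  have "laplacian_tension G \<Phi> (Suc r) = rough_laplacian G \<Phi> (laplacian_tension G \<Phi> r)"
    by (simp add: laplacian_tension_def)
  then show ?thesis
    using dominated_rough_laplacian[OF smooth_laplacian_tension[of r] tension_height_def]
    by (simp add: tension_height_def[of "Suc r"])
qed

text \<open>As \<open>R(u, v) w\<close> is a combination of \<open>u\<close> and \<open>v\<close>, only the last coordinates of these two sections
  matter. They are unknowns, first derivatives of the height, or last coordinates of covariant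
  derivatives, and these are dominated.\<close>

lemma
  assumes "finite us" "height \<in> us" "tension_height q \<in> us"
  shows dominated_curv_term: "dominated \<Omega> us (\<lambda>x. snd (curv_term G \<Phi> (laplacian_tension G \<Phi> q) x))"
    and dominated_curv_term_left: "tension_height r \<in> us \<Longrightarrow> dominated \<Omega> us
      (\<lambda>x. snd (curv_term_left G \<Phi> (laplacian_tension G \<Phi> q) (laplacian_tension G \<Phi> r) x))"
    and dominated_curv_term_right: "tension_height r \<in> us \<Longrightarrow> dominated \<Omega> us
      (\<lambda>x. snd (curv_term_right G \<Phi> (laplacian_tension G \<Phi> q) (laplacian_tension G \<Phi> r) x))"
proof -
  have \<Phi>: "(\<lambda>x. snd (\<Phi> x)) \<in> us" using assms(2) by (simp add: height_def[abs_def])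
  have snd_us: "(\<lambda>x. snd (laplacian_tension G \<Phi> r x)) \<in> us" if "tension_height r \<in> us" for r
    using that by (simp add: tension_height_def)
  note smooth = smooth_laplacian_tension smooth_deriv_along smooth_pullback_conn smooth_on_const smooth_map
  note tangent = laplacian_tension_tangent derivative_tangent pullback_conn_tangent
  have mem: "dominated \<Omega> us (\<lambda>x. snd (laplacian_tension G \<Phi> r x))" if "tension_height r \<in> us" for r
    by (rule dominated_member[OF assms(1) snd_us[OF that]])
  show "dominated \<Omega> us (\<lambda>x. snd (curv_term G \<Phi> (laplacian_tension G \<Phi> q) x))"
    unfolding curv_term_def
    by (intro dominated_metric_trace dominated_sphere_curv smooth tangent mem assms
        dominated_derivative[OF _ _ _ \<Phi>])
  show "dominated \<Omega> us (\<lambda>x. snd (curv_term_left G \<Phi> (laplacian_tension G \<Phi> q) (laplacian_tension G \<Phi> r) x))"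
    if "tension_height r \<in> us"
    unfolding curv_term_left_def
    by (intro dominated_metric_trace dominated_sphere_curv smooth tangent mem assms that
        dominated_pullback_conn snd_us)
  show "dominated \<Omega> us (\<lambda>x. snd (curv_term_right G \<Phi> (laplacian_tension G \<Phi> q) (laplacian_tension G \<Phi> r) x))"
    if "tension_height r \<in> us"
    unfolding curv_term_right_def
    by (intro dominated_metric_trace dominated_sphere_curv smooth tangent mem assms that
        dominated_pullback_conn snd_us)
qed

text \<open>The unknowns of the system. For \<open>k = 1\<close> the height is the only one.\<close>

definition heights :: "nat \<Rightarrow> (real ^ 'm \<Rightarrow> real) set" where
  "heights k = insert height (tension_height ` {..<k - 1})"

lemma finite_heights: "finite (heights k)"
  by (simp add: heights_def)

text \<open>In the \<open>k\<close>-harmonic equation the iterated rough Laplacian of order \<open>k - 1\<close> of the tension field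
  occurs alone, while the curvature terms involve orders at most \<open>k - 2\<close>, which belong to the
  unknowns.\<close>

lemma k_harmonic_dominated:
  assumes "1 \<le> k" "\<And>x. x \<in> \<Omega> \<Longrightarrow> k_tension k G \<Phi> x = 0"
  shows "dominated \<Omega> (heights k) (tension_height (k - 1))"
proof -
  have us: "finite (heights k)" "height \<in> heights k" by (auto simp: heights_def)
  have mem: "tension_height q \<in> heights k" if "q < k - 1" for q using that by (auto simp: heights_def)
  define s where "s = k div 2"
  have "k = 1 \<or> (k = 2 * s \<and> 1 \<le> s) \<or> (k = 2 * s + 1 \<and> 1 \<le> s)"
    using assms(1) unfolding s_def by presburger
  then consider "k = 1" | "k = 2 * s" "1 \<le> s" | "k = 2 * s + 1" "1 \<le> s" by blast
  then show ?thesis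
  proof cases
    case 1
    show ?thesis
    proof (rule dominated_cong[OF dominated_zero])
      show "0 = tension_height (k - 1) x" if "x \<in> \<Omega>" for x
        using assms(2)[OF that] 1 by (simp add: k_tension_def tension_height_def laplacian_tension_def)
    qed
  next
    case 2
    define \<tau> where "\<tau> = laplacian_tension G \<Phi>"
    have eq: "tension_height (k - 1) x = snd (curv_term G \<Phi> (\<tau> (2 * s - 2)) x)
        + (\<Sum>l = 1..s - 1. snd (curv_term_left G \<Phi> (\<tau> (s + l - 2)) (\<tau> (s - l - 1)) x)
          - snd (curv_term_right G \<Phi> (\<tau> (s + l - 2)) (\<tau> (s - l - 1)) x))" if "x \<in> \<Omega>" for x
    proof -
      have "tension_even G \<Phi> s x = 0"
        using assms(2)[OF that] 2 by (simp add: k_tension_def)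
      then have "snd (tension_even G \<Phi> s x) = 0" by simp
      then show ?thesis
        using 2(1) by (simp add: tension_even_def Let_def tension_height_def \<tau>_def snd_sum)
    qed
    show ?thesis
    proof (rule dominated_cong)
      show "dominated \<Omega> (heights k) (\<lambda>x. snd (curv_term G \<Phi> (\<tau> (2 * s - 2)) x)
        + (\<Sum>l = 1..s - 1. snd (curv_term_left G \<Phi> (\<tau> (s + l - 2)) (\<tau> (s - l - 1)) x)
          - snd (curv_term_right G \<Phi> (\<tau> (s + l - 2)) (\<tau> (s - l - 1)) x)))"
        unfolding \<tau>_def
        by (intro dominated_add dominated_sum dominated_diff dominated_curv_term dominated_curv_term_left
            dominated_curv_term_right us mem) (use 2 in auto)
    qed (rule eq[symmetric])
  next
    case 3
    define \<tau> where "\<tau> = laplacian_tension G \<Phi>"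
    have eq: "tension_height (k - 1) x = snd (curv_term G \<Phi> (\<tau> (2 * s - 1)) x)
        + (\<Sum>l = 1..s - 1. snd (curv_term_left G \<Phi> (\<tau> (s + l - 1)) (\<tau> (s - l - 1)) x)
          - snd (curv_term_right G \<Phi> (\<tau> (s + l - 1)) (\<tau> (s - l - 1)) x))
        + snd (curv_term_left G \<Phi> (\<tau> (s - 1)) (\<tau> (s - 1)) x)" if "x \<in> \<Omega>" for x
    proof -
      have "tension_odd G \<Phi> s x = 0"
        using assms(2)[OF that] 3 by (simp add: k_tension_def)
      then have "snd (tension_odd G \<Phi> s x) = 0" by simp
      then show ?thesis
        using 3(1) by (simp add: tension_odd_def Let_def tension_height_def \<tau>_def snd_sum)
    qed
    show ?thesis
    proof (rule dominated_cong)
      show "dominated \<Omega> (heights k) (\<lambda>x. snd (curv_term G \<Phi> (\<tau> (2 * s - 1)) x)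
        + (\<Sum>l = 1..s - 1. snd (curv_term_left G \<Phi> (\<tau> (s + l - 1)) (\<tau> (s - l - 1)) x)
          - snd (curv_term_right G \<Phi> (\<tau> (s + l - 1)) (\<tau> (s - l - 1)) x))
        + snd (curv_term_left G \<Phi> (\<tau> (s - 1)) (\<tau> (s - 1)) x))"
        unfolding \<tau>_def
        by (intro dominated_add dominated_sum dominated_diff dominated_curv_term dominated_curv_term_left
            dominated_curv_term_right us mem) (use 3 in auto)
    qed (rule eq[symmetric])
  qed
qed

lemma laplacian_heights_dominated:
  assumes "1 \<le> k" "\<And>x. x \<in> \<Omega> \<Longrightarrow> k_tension k G \<Phi> x = 0" "h \<in> heights k"
  shows "dominated \<Omega> (heights k) (laplacian h)"
proof -
  have mem: "dominated \<Omega> (heights k) (tension_height q)" if "q \<le> k - 1" for q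
  proof (cases "q = k - 1")
    case True
    then show ?thesis using k_harmonic_dominated[OF assms(1,2)] by simp
  next
    case False
    then show ?thesis using that by (intro dominated_member finite_heights) (auto simp: heights_def)
  qed
  consider "h = height" | r where "r < k - 1" "h = tension_height r"
    using assms(3) by (auto simp: heights_def)
  then show ?thesis
  proof cases
    case 1
    have "dominated \<Omega> (heights k) (\<lambda>x. tension_height 0 x - (tension_height 0 x - laplacian height x))"
      by (intro dominated_diff mem dominated_mono[OF dominated_laplacian_height] finite_heights)
        (auto simp: heights_def)
    then show ?thesis using 1 by simp
  next
    case 2
    have "dominated \<Omega> (heights k)
        (\<lambda>x. (tension_height (Suc r) x + laplacian (tension_height r) x) - tension_height (Suc r) x)"
      using 2(1)
      by (intro dominated_diff mem dominated_mono[OF dominated_laplacian_tension_height] finite_heights)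
        (auto simp: heights_def)
    then show ?thesis using 2 by simp
  qed
qed

lemma laplacian_vanishes:
  assumes "open W" "\<And>x. x \<in> W \<Longrightarrow> h x = 0" "x \<in> W"
  shows "laplacian h x = 0"
proof -
  have "laplacian h x = divergence (\<lambda>_. 0) x"
    unfolding laplacian_def
  proof (rule divergence_cong_open[OF assms(1,3)])
    fix y assume "y \<in> W"
    then have "grad h y = grad (\<lambda>_. 0) y" using assms(1,2) by (intro grad_cong_open) auto
    then show "cometric y *v grad h y = 0" by (simp add: grad_def)
  qed
  then show ?thesis by (simp add: divergence_def)
qed

text \<open>The equations express each unknown by the operator applied to the preceding one and terms of lower
  order, so they vanish one after the other.\<close>

lemma tension_height_vanishes:
  assumes W: "open W" "W \<subseteq> \<Omega>" "\<And>x. x \<in> W \<Longrightarrow> height x = 0"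
  shows "x \<in> W \<Longrightarrow> tension_height r x = 0"
proof (induction r arbitrary: x)
  case 0
  then show ?case
    using dominated_vanishes[OF dominated_laplacian_height W(1,2), of x] laplacian_vanishes[OF W(1), of height x] W(3)
    by auto
next
  case (Suc r)
  then show ?case
    using dominated_vanishes[OF dominated_laplacian_tension_height W(1,2), of r x]
      laplacian_vanishes[OF W(1), of "tension_height r" x] W(3)
    by auto
qed

lemma height_unique_continuation:
  assumes "1 \<le> k" "\<And>x. x \<in> \<Omega> \<Longrightarrow> k_tension k G \<Phi> x = 0"
    and B: "open B" "connected B" "B \<subseteq> \<Omega>"
    and W: "open W" "W \<noteq> {}" "W \<subseteq> B" "\<And>x. x \<in> W \<Longrightarrow> height x = 0" and "x \<in> B"
  shows "height x = 0"
proof (rule unique_continuation[OF B(1,2) _ _ _ finite_heights[of k] _ _ W(1-3), where u = "\<lambda>h. h"])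
  show "C_on 1 cometric B" by (rule C_on_subset[OF smooth_onD[OF smooth_cometric] B(3)])
  show "transpose (cometric x) = cometric x" if "x \<in> B" for x
    using that B(3) by (intro cometric_symmetric) auto
  show "0 < v \<bullet> (cometric x *v v)" if "x \<in> B" "v \<noteq> 0" for x v
    using that B(3) by (intro cometric_positive) auto
  show "C_on 2 h B" if "h \<in> heights k" for h
  proof -
    have "smooth_on h \<Omega>" using that smooth_height smooth_tension_height by (auto simp: heights_def)
    then show ?thesis by (rule C_on_subset[OF smooth_onD B(3)])
  qed
  show "h x = 0" if "h \<in> heights k" "x \<in> W" for h x
    using that W tension_height_vanishes[OF W(1) _ W(4), of x] B(3) by (auto simp: heights_def)
  show "\<exists>C e. 0 < e \<and> (\<forall>y\<in>B \<inter> ball x e. \<forall>h\<in>heights k.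
      \<bar>divergence (\<lambda>y. cometric y *v grad h y) y\<bar> \<le> C * (\<Sum>h\<in>heights k. \<bar>h y\<bar> + norm (grad h y)))"
    if "x \<in> B" for x
  proof -
    have "dominated \<Omega> (heights k) (\<lambda>y. \<Sum>h\<in>heights k. \<bar>laplacian h y\<bar>)"
    proof (rule dominated_sum)
      show "dominated \<Omega> (heights k) (\<lambda>y. \<bar>laplacian h y\<bar>)" if "h \<in> heights k" for h
        using laplacian_heights_dominated[OF assms(1,2) that] by (simp add: dominated_def)
    qed
    moreover have "x \<in> \<Omega>" using that B(3) by blast
    ultimately have "\<exists>C e. 0 < e \<and> (\<forall>y\<in>\<Omega> \<inter> ball x e.
        \<bar>\<Sum>h\<in>heights k. \<bar>laplacian h y\<bar>\<bar> \<le> C * jet_size (heights k) y)"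
      unfolding dominated_def by (rule bspec)
    then obtain C e where C: "0 < e" "\<forall>y\<in>\<Omega> \<inter> ball x e.
        \<bar>\<Sum>h\<in>heights k. \<bar>laplacian h y\<bar>\<bar> \<le> C * jet_size (heights k) y"
      by (elim exE conjE)
    have "\<bar>laplacian h y\<bar> \<le> C * jet_size (heights k) y" if "y \<in> B \<inter> ball x e" "h \<in> heights k" for y h
    proof -
      have "\<bar>laplacian h y\<bar> \<le> (\<Sum>h\<in>heights k. \<bar>laplacian h y\<bar>)"
        using that(2) by (intro member_le_sum finite_heights) auto
      also have "\<dots> \<le> \<bar>\<Sum>h\<in>heights k. \<bar>laplacian h y\<bar>\<bar>" by (rule abs_ge_self)
      also have "\<dots> \<le> C * jet_size (heights k) y"
        by (rule bspec[OF C(2)]) (use that(1) B(3) in blast)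
      finally show ?thesis .
    qed
    then show ?thesis using C(1) unfolding laplacian_def jet_size_def by blast
  qed
  show "height \<in> heights k" by (simp add: heights_def)
qed (rule assms(10))

end

section \<open>From charts to the manifold\<close>

theorem theorem1p3:
  fixes M :: "'a topology" and A :: "('a, 'm::finite) chart set"
    and g :: "('a, 'm) chart \<Rightarrow> real ^ 'm \<Rightarrow> real ^ 'm ^ 'm"
    and \<phi> :: "'a \<Rightarrow> (real ^ 'n::finite) \<times> real"
    and k :: nat and W :: "'a set"
  assumes "riemannian_manifold M A g" and "connected_space M"
    and "k \<ge> 1" and "smooth_sphere_map M A \<phi>" and "k_harmonic k A g \<phi>"
    and "openin M W" and "W \<noteq> {}" and "\<phi> ` W \<subseteq> equator"
  shows "\<phi> ` topspace M \<subseteq> equator"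
proof -
  interpret riemannian_manifold M A g by (rule assms(1))
  define vanish where "vanish U \<longleftrightarrow> openin M U \<and> (\<forall>q\<in>U. snd (\<phi> q) = 0)" for U
  define Z where "Z = \<Union> {U. vanish U}"
  have sphere: "norm (\<phi> q) = 1" if "q \<in> topspace M" for q
    using assms(4) that by (auto simp: smooth_sphere_map_def image_subset_iff)
  \<comment> \<open>Every point has a coordinate ball that lies in \<open>Z\<close> as soon as it meets \<open>Z\<close>.\<close>
  have local: "\<exists>N. openin M N \<and> q \<in> N \<and> (N \<inter> Z \<noteq> {} \<longrightarrow> vanish N)" if q: "q \<in> topspace M" for q
  proof -
    obtain c where c: "c \<in> A" "q \<in> fst c" using charts_cover q by blast
    note hom = chart_homeomorphic[OF c(1)]
    have fst_c: "fst c \<subseteq> topspace M" using chart_domain[OF c(1)] by (rule openin_subset)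
    have inj: "inj_on (snd c) (fst c)"
      using homeomorphic_imp_injective_map[OF hom] fst_c by (simp add: topspace_subtopology Int_absorb1)
    have inv: "chart_inv c (snd c q') = q'" if "q' \<in> fst c" for q'
      using inj that by (simp add: chart_inv_def)
    have inv_mem: "chart_inv c x \<in> fst c" if "x \<in> chart_image c" for x
      using that by (auto simp: chart_image_def inv)
    interpret sphere_map_chart "chart_image c" "g c" "\<phi> \<circ> chart_inv c"
    proof
      show "smooth_on (\<phi> \<circ> chart_inv c) (chart_image c)"
        using assms(4) c(1) by (simp add: smooth_sphere_map_def)
      show "norm ((\<phi> \<circ> chart_inv c) x) = 1" if "x \<in> chart_image c" for x
        using sphere inv_mem[OF that] fst_c by auto
    qed (use open_chart_image metric_smooth metric_sym metric_pos c(1) in auto)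
    obtain R where R: "0 < R" "ball (snd c q) R \<subseteq> chart_image c"
      using open_chart_image[OF c(1)] c(2) openE by (metis chart_image_def imageI)
    define B where "B = ball (snd c q) R"
    define N where "N = {q' \<in> fst c. snd c q' \<in> B}"
    have "openin (top_of_set (chart_image c)) B"
      using R(2) by (simp add: B_def open_openin_trans open_chart_image[OF c(1)] openin_open_eq)
    then have "openin (subtopology M (fst c)) {q' \<in> topspace (subtopology M (fst c)). snd c q' \<in> B}"
      by (rule openin_continuous_map_preimage[OF homeomorphic_imp_continuous_map[OF hom]])
    then have N: "openin M N"
      using fst_c chart_domain[OF c(1)] by (simp add: N_def topspace_subtopology Int_absorb1 openin_open_subtopology)
    have "q \<in> N" using c(2) R(1) by (simp add: N_def B_def)
    moreover have "vanish N" if meets: "N \<inter> Z \<noteq> {}"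
    proof -
      obtain U where U: "vanish U" "N \<inter> U \<noteq> {}" using meets unfolding Z_def by blast
      define W' where "W' = snd c ` (N \<inter> U)"
      have "openin M (N \<inter> U)" using N U(1) by (auto simp: vanish_def)
      then have "openin (subtopology M (fst c)) (N \<inter> U)"
        using chart_domain[OF c(1)] by (auto simp: openin_open_subtopology N_def)
      then have "openin (top_of_set (chart_image c)) W'"
        unfolding W'_def using homeomorphic_imp_open_map[OF hom] by (simp add: open_map_def)
      then have W': "open W'" using open_chart_image[OF c(1)] by (simp add: openin_open_eq)
      have height_B: "height x = 0" if "x \<in> B" for x
      proof (rule height_unique_continuation[OF assms(3) _ _ _ _ W' _ _ _ that])
        show "k_tension k (g c) (\<phi> \<circ> chart_inv c) x = 0" if "x \<in> chart_image c" for x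
          using assms(5) c(1) that by (auto simp: k_harmonic_def)
        show "open B" "connected B" "B \<subseteq> chart_image c" using R(2) by (auto simp: B_def)
        show "W' \<noteq> {}" "W' \<subseteq> B" using U(2) by (auto simp: W'_def N_def)
        show "height x = 0" if "x \<in> W'" for x
          using that U(1) by (auto simp: W'_def N_def height_def vanish_def inv)
      qed
      have "snd (\<phi> q') = 0" if "q' \<in> N" for q'
        using that height_B[of "snd c q'"] by (simp add: N_def height_def inv)
      then show ?thesis using N by (simp add: vanish_def)
    qed
    ultimately show ?thesis using N by blast
  qed
  have "openin M Z" unfolding Z_def by (auto simp: vanish_def)
  moreover have "openin M (topspace M - Z)"
  proof (subst openin_subopen, intro ballI)
    fix q assume q: "q \<in> topspace M - Z"
    then obtain N where N: "openin M N" "q \<in> N" "N \<inter> Z \<noteq> {} \<longrightarrow> vanish N" using local by blast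
    then have "N \<inter> Z = {}" using q unfolding Z_def by blast
    then show "\<exists>T. openin M T \<and> q \<in> T \<and> T \<subseteq> topspace M - Z"
      using N openin_subset[OF N(1)] by blast
  qed
  moreover have "Z \<subseteq> topspace M" using \<open>openin M Z\<close> by (rule openin_subset)
  ultimately have "Z = {} \<or> Z = topspace M"
    using assms(2) unfolding connected_space_clopen_in closedin_def by blast
  moreover have "vanish W" using assms(6,8) by (auto simp: vanish_def equator_def)
  then have "W \<subseteq> Z" unfolding Z_def by blast
  ultimately have "Z = topspace M" using assms(7) by blast
  then have "snd (\<phi> q) = 0" if "q \<in> topspace M" for q
    using that unfolding Z_def vanish_def by blast
  then show ?thesis using sphere by (auto simp: equator_def)
qed

end
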